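(* Let $(G,\sigma,K)$ be a Riemannian symmetric triple, with $\mathfrak{g}=\mathfrak{k}\oplus\mathfrak{p}$ the decomposition of the Lie algebra of $G$ into the $(+1)$- and $(-1)$-eigenspaces of $d\sigma$. Define $P=\exp(\mathfrak{p})$, $Q=\{g\sigma(g)^{-1}\mid g\in G\}$, $R=\{g\in G\mid \sigma(g)=g^{-1}\}$, $R^2=\{g^2\mid g\in R\}$, and let $R_0$ and $R'_0$ be, respectively, the connected component and the path component of $R$ containing the identity $e$. Then $$P=Q=R_0=R'_0=R^2.$$
   Context: A Riemannian symmetric triple $(G,\sigma,K)$ consists of a connected Lie group $G$, an involution $\sigma$ of $G$ (a Lie group automorphism with $\sigma^2=\mathrm{id}$), and the closed subgroup $K=\{g\in G\mid\sigma(g)=g\}$, such that there exists a $G$-invariant Riemannian structure on $G/K$. Let $\mathfrak{g}$ be the Lie algebra of $G$ and $d\sigma:\mathfrak{g}\to\mathfrak{g}$ the differential of $\sigma$; $\mathfrak{k}$ and $\mathfrak{p}$ denote the eigenspaces of $d\sigma$ with eigenvalues $1$ and $-1$, respectively, so $\mathfrak{g}=\mathfrak{k}\oplus\mathfrak{p}$. $R$ carries the subspace topology from $G$. *)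

theory Defs
  imports "HOL-Analysis.Analysis" "HOL-Algebra.Left_Coset"
begin

section \<open>Smooth maps between open subsets of finite-dimensional vector spaces\<close>

text \<open>
  Finite-dimensional model spaces are linear subspaces \<open>V\<close> of a Euclidean space \<open>'e\<close>; a type of
  class \<open>euclidean_space\<close> alone would exclude dimension 0 (which occurs: \<open>G/K\<close> is a point if
  \<open>\<sigma> = id\<close>).  In the following definition \<open>U\<close> is meant to be open in \<open>V\<close>.  The derivative within
  \<open>U\<close> is then uniquely determined on \<open>V\<close> (though not off \<open>V\<close>), so only the directional derivatives
  along vectors of \<open>V\<close> are required to be differentiable again.
\<close>

primrec Ck_on :: "nat \<Rightarrow> 'e::euclidean_space set \<Rightarrow> 'e set \<Rightarrow> ('e \<Rightarrow> 'f::real_normed_vector) \<Rightarrow> bool"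
  where
    "Ck_on 0 V U f \<longleftrightarrow> continuous_on U f"
  | "Ck_on (Suc k) V U f \<longleftrightarrow>
       (\<exists>f'. (\<forall>x\<in>U. (f has_derivative f' x) (at x within U)) \<and>
             (\<forall>v\<in>V. Ck_on k V U (\<lambda>x. f' x v)))"

definition smooth_on :: "'e::euclidean_space set \<Rightarrow> 'e set \<Rightarrow> ('e \<Rightarrow> 'f::real_normed_vector) \<Rightarrow> bool"
  where "smooth_on V U f \<longleftrightarrow> (\<forall>k. Ck_on k V U f)"


section \<open>Smooth manifolds\<close>

text \<open>A chart is a pair of its domain and its coordinate map.\<close>

type_synonym ('a, 'e) chart = "'a set \<times> ('a \<Rightarrow> 'e)"

record ('a, 'e) manifold =
  mtop :: "'a topology"
  model :: "'e set"
  charts :: "('a, 'e) chart set"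

definition is_chart :: "'a topology \<Rightarrow> 'e::euclidean_space set \<Rightarrow> ('a, 'e) chart \<Rightarrow> bool" where
  "is_chart T V c \<longleftrightarrow>
     openin T (fst c) \<and> openin (top_of_set V) (snd c ` fst c) \<and>
     homeomorphic_map (subtopology T (fst c)) (top_of_set (snd c ` fst c)) (snd c)"

text \<open>
  The coordinate representation of a map \<open>f\<close> with respect to a chart \<open>c\<close> of the source and a chart
  \<open>d\<close> of the target, together with its domain.  For \<open>f = id\<close> this is the change of coordinates.
\<close>

definition coord_dom :: "('a, 'e) chart \<Rightarrow> ('b, 'f) chart \<Rightarrow> ('a \<Rightarrow> 'b) \<Rightarrow> 'e set" where
  "coord_dom c d f = snd c ` (fst c \<inter> f -` fst d)"

definition coord_rep :: "('a, 'e) chart \<Rightarrow> ('b, 'f) chart \<Rightarrow> ('a \<Rightarrow> 'b) \<Rightarrow> 'e \<Rightarrow> 'f" where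
  "coord_rep c d f = snd d \<circ> f \<circ> inv_into (fst c) (snd c)"

definition coord_deriv ::
  "('a, 'e::euclidean_space) chart \<Rightarrow> ('b, 'f::euclidean_space) chart \<Rightarrow> ('a \<Rightarrow> 'b) \<Rightarrow> 'a \<Rightarrow> 'e \<Rightarrow> 'f"
  where
    "coord_deriv c d f p =
       frechet_derivative (coord_rep c d f) (at (snd c p) within coord_dom c d f)"

text \<open>The atlas is not required to be maximal; an atlas determines the smooth structure.\<close>

definition smooth_manifold :: "('a, 'e::euclidean_space) manifold \<Rightarrow> bool" where
  "smooth_manifold M \<longleftrightarrow>
     Hausdorff_space (mtop M) \<and> second_countable (mtop M) \<and> subspace (model M) \<and>
     (\<forall>c\<in>charts M. is_chart (mtop M) (model M) c) \<and>
     (\<Union>c\<in>charts M. fst c) = topspace (mtop M) \<and>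
     (\<forall>c\<in>charts M. \<forall>d\<in>charts M. smooth_on (model M) (coord_dom c d id) (coord_rep c d id))"

definition smooth_map ::
  "('a, 'e::euclidean_space) manifold \<Rightarrow> ('b, 'f::euclidean_space) manifold \<Rightarrow> ('a \<Rightarrow> 'b) \<Rightarrow> bool"
  where
    "smooth_map M N f \<longleftrightarrow>
       continuous_map (mtop M) (mtop N) f \<and>
       (\<forall>c\<in>charts M. \<forall>d\<in>charts N. smooth_on (model M) (coord_dom c d f) (coord_rep c d f))"

definition prod_manifold ::
  "('a, 'e) manifold \<Rightarrow> ('b, 'f) manifold \<Rightarrow> ('a \<times> 'b, 'e \<times> 'f) manifold" where
  "prod_manifold M N =
     \<lparr>mtop = prod_topology (mtop M) (mtop N),
      model = model M \<times> model N,
      charts = {(fst c \<times> fst d, map_prod (snd c) (snd d)) | c d. c \<in> charts M \<and> d \<in> charts N}\<rparr>"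

definition real_line :: "(real, real) manifold" where
  "real_line = \<lparr>mtop = euclideanreal, model = UNIV, charts = {(UNIV, id)}\<rparr>"


section \<open>Tangent vectors\<close>

text \<open>
  A tangent vector at \<open>p\<close> is a family of coordinate vectors, one for each chart around \<open>p\<close>, which
  transform into each other by the derivatives of the coordinate changes.  The vector space
  operations are pointwise.  Components at charts not containing \<open>p\<close> are set to 0, so that
  equality of tangent vectors at \<open>p\<close> is equality of functions.
\<close>

type_synonym ('a, 'e) tvec = "('a, 'e) chart \<Rightarrow> 'e"

definition tangent_space :: "('a, 'e::euclidean_space) manifold \<Rightarrow> 'a \<Rightarrow> ('a, 'e) tvec set" where
  "tangent_space M p =
     {X. (\<forall>c. if c \<in> charts M \<and> p \<in> fst c then X c \<in> model M else X c = 0) \<and>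
         (\<forall>c\<in>charts M. \<forall>d\<in>charts M. p \<in> fst c \<longrightarrow> p \<in> fst d \<longrightarrow> X d = coord_deriv c d id p (X c))}"

definition chart_at :: "('a, 'e) manifold \<Rightarrow> 'a \<Rightarrow> ('a, 'e) chart" where
  "chart_at M p = (SOME c. c \<in> charts M \<and> p \<in> fst c)"

text \<open>The differential of \<open>f\<close> at \<open>p\<close>; it does not depend on the chart chosen around \<open>p\<close>.\<close>

definition tangent_map ::
  "('a, 'e::euclidean_space) manifold \<Rightarrow> ('b, 'f::euclidean_space) manifold \<Rightarrow> ('a \<Rightarrow> 'b) \<Rightarrow> 'a \<Rightarrow>
    ('a, 'e) tvec \<Rightarrow> ('b, 'f) tvec" where
  "tangent_map M N f p X =
     (\<lambda>d. if d \<in> charts N \<and> f p \<in> fst d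
          then coord_deriv (chart_at M p) d f p (X (chart_at M p)) else 0)"

definition velocity :: "('a, 'e::euclidean_space) manifold \<Rightarrow> (real \<Rightarrow> 'a) \<Rightarrow> real \<Rightarrow> ('a, 'e) tvec"
  where
    "velocity M \<gamma> t =
       (\<lambda>d. if d \<in> charts M \<and> \<gamma> t \<in> fst d then vector_derivative (snd d \<circ> \<gamma>) (at t) else 0)"

text \<open>The tangent vector at \<open>p\<close> whose coordinate vector in the chart \<open>c\<close> is \<open>v\<close>.\<close>

definition coord_vector ::
  "('a, 'e::euclidean_space) manifold \<Rightarrow> ('a, 'e) chart \<Rightarrow> 'e \<Rightarrow> 'a \<Rightarrow> ('a, 'e) tvec" where
  "coord_vector M c v p = (\<lambda>d. if d \<in> charts M \<and> p \<in> fst d then coord_deriv c d id p v else 0)"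


section \<open>Riemannian metrics\<close>

definition riemannian_metric ::
  "('a, 'e::euclidean_space) manifold \<Rightarrow> ('a \<Rightarrow> ('a, 'e) tvec \<Rightarrow> ('a, 'e) tvec \<Rightarrow> real) \<Rightarrow> bool" where
  "riemannian_metric M h \<longleftrightarrow>
     (\<forall>p\<in>topspace (mtop M).
        (\<forall>X\<in>tangent_space M p. \<forall>Y\<in>tangent_space M p. h p X Y = h p Y X) \<and>
        (\<forall>X\<in>tangent_space M p. \<forall>Y\<in>tangent_space M p. \<forall>Z\<in>tangent_space M p. \<forall>a b.
           h p (\<lambda>c. a *\<^sub>R X c + b *\<^sub>R Y c) Z = a * h p X Z + b * h p Y Z) \<and>
        (\<forall>X\<in>tangent_space M p. X \<noteq> (\<lambda>c. 0) \<longrightarrow> h p X X > 0)) \<and>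
     (\<forall>c\<in>charts M. \<forall>v\<in>model M. \<forall>w\<in>model M.
        smooth_on (model M) (snd c ` fst c)
          ((\<lambda>p. h p (coord_vector M c v p) (coord_vector M c w p)) \<circ> inv_into (fst c) (snd c)))"


section \<open>Lie groups\<close>

definition lie_group :: "('a, 'b) monoid_scheme \<Rightarrow> ('a, 'e::euclidean_space) manifold \<Rightarrow> bool" where
  "lie_group G M \<longleftrightarrow>
     group G \<and> smooth_manifold M \<and> topspace (mtop M) = carrier G \<and>
     smooth_map (prod_manifold M M) M (\<lambda>(x, y). x \<otimes>\<^bsub>G\<^esub> y) \<and>
     smooth_map M M (\<lambda>x. inv\<^bsub>G\<^esub> x)"

text \<open>The Lie algebra as a vector space; its bracket is not needed here.\<close>

definition lie_algebra ::
  "('a, 'b) monoid_scheme \<Rightarrow> ('a, 'e::euclidean_space) manifold \<Rightarrow> ('a, 'e) tvec set" where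
  "lie_algebra G M = tangent_space M \<one>\<^bsub>G\<^esub>"

definition one_param_subgroup ::
  "('a, 'b) monoid_scheme \<Rightarrow> ('a, 'e::euclidean_space) manifold \<Rightarrow> (real \<Rightarrow> 'a) \<Rightarrow> bool" where
  "one_param_subgroup G M \<gamma> \<longleftrightarrow>
     smooth_map real_line M \<gamma> \<and> (\<forall>s t. \<gamma> (s + t) = \<gamma> s \<otimes>\<^bsub>G\<^esub> \<gamma> t)"

definition lie_exp ::
  "('a, 'b) monoid_scheme \<Rightarrow> ('a, 'e::euclidean_space) manifold \<Rightarrow> ('a, 'e) tvec \<Rightarrow> 'a" where
  "lie_exp G M X = (THE \<gamma>. one_param_subgroup G M \<gamma> \<and> velocity M \<gamma> 0 = X) 1"

definition lie_involution ::
  "('a, 'b) monoid_scheme \<Rightarrow> ('a, 'e::euclidean_space) manifold \<Rightarrow> ('a \<Rightarrow> 'a) \<Rightarrow> bool" where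
  "lie_involution G M \<sigma> \<longleftrightarrow>
     \<sigma> \<in> iso G G \<and> smooth_map M M \<sigma> \<and> (\<forall>g\<in>carrier G. \<sigma> (\<sigma> g) = g)"

definition differential_eigenspace ::
  "('a, 'b) monoid_scheme \<Rightarrow> ('a, 'e::euclidean_space) manifold \<Rightarrow> ('a \<Rightarrow> 'a) \<Rightarrow> real \<Rightarrow>
    ('a, 'e) tvec set" where
  "differential_eigenspace G M \<sigma> r =
     {X \<in> lie_algebra G M. tangent_map M M \<sigma> \<one>\<^bsub>G\<^esub> X = (\<lambda>c. r *\<^sub>R X c)}"


section \<open>Riemannian symmetric triples\<close>

text \<open>
  \<open>B\<close> is the homogeneous space \<open>G/K\<close> of left cosets with its canonical manifold structure, that is,
  the unique smooth structure for which the projection is a smooth submersion.  Since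
  \<open>dim G/K \<le> dim G\<close>, it may be modelled on a subspace of the same Euclidean space as \<open>G\<close>.
\<close>

definition homogeneous_space ::
  "('a, 'b) monoid_scheme \<Rightarrow> ('a, 'e::euclidean_space) manifold \<Rightarrow> 'a set \<Rightarrow>
    ('a set, 'e) manifold \<Rightarrow> bool" where
  "homogeneous_space G M K B \<longleftrightarrow>
     smooth_manifold B \<and> topspace (mtop B) = lcosets\<^bsub>G\<^esub> K \<and>
     quotient_map (mtop M) (mtop B) (\<lambda>g. g <#\<^bsub>G\<^esub> K) \<and>
     smooth_map M B (\<lambda>g. g <#\<^bsub>G\<^esub> K) \<and>
     (\<forall>g\<in>carrier G.
        tangent_map M B (\<lambda>g. g <#\<^bsub>G\<^esub> K) g ` tangent_space M g = tangent_space B (g <#\<^bsub>G\<^esub> K))"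

text \<open>\<open>g <# x\<close> is also the action of \<open>g \<in> G\<close> on \<open>x \<in> G/K\<close>.\<close>

definition invariant_metric ::
  "('a, 'b) monoid_scheme \<Rightarrow> ('a set, 'e::euclidean_space) manifold \<Rightarrow>
    ('a set \<Rightarrow> ('a set, 'e) tvec \<Rightarrow> ('a set, 'e) tvec \<Rightarrow> real) \<Rightarrow> bool" where
  "invariant_metric G B h \<longleftrightarrow>
     (\<forall>g\<in>carrier G. \<forall>x\<in>topspace (mtop B). \<forall>X\<in>tangent_space B x. \<forall>Y\<in>tangent_space B x.
        h (g <#\<^bsub>G\<^esub> x)
          (tangent_map B B (\<lambda>y. g <#\<^bsub>G\<^esub> y) x X)
          (tangent_map B B (\<lambda>y. g <#\<^bsub>G\<^esub> y) x Y) = h x X Y)"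

definition riemannian_symmetric_triple ::
  "('a, 'b) monoid_scheme \<Rightarrow> ('a, 'e::euclidean_space) manifold \<Rightarrow> ('a \<Rightarrow> 'a) \<Rightarrow> 'a set \<Rightarrow> bool"
  where
    "riemannian_symmetric_triple G M \<sigma> K \<longleftrightarrow>
       lie_group G M \<and> connected_space (mtop M) \<and> lie_involution G M \<sigma> \<and>
       K = {g \<in> carrier G. \<sigma> g = g} \<and>
       (\<exists>B h. homogeneous_space G M K B \<and> riemannian_metric B h \<and> invariant_metric G B h)"

end

theory Submission
  imports Defs
begin

text \<open>
  The inclusions \<open>exp(\<pp>) \<subseteq> R\<^sup>2 \<subseteq> Q\<close> are clear.  The group \<open>G\<close> acts on \<open>R\<close> by \<open>h \<cdot> r = h r \<sigma>(h)\<^sup>-\<^sup>1\<close>;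
  the orbits are open because elements of \<open>R\<close> near \<open>1\<close> have square roots in \<open>R\<close>, so \<open>Q\<close>, the connected
  orbit of \<open>1\<close>, is open and closed in \<open>R\<close> and hence equals \<open>R\<^sub>0\<close>.  The paths \<open>t \<mapsto> exp(t X)\<close> show
  \<open>exp(\<pp>) \<subseteq> R'\<^sub>0\<close>.  It remains to see \<open>Q \<subseteq> exp(\<pp>)\<close>, that is \<open>G = exp(\<pp>) K\<close>.

  In place of the Hopf-Rinow theorem we minimize, for given \<open>g\<close>, the energy \<open>\<Sum> |X\<^sub>i|\<^sup>2\<close> over all
  \<open>X\<^sub>1, \<dots>, X\<^sub>n\<close> in a small ball of \<open>\<pp>\<close> with \<open>g \<in> exp X\<^sub>1 \<cdots> exp X\<^sub>n K\<close>, the norm being the one induced by the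
  invariant metric; it is \<open>Ad(K)\<close>-invariant.  Two consecutive small factors \<open>exp X exp Y = exp Z k\<close> satisfy
  \<open>|Z|\<^sup>2/2 < |X|\<^sup>2 + |Y|\<^sup>2\<close> unless \<open>X = Y\<close>: exchanging \<open>X\<close> and \<open>Y\<close> changes \<open>Z\<close> only by an element of
  \<open>Ad(K)\<close>, so \<open>|Z|\<^sup>2 - |X + Y|\<^sup>2\<close> is even in \<open>X - Y\<close>, vanishes for \<open>X = Y\<close>, and is of second order in
  \<open>X - Y\<close> with a small constant.  Hence all \<open>X\<^sub>i\<close> of a minimum agree.

  The exponential map is obtained without differential equations, as the limit of the \<open>2\<^sup>n\<close>-th powers
  of the points with coordinates \<open>v/2\<^sup>n\<close>.  The analysis only uses maps that are Lipschitz close to their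
  derivative at \<open>0\<close> and have second differences of second order (\<open>c11\<close>).
\<close>


section \<open>Functions with quadratic remainder\<close>

text \<open>Merging two factors gains only a quadratic amount: by the parallelogram law
  \<open>2 (|X|^2 + |Y|^2) = |X + Y|^2 + |X - Y|^2\<close>. The remainder \<open>Z - (X + Y)\<close>
  vanishes for \<open>X = Y\<close>, but a Lipschitz bound makes it only linear in
  \<open>X - Y\<close>, and for \<open>X\<close> close to \<open>Y\<close> a linear error would
  outweigh the gain. Averaging over the exchange of \<open>X\<close> and \<open>Y\<close> leaves the
  sum of two remainders, which is a second difference. This is why \<open>c11\<close> contains an
  estimate of second differences, carried through composition, inversion and the limit that defines
  the exponential map. A minimum exists because the number of factors is fixed, the factors range
  over a compact ball and \<open>K\<close> is closed. Once all factors agree, their product is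
  \<open>exp (n X)\<close>, so geodesics never have to be studied beyond the small ball. Model
  spaces are linear subspaces \<open>V\<close> of a Euclidean space, so a derivative within an open
  subset of \<open>V\<close> is determined on \<open>V\<close> only. Derivatives are therefore
  explicit arguments and are compared on \<open>V\<close> only.\<close>

definition c11_on ::
  "'e::real_normed_vector set \<Rightarrow> real \<Rightarrow> real \<Rightarrow> ('e \<Rightarrow> 'f::real_normed_vector) \<Rightarrow> ('e \<Rightarrow> 'f) \<Rightarrow> bool"
  where "c11_on V r C f L \<longleftrightarrow>
    (\<forall>x\<in>V. \<forall>y\<in>V. norm x < r \<longrightarrow> norm y < r \<longrightarrow>
       norm (f x - f y - L (x - y)) \<le> C * (norm x + norm y) * norm (x - y) \<and>
       norm (f x + f y - 2 *\<^sub>R f ((1/2) *\<^sub>R (x + y))) \<le> C * (norm (x - y))\<^sup>2)"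

text \<open>Estimates of the kind that a function with Lipschitz derivative satisfies near
  \<open>0\<close>. They mention only values of \<open>f\<close>, so they pass to pointwise limits
  and to inverses, and they make sense on a proper subspace \<open>V\<close>, where values of
  \<open>L\<close> off \<open>V\<close> do not enter.\<close>

definition c11 ::
  "'e::real_normed_vector set \<Rightarrow> ('e \<Rightarrow> 'f::real_normed_vector) \<Rightarrow> ('e \<Rightarrow> 'f) \<Rightarrow> bool"
  where "c11 V f L \<longleftrightarrow> bounded_linear L \<and> f 0 = 0 \<and> (\<exists>r>0. \<exists>C\<ge>0. c11_on V r C f L)"

lemma c11I:
  "bounded_linear L \<Longrightarrow> f 0 = 0 \<Longrightarrow> 0 < r \<Longrightarrow> 0 \<le> C \<Longrightarrow> c11_on V r C f L \<Longrightarrow> c11 V f L"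
  unfolding c11_def by blast

lemma c11_onD:
  assumes "c11_on V r C f L" "x \<in> V" "y \<in> V" "norm x < r" "norm y < r"
  shows "norm (f x - f y - L (x - y)) \<le> C * (norm x + norm y) * norm (x - y)"
    and "norm (f x + f y - 2 *\<^sub>R f ((1/2) *\<^sub>R (x + y))) \<le> C * (norm (x - y))\<^sup>2"
  using assms unfolding c11_on_def by auto

lemma c11_on_mono:
  assumes "c11_on V r C f L" "s \<le> r" "C \<le> D"
  shows "c11_on V s D f L"
  unfolding c11_on_def
proof (intro ballI impI conjI)
  fix x y assume *: "x \<in> V" "y \<in> V" "norm x < s" "norm y < s"
  have "norm (f x - f y - L (x - y)) \<le> C * (norm x + norm y) * norm (x - y)"
    using c11_onD(1)[OF assms(1)] * assms(2) by force
  also have "\<dots> \<le> D * (norm x + norm y) * norm (x - y)"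
    using assms(3) by (intro mult_right_mono) auto
  finally show "norm (f x - f y - L (x - y)) \<le> D * (norm x + norm y) * norm (x - y)" .
  have "norm (f x + f y - 2 *\<^sub>R f ((1/2) *\<^sub>R (x + y))) \<le> C * (norm (x - y))\<^sup>2"
    using c11_onD(2)[OF assms(1)] * assms(2) by force
  also have "\<dots> \<le> D * (norm (x - y))\<^sup>2"
    using assms(3) by (intro mult_right_mono) auto
  finally show "norm (f x + f y - 2 *\<^sub>R f ((1/2) *\<^sub>R (x + y))) \<le> D * (norm (x - y))\<^sup>2" .
qed

lemma norm_half_sum_less: "norm x < r \<Longrightarrow> norm y < r \<Longrightarrow> norm ((1/2) *\<^sub>R (x + y)) < (r::real)"
  using norm_triangle_ineq[of x y] by simp

lemma subspace_half_sum: "subspace V \<Longrightarrow> x \<in> V \<Longrightarrow> y \<in> V \<Longrightarrow> (1/2) *\<^sub>R (x + y) \<in> V"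
  by (simp add: subspace_add subspace_scale)

lemma c11_on_cong:
  assumes "c11_on V r C f L" "subspace V" "\<And>x. x \<in> V \<Longrightarrow> norm x < r \<Longrightarrow> f x = g x"
    "\<And>x. x \<in> V \<Longrightarrow> L x = M x"
  shows "c11_on V r C g M"
  using assms(1) norm_half_sum_less subspace_half_sum[OF assms(2)] assms(3,4) subspace_diff[OF assms(2)]
  unfolding c11_on_def by metis

lemma c11_cong:
  assumes "c11 V f L" "subspace V" "0 < r" "\<And>x. x \<in> V \<Longrightarrow> norm x < r \<Longrightarrow> f x = g x"
    "bounded_linear M" "\<And>x. x \<in> V \<Longrightarrow> L x = M x"
  shows "c11 V g M"
proof -
  obtain s C where sC: "s > 0" "C \<ge> 0" "c11_on V s C f L" "f 0 = 0"
    using assms(1) unfolding c11_def by auto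
  have "c11_on V (min r s) C g M"
    using c11_on_cong[OF c11_on_mono[OF sC(3), of "min r s" C] assms(2)] assms(4,6) by force
  moreover have "g 0 = 0" using assms(3) assms(4)[of 0] sC(4) subspace_0[OF assms(2)] by simp
  ultimately show ?thesis
    using assms sC by (intro c11I[of _ _ "min r s" C]) auto
qed

lemma c11_linear: "bounded_linear L \<Longrightarrow> c11 V L L"
proof -
  assume L: "bounded_linear L"
  interpret L: bounded_linear L by fact
  have "c11_on V 1 0 L L"
    unfolding c11_on_def by (simp add: L.diff L.add L.scaleR)
  then show ?thesis using L L.zero by (intro c11I[of _ _ 1 0]) auto
qed

lemma c11_on_lipschitz:
  assumes "c11_on V r C f L" "bounded_linear L" "0 \<le> C" "x \<in> V" "y \<in> V" "norm x < r" "norm y < r"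
  shows "norm (f x - f y) \<le> (onorm L + 2 * C * r) * norm (x - y)"
proof -
  have "norm (f x - f y) \<le> norm (f x - f y - L (x - y)) + norm (L (x - y))"
    by (metis diff_add_cancel norm_triangle_ineq)
  also have "\<dots> \<le> C * (norm x + norm y) * norm (x - y) + onorm L * norm (x - y)"
    using c11_onD(1)[OF assms(1,4-7)] onorm[OF assms(2)] by (intro add_mono) auto
  also have "\<dots> \<le> C * (2 * r) * norm (x - y) + onorm L * norm (x - y)"
    using assms by (intro add_mono mult_right_mono mult_left_mono) auto
  finally show ?thesis by (simp add: algebra_simps)
qed

lemma c11_compose:
  fixes f :: "'e::real_normed_vector \<Rightarrow> 'f::real_normed_vector" and g :: "'f \<Rightarrow> 'g::real_normed_vector"
  assumes f: "c11 V f L" and g: "c11 W g M" and V: "subspace V" and W: "subspace W"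
    and fW: "\<exists>r>0. \<forall>x\<in>V. norm x < r \<longrightarrow> f x \<in> W"
  shows "c11 V (\<lambda>x. g (f x)) (\<lambda>x. M (L x))"
proof -
  obtain r1 C where 1: "r1 > 0" "C \<ge> 0" "c11_on V r1 C f L" "f 0 = 0" "bounded_linear L"
    using f unfolding c11_def by auto
  obtain s D where 2: "s > 0" "D \<ge> 0" "c11_on W s D g M" "g 0 = 0" "bounded_linear M"
    using g unfolding c11_def by auto
  obtain r0 where r0: "r0 > 0" "\<And>x. x \<in> V \<Longrightarrow> norm x < r0 \<Longrightarrow> f x \<in> W" using fW by auto
  define K where "K = onorm L + 2 * C * r1"
  have K0: "K \<ge> 0" using onorm_pos_le[OF 1(5)] 1 by (simp add: K_def)
  define N where "N = onorm M + 2 * D * s"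
  have N0: "N \<ge> 0" using onorm_pos_le[OF 2(5)] 2 by (simp add: N_def)
  have M0: "onorm M \<ge> 0" using onorm_pos_le[OF 2(5)] .
  define r where "r = min (min r0 r1) (s / (K + 1))"
  have r: "r > 0" "r \<le> r0" "r \<le> r1" using r0 1 2 K0 by (auto simp: r_def)
  have rs: "K * t < s" if "0 \<le> t" "t < r" for t
  proof -
    have "t < s / (K + 1)" using that by (simp add: r_def)
    then have "t * (K + 1) < s" using K0 by (simp add: pos_less_divide_eq)
    then show ?thesis using that by (simp add: algebra_simps)
  qed
  have lip: "norm (f x - f y) \<le> K * norm (x - y)" if "x \<in> V" "y \<in> V" "norm x < r" "norm y < r" for x y
    using c11_on_lipschitz[OF 1(3,5,2) that(1,2)] that r by (simp add: K_def)
  have bd: "norm (f x) \<le> K * norm x" if "x \<in> V" "norm x < r" for x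
    using lip[of x 0] that r 1 subspace_0[OF V] by simp
  have fs: "norm (f x) < s" if "x \<in> V" "norm x < r" for x
    using bd[OF that] rs[of "norm x"] that by simp
  have fW': "f x \<in> W" if "x \<in> V" "norm x < r" for x using r0 r that by simp
  define E where "E = D * K * K + onorm M * C + N * C"
  have E: "E \<ge> 0" using K0 N0 M0 1 2 by (simp add: E_def)
  interpret M: bounded_linear M using 2 by simp
  interpret L: bounded_linear L using 1 by simp
  have "c11_on V r E (\<lambda>x. g (f x)) (\<lambda>x. M (L x))"
    unfolding c11_on_def
  proof (intro ballI impI conjI)
    fix x y assume *: "x \<in> V" "y \<in> V" "norm x < r" "norm y < r"
    have 4: "norm (f x - f y - L (x - y)) \<le> C * (norm x + norm y) * norm (x - y)"
      using c11_onD(1)[OF 1(3)] * r by force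
    have 5: "norm (g (f x) - g (f y) - M (f x - f y)) \<le> D * (norm (f x) + norm (f y)) * norm (f x - f y)"
      using c11_onD(1)[OF 2(3)] * fs fW' by force
    have "g (f x) - g (f y) - M (L (x - y)) = (g (f x) - g (f y) - M (f x - f y)) + M (f x - f y - L (x - y))"
      by (simp add: M.diff)
    then have "norm (g (f x) - g (f y) - M (L (x - y))) \<le>
       norm (g (f x) - g (f y) - M (f x - f y)) + norm (M (f x - f y - L (x - y)))"
      by (simp only: norm_triangle_ineq)
    also have "\<dots> \<le> D * (norm (f x) + norm (f y)) * norm (f x - f y)
        + onorm M * (C * (norm x + norm y) * norm (x - y))"
      using 5 onorm[OF 2(5), of "f x - f y - L (x - y)"] mult_left_mono[OF 4 M0] by linarith
    also have "D * (norm (f x) + norm (f y)) * norm (f x - f y) \<le>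
       D * (K * norm x + K * norm y) * (K * norm (x - y))"
      using bd lip * 2 K0 by (intro mult_mono add_mono) auto
    finally have "norm (g (f x) - g (f y) - M (L (x - y))) \<le> (D * K * K + onorm M * C) * (norm x + norm y) * norm (x - y)"
      by (simp add: algebra_simps)
    also have "\<dots> \<le> E * (norm x + norm y) * norm (x - y)"
      using N0 1 by (intro mult_right_mono) (auto simp: E_def)
    finally show "norm (g (f x) - g (f y) - M (L (x - y))) \<le> E * (norm x + norm y) * norm (x - y)" .
    \<comment> \<open>The second difference of the composition is compared with that of
      \<open>g\<close> at \<open>f x\<close> and \<open>f y\<close>: the midpoint \<open>v\<close>
      misses \<open>f m\<close> by half the second difference of \<open>f\<close>, and
      \<open>g\<close> is Lipschitz with constant \<open>N\<close>.\<close>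
    define m where "m = (1/2) *\<^sub>R (x + y)"
    define v where "v = (1/2) *\<^sub>R (f x + f y)"
    have m: "m \<in> V" "norm m < r"
      using norm_half_sum_less[OF *(3,4)] subspace_half_sum[OF V *(1,2)] unfolding m_def by blast+
    have v: "v \<in> W" "norm v < s"
      using norm_half_sum_less[OF fs[OF *(1,3)] fs[OF *(2,4)]] subspace_half_sum[OF W fW'[OF *(1,3)] fW'[OF *(2,4)]]
      unfolding v_def by blast+
    have 6: "norm (f x + f y - 2 *\<^sub>R f m) \<le> C * (norm (x - y))\<^sup>2"
      using c11_onD(2)[OF 1(3)] * r unfolding m_def by force
    have 7: "norm (g (f x) + g (f y) - 2 *\<^sub>R g v) \<le> D * (norm (f x - f y))\<^sup>2"
      using c11_onD(2)[OF 2(3)] * fs fW' unfolding v_def by force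
    have 8: "norm (g v - g (f m)) \<le> N * norm (v - f m)"
      using c11_on_lipschitz[OF 2(3,5,2) v(1) fW'[OF m] v(2) fs[OF m]] by (simp add: N_def)
    have 9: "2 * norm (v - f m) = norm (f x + f y - 2 *\<^sub>R f m)"
    proof -
      have "f x + f y - 2 *\<^sub>R f m = 2 *\<^sub>R (v - f m)" by (simp add: v_def algebra_simps)
      then show ?thesis by simp
    qed
    have 10: "D * (norm (f x - f y))\<^sup>2 \<le> D * (K * norm (x - y))\<^sup>2"
      using lip * 2 by (intro mult_left_mono power_mono) auto
    have 11: "2 * norm (g v - g (f m)) \<le> N * (C * (norm (x - y))\<^sup>2)"
      using mult_left_mono[OF 8, of 2] mult_left_mono[OF 6 N0] unfolding 9[symmetric] by simp
    have "g (f x) + g (f y) - 2 *\<^sub>R g (f m) = (g (f x) + g (f y) - 2 *\<^sub>R g v) + 2 *\<^sub>R (g v - g (f m))"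
      by (simp add: algebra_simps)
    then have "norm (g (f x) + g (f y) - 2 *\<^sub>R g (f m)) \<le> norm (g (f x) + g (f y) - 2 *\<^sub>R g v) + 2 * norm (g v - g (f m))"
      by (metis norm_triangle_ineq norm_scaleR abs_numeral)
    also have "\<dots> \<le> D * (K * norm (x - y))\<^sup>2 + N * (C * (norm (x - y))\<^sup>2)"
      using 7 10 11 by linarith
    also have "\<dots> = (D * K * K + N * C) * (norm (x - y))\<^sup>2"
      by (simp add: power2_eq_square algebra_simps)
    also have "\<dots> \<le> E * (norm (x - y))\<^sup>2"
      using M0 1 by (intro mult_right_mono) (auto simp: E_def)
    finally show "norm (g (f x) + g (f y) - 2 *\<^sub>R g (f ((1/2) *\<^sub>R (x + y)))) \<le> E * (norm (x - y))\<^sup>2"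
      by (simp add: m_def)
  qed
  then show ?thesis
    using bounded_linear_compose[OF 2(5) 1(5)] r E 1 2 by (intro c11I[of _ _ r E]) auto
qed

lemma c11_Pair:
  assumes f: "c11 V f L" and g: "c11 V g M"
  shows "c11 V (\<lambda>x. (f x, g x)) (\<lambda>x. (L x, M x))"
proof -
  obtain r C where 1: "r > 0" "C \<ge> 0" "c11_on V r C f L" "f 0 = 0" "bounded_linear L"
    using f unfolding c11_def by auto
  obtain s D where 2: "s > 0" "D \<ge> 0" "c11_on V s D g M" "g 0 = 0" "bounded_linear M"
    using g unfolding c11_def by auto
  have "c11_on V (min r s) (C + D) (\<lambda>x. (f x, g x)) (\<lambda>x. (L x, M x))"
    unfolding c11_on_def
  proof (intro ballI impI conjI)
    fix x y assume "x \<in> V" "y \<in> V" "norm x < min r s" "norm y < min r s"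
    then have *: "x \<in> V" "y \<in> V" "norm x < r" "norm y < r" "norm x < s" "norm y < s" by auto
    show "norm ((f x, g x) - (f y, g y) - (L (x - y), M (x - y))) \<le> (C + D) * (norm x + norm y) * norm (x - y)"
      using c11_onD(1)[OF 1(3) *(1-4)] c11_onD(1)[OF 2(3) *(1,2,5,6)]
        norm_Pair_le[of "f x - f y - L (x - y)" "g x - g y - M (x - y)"]
      by (simp add: algebra_simps)
    show "norm ((f x, g x) + (f y, g y) - 2 *\<^sub>R (f ((1/2) *\<^sub>R (x + y)), g ((1/2) *\<^sub>R (x + y))))
      \<le> (C + D) * (norm (x - y))\<^sup>2"
      using c11_onD(2)[OF 1(3) *(1-4)] c11_onD(2)[OF 2(3) *(1,2,5,6)]
        norm_Pair_le[of "f x + f y - 2 *\<^sub>R f ((1/2) *\<^sub>R (x + y))" "g x + g y - 2 *\<^sub>R g ((1/2) *\<^sub>R (x + y))"]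
      by (simp add: distrib_right)
  qed
  then show ?thesis
    using bounded_linear_Pair[OF 1(5) 2(5)] 1 2
    by (intro c11I[of _ _ "min r s" "C + D"]) (auto simp: zero_prod_def)
qed

lemma c11_linear_comp:
  assumes "c11 V f L" "bounded_linear M" "subspace V"
  shows "c11 V (\<lambda>x. M (f x)) (\<lambda>x. M (L x))"
proof -
  have "\<exists>r>0::real. \<forall>x\<in>V. norm x < r \<longrightarrow> f x \<in> UNIV" by (intro exI[of _ 1]) simp
  from c11_compose[OF assms(1) c11_linear[OF assms(2), of UNIV] assms(3) subspace_UNIV this]
  show ?thesis .
qed

lemma c11_diff:
  assumes "c11 V f L" "c11 V g M" "subspace V"
  shows "c11 V (\<lambda>x. f x - g x) (\<lambda>x. L x - M x)"
  using c11_linear_comp[OF c11_Pair[OF assms(1,2)]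
      bounded_linear_sub[OF bounded_linear_fst bounded_linear_snd] assms(3)]
  by (simp only: fst_conv snd_conv)

lemma c11_derivative:
  assumes f: "c11 V f L" and V: "subspace V"
  shows "(f has_derivative L) (at 0 within V)"
proof -
  obtain r C where 1: "r > 0" "C \<ge> 0" "c11_on V r C f L" "f 0 = 0" "bounded_linear L"
    using f unfolding c11_def by auto
  have "((\<lambda>y. C * norm y) \<longlongrightarrow> C * norm (0::'a)) (at 0 within V)"
    by (intro tendsto_intros)
  moreover have "norm (f y - f 0 - L (y - 0)) / norm (y - 0) \<le> C * norm y"
    if "y \<in> V" "y \<noteq> 0" "dist y 0 < r" for y
    using c11_onD(1)[OF 1(3), of y 0] that subspace_0[OF V] 1(1) by (simp add: divide_le_eq)
  ultimately show ?thesis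
    using 1 by (intro has_derivativeI_sandwich[of r]) auto
qed

text \<open>The remainder is at most \<open>C * |x i|^2\<close>. After multiplication by
  \<open>s i\<close> it is bounded by \<open>C * |s i x i| * |x i|\<close>, a convergent factor
  times one that tends to \<open>0\<close>.\<close>

lemma c11_tendsto:
  assumes f: "c11 V f L" and V: "subspace V" and x: "\<forall>\<^sub>F i in F. x i \<in> V" "(x \<longlongrightarrow> 0) F"
    and sx: "((\<lambda>i. s i *\<^sub>R x i) \<longlongrightarrow> v) F"
  shows "((\<lambda>i. f (x i)) \<longlongrightarrow> 0) F" and "((\<lambda>i. s i *\<^sub>R f (x i)) \<longlongrightarrow> L v) F"
proof -
  obtain r C where 1: "r > 0" "C \<ge> 0" "c11_on V r C f L" "f 0 = 0" "bounded_linear L"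
    using f unfolding c11_def by auto
  interpret L: bounded_linear L using 1 by simp
  have "\<forall>\<^sub>F i in F. norm (x i) < r"
    using tendstoD[OF x(2) 1(1)] by simp
  with x(1) have ev: "\<forall>\<^sub>F i in F. norm (f (x i) - L (x i)) \<le> C * norm (x i) * norm (x i)"
  proof eventually_elim
    case (elim i)
    then show ?case
      using c11_onD(1)[OF 1(3), of "x i" 0] subspace_0[OF V] 1 by simp
  qed
  have nx: "((\<lambda>i. norm (x i)) \<longlongrightarrow> 0) F" using x(2) tendsto_norm_zero by blast
  have "((\<lambda>i. C * norm (x i) * norm (x i)) \<longlongrightarrow> C * 0 * 0) F"
    by (intro tendsto_intros nx)
  then have "((\<lambda>i. f (x i) - L (x i)) \<longlongrightarrow> 0) F"
    using ev by (intro Lim_null_comparison[OF ev]) simp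
  from tendsto_add[OF this L.tendsto[OF x(2)]] show "((\<lambda>i. f (x i)) \<longlongrightarrow> 0) F" by (simp add: L.zero)
  have t: "((\<lambda>i. C * norm (s i *\<^sub>R x i) * norm (x i)) \<longlongrightarrow> 0) F"
    using tendsto_mult[OF tendsto_mult[OF tendsto_const[of C] tendsto_norm[OF sx]] nx] by simp
  have e: "\<forall>\<^sub>F i in F. norm (s i *\<^sub>R (f (x i) - L (x i))) \<le> C * norm (s i *\<^sub>R x i) * norm (x i)"
    using ev
  proof eventually_elim
    case (elim i)
    show ?case using mult_left_mono[OF elim, of "\<bar>s i\<bar>"] by (simp add: mult_ac)
  qed
  have "((\<lambda>i. s i *\<^sub>R (f (x i) - L (x i))) \<longlongrightarrow> 0) F"
    by (rule Lim_null_comparison[OF e t])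
  from tendsto_add[OF this L.tendsto[OF sx]] show "((\<lambda>i. s i *\<^sub>R f (x i)) \<longlongrightarrow> L v) F"
    by (simp add: L.scaleR scaleR_right_diff_distrib)
qed

text \<open>\<open>A x\<close> is the limit of the quotients \<open>2^n f (x / 2^n)\<close>, which
  eventually lie in the closed subspace \<open>W\<close>.\<close>

lemma c11_derivative_range:
  assumes f: "c11 S f A" and S: "subspace S" and W: "closed W" "subspace W"
    and r: "r > 0" "\<And>x. x \<in> S \<Longrightarrow> norm x < r \<Longrightarrow> f x \<in> W" and x: "x \<in> S"
  shows "A x \<in> W"
proof -
  define y where "y n = (1/2::real)^n *\<^sub>R x" for n
  have yS: "y n \<in> S" for n using subspace_scale[OF S x] by (simp add: y_def)
  have "(\<lambda>n. (1/2::real)^n) \<longlonglongrightarrow> 0" by (rule LIMSEQ_realpow_zero) auto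
  from tendsto_scaleR[OF this tendsto_const[of x]] have y0: "y \<longlonglongrightarrow> 0" by (simp add: y_def[abs_def])
  have "2^n *\<^sub>R y n = x" for n by (simp add: y_def power_mult_distrib[symmetric])
  then have "(\<lambda>n. 2^n *\<^sub>R y n) \<longlonglongrightarrow> x" by simp
  from c11_tendsto(2)[OF f S always_eventually[OF allI[OF yS]] y0 this]
  have lim: "(\<lambda>n. 2^n *\<^sub>R f (y n)) \<longlonglongrightarrow> A x" .
  have "\<forall>\<^sub>F n in sequentially. norm (y n) < r"
    using order_tendstoD(2)[OF tendsto_norm[OF y0], of r] r(1) by simp
  then have "\<forall>\<^sub>F n in sequentially. 2^n *\<^sub>R f (y n) \<in> W"
    by (rule eventually_mono) (intro subspace_scale[OF W(2)] r(2) yS)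
  from Lim_in_closed_set[OF W(1) this _ lim] show ?thesis by simp
qed

text \<open>Solving \<open>f x = y\<close> is a fixed point problem for
  \<open>x \<mapsto> y + x - f x\<close>, a contraction near \<open>0\<close> because
  \<open>f\<close> is Lipschitz close to the identity. \<open>fV\<close> keeps the iteration inside
  \<open>V\<close>.\<close>

lemma c11_inverse:
  fixes f :: "'e::euclidean_space \<Rightarrow> 'e"
  assumes f: "c11 V f L" and V: "subspace V" and L: "\<And>x. x \<in> V \<Longrightarrow> L x = x"
    and fV: "\<exists>r>0. \<forall>x\<in>V. norm x < r \<longrightarrow> f x \<in> V"
  obtains g r where "c11 V g (\<lambda>x. x)" "r > 0"
    "\<And>y. y \<in> V \<Longrightarrow> norm y < r \<Longrightarrow> g y \<in> V \<and> f (g y) = y"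
    "\<And>x. x \<in> V \<Longrightarrow> norm x < r \<Longrightarrow> f x \<in> V \<and> g (f x) = x"
proof -
  obtain r1 C where 1: "r1 > 0" "C \<ge> 0" "c11_on V r1 C f L" "f 0 = 0" "bounded_linear L"
    using f unfolding c11_def by auto
  obtain r0 where r0: "r0 > 0" "\<And>x. x \<in> V \<Longrightarrow> norm x < r0 \<Longrightarrow> f x \<in> V" using fV by auto
  \<comment> \<open>This radius gives \<open>4 C r <= 1\<close>, hence
    \<open>C (|x| + |y|) <= 1/2\<close> on the ball.\<close>
  define r where "r = min (min r0 r1) (1 / (4 * (C + 1)))"
  have r: "r > 0" "r \<le> r0" "r \<le> r1" using r0 1 by (auto simp: r_def)
  have rC: "4 * C * r \<le> 1"
  proof -
    have "4 * (C + 1) * r \<le> 4 * (C + 1) * (1 / (4 * (C + 1)))"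
      using 1 by (intro mult_left_mono) (auto simp: r_def)
    then have "4 * (C + 1) * r \<le> 1" using 1 by simp
    then show ?thesis using r by (simp add: algebra_simps)
  qed
  have C1: "c11_on V r C f L" using c11_on_mono[OF 1(3) r(3)] by simp
  have fV': "f x \<in> V" if "x \<in> V" "norm x < r" for x using r0 r that by simp
  have q: "norm (f x - f y - (x - y)) \<le> C * (norm x + norm y) * norm (x - y)"
    if "x \<in> V" "y \<in> V" "norm x < r" "norm y < r" for x y
    using c11_onD(1)[OF C1 that] L[of "x - y"] subspace_diff[OF V that(1,2)] by simp
  have half: "norm (f x - f y - (x - y)) \<le> (1/2) * norm (x - y)"
    if "x \<in> V" "y \<in> V" "norm x < r" "norm y < r" for x y
  proof -
    have "C * (norm x + norm y) \<le> C * (2 * r)" using that 1 by (intro mult_left_mono) auto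
    also have "\<dots> \<le> 1/2" using rC by simp
    finally show ?thesis using q[OF that] mult_right_mono[of "C * (norm x + norm y)" "1/2" "norm (x - y)"]
      by (smt (verit) norm_ge_zero)
  qed
  have low: "norm (x - y) \<le> 2 * norm (f x - f y)"
    if "x \<in> V" "y \<in> V" "norm x < r" "norm y < r" for x y
    using half[OF that] norm_triangle_ineq4[of "f x - f y" "f x - f y - (x - y)"] by simp
  have up: "norm (f x) \<le> (3/2) * norm x" if "x \<in> V" "norm x < r" for x
    using half[of x 0] that subspace_0[OF V] 1 r norm_triangle_ineq[of "f x - x" x] by simp
  define S where "S = V \<inter> cball 0 (r/2)"
  have S: "complete S" "0 \<in> S"
    unfolding S_def using closed_subspace[OF V] subspace_0[OF V] r
    by (auto simp: complete_eq_closed intro: closed_Int)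
  \<comment> \<open>The radii fit: \<open>|y| < r/4\<close> and
    \<open>|x - f x| <= |x|/2 <= r/4\<close> keep the iteration in the ball of radius
    \<open>r/2\<close>.\<close>
  have ex1: "\<exists>!x. x \<in> S \<and> y + x - f x = x" if y: "y \<in> V" "norm y < r / 4" for y
  proof (rule Banach_fix[of S "1/2" "\<lambda>x. y + x - f x"])
    show "complete S" "S \<noteq> {}" "(0::real) \<le> 1/2" "1/2 < (1::real)" using S by auto
    show "(\<lambda>x. y + x - f x) ` S \<subseteq> S"
    proof safe
      fix x assume "x \<in> S"
      then have x: "x \<in> V" "norm x \<le> r/2" "norm x < r" using r by (auto simp: S_def)
      have "norm (f x - x) \<le> (1/2) * norm x"
        using half[of x 0] x subspace_0[OF V] 1 r by simp
      then have "norm (y + x - f x) \<le> r / 2"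
        using norm_triangle_ineq[of y "x - f x"] x y by (simp add: norm_minus_commute algebra_simps)
      then show "y + x - f x \<in> S"
        unfolding S_def using x y fV' V by (simp add: subspace_add subspace_diff)
    qed
    fix x z assume "x \<in> S" "z \<in> S"
    show "dist (y + x - f x) (y + z - f z) \<le> 1 / 2 * dist x z"
    proof -
      from \<open>x \<in> S\<close> \<open>z \<in> S\<close> have x: "x \<in> V" "norm x < r" "z \<in> V" "norm z < r"
        using r by (auto simp: S_def)
      have "dist (y + x - f x) (y + z - f z) = norm (f x - f z - (x - z))"
        by (simp add: dist_norm norm_minus_commute algebra_simps)
      then show "dist (y + x - f x) (y + z - f z) \<le> 1 / 2 * dist x z"
        using half[OF x(1,3,2,4)] by (simp add: dist_norm)
    qed
  qed
  define g where "g y = (THE x. x \<in> S \<and> f x = y)" for y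
  have eqv: "(y + x - f x = x) \<longleftrightarrow> f x = y" for x y :: 'e by (auto simp: algebra_simps)
  have ex1': "\<exists>!x. x \<in> S \<and> f x = y" if y: "y \<in> V" "norm y < r / 4" for y
    using ex1[OF that] unfolding eqv .
  have g: "g y \<in> S" "f (g y) = y" if y: "y \<in> V" "norm y < r / 4" for y
    using theI'[OF ex1'[OF that]] unfolding g_def by auto
  \<comment> \<open>\<open>r/6\<close> because \<open>|f x| <= (3/2) |x|\<close>, so that
    \<open>f x\<close> falls into the domain \<open>|y| < r/4\<close> of \<open>g\<close>.\<close>
  have gf: "g (f x) = x" "norm (f x) < r/4" if x: "x \<in> V" "norm x < r / 6" for x
  proof -
    show 2: "norm (f x) < r/4" using up[of x] x r by simp
    have "x \<in> S" using x r by (simp add: S_def)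
    then show "g (f x) = x"
      using ex1'[OF fV' 2] x r unfolding g_def by (intro the1_equality) auto
  qed
  have gV: "g y \<in> V" "norm (g y) < r" if y: "y \<in> V" "norm y < r / 4" for y
    using g(1)[OF that] r by (auto simp: S_def)
  have glip: "norm (g x - g y) \<le> 2 * norm (x - y)"
    if "x \<in> V" "y \<in> V" "norm x < r/4" "norm y < r/4" for x y
    using low[of "g x" "g y"] gV g that by simp
  have g0: "g 0 = 0" using gf(1)[of 0] subspace_0[OF V] r 1 by simp
  have gb: "norm (g y) \<le> 2 * norm y" if "y \<in> V" "norm y < r/4" for y
    using glip[of y 0] that subspace_0[OF V] g0 r by simp
  have "c11_on V (r/4) (8 * C) g (\<lambda>x. x)"
    unfolding c11_on_def
  proof (intro ballI impI conjI)
    fix x y assume *: "x \<in> V" "y \<in> V" "norm x < r/4" "norm y < r/4"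
    have "norm (g x - g y - (x - y)) = norm (f (g x) - f (g y) - (g x - g y))"
      using g * by (simp add: norm_minus_commute)
    also have "\<dots> \<le> C * (norm (g x) + norm (g y)) * norm (g x - g y)"
      using q gV * by blast
    also have "\<dots> \<le> C * (2 * norm x + 2 * norm y) * (2 * norm (x - y))"
      using gb glip * 1 by (intro mult_mono add_mono mult_left_mono) auto
    also have "\<dots> = 4 * C * (norm x + norm y) * norm (x - y)" by (simp add: algebra_simps)
    also have "\<dots> \<le> 8 * C * (norm x + norm y) * norm (x - y)"
      using 1 by (intro mult_right_mono) auto
    finally show "norm (g x - g y - (x - y)) \<le> 8 * C * (norm x + norm y) * norm (x - y)" .
    \<comment> \<open>\<open>f (g m) = m\<close> is also the mean of \<open>f (g x)\<close> and
      \<open>f (g y)\<close>. So the second difference of \<open>f\<close> at \<open>g x\<close> and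
      \<open>g y\<close> measures the distance of \<open>f (g m)\<close> from \<open>f v\<close>,
      and \<open>low\<close> converts it into the distance of \<open>g m\<close> from
      \<open>v\<close>.\<close>
    define m where "m = (1/2) *\<^sub>R (x + y)"
    define v where "v = (1/2) *\<^sub>R (g x + g y)"
    have m: "m \<in> V" "norm m < r/4"
      using norm_half_sum_less[OF *(3,4)] subspace_half_sum[OF V *(1,2)] unfolding m_def by blast+
    have v: "v \<in> V" "norm v < r"
      using norm_half_sum_less[OF gV(2)[OF *(1,3)] gV(2)[OF *(2,4)]]
        subspace_half_sum[OF V gV(1)[OF *(1,3)] gV(1)[OF *(2,4)]] unfolding v_def by blast+
    have "norm (f (g x) + f (g y) - 2 *\<^sub>R f v) \<le> C * (norm (g x - g y))\<^sup>2"
      using c11_onD(2)[OF C1] gV * unfolding v_def by blast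
    also have "f (g x) + f (g y) = 2 *\<^sub>R f (g m)" using g * m by (simp add: m_def)
    also have "2 *\<^sub>R f (g m) - 2 *\<^sub>R f v = 2 *\<^sub>R (f (g m) - f v)" by (simp add: algebra_simps)
    finally have 3: "2 * norm (f (g m) - f v) \<le> C * (norm (g x - g y))\<^sup>2" by simp
    have "g x + g y - 2 *\<^sub>R g m = 2 *\<^sub>R (v - g m)" by (simp add: v_def algebra_simps)
    then have "norm (g x + g y - 2 *\<^sub>R g m) = 2 * norm (g m - v)" by (simp add: norm_minus_commute)
    also have "\<dots> \<le> 4 * norm (f (g m) - f v)"
      using low[OF gV(1)[OF m] v(1) gV(2)[OF m] v(2)] by simp
    also have "\<dots> \<le> 2 * (C * (norm (g x - g y))\<^sup>2)" using 3 by simp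
    also have "\<dots> \<le> 2 * (C * (2 * norm (x - y))\<^sup>2)"
      using glip * 1 by (intro mult_left_mono power_mono) auto
    finally show "norm (g x + g y - 2 *\<^sub>R g ((1/2) *\<^sub>R (x + y))) \<le> 8 * C * (norm (x - y))\<^sup>2"
      by (simp add: m_def power_mult_distrib)
  qed
  then have "c11 V g (\<lambda>x. x)"
    using g0 r 1 by (intro c11I[of _ _ "r/4" "8 * C"]) (auto simp: bounded_linear_ident)
  then show thesis
    by (rule that[of g "r/6"]) (use r gV g gf fV' in auto)
qed

text \<open>On the line \<open>p + t v\<close>, which stays in \<open>U\<close> for small
  \<open>t\<close>, both derivatives induce the derivative of a function of one real variable, and
  that is unique.\<close>

lemma has_derivative_unique_on_subspace:
  assumes V: "subspace V" and U: "openin (top_of_set V) U" "p \<in> U"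
    and D: "(f has_derivative D) (at p within U)" "(f has_derivative E) (at p within U)"
    and v: "v \<in> V"
  shows "D v = E v"
proof -
  define T where "T = {t::real. p + t *\<^sub>R v \<in> U}"
  obtain e where e: "e > 0" "ball p e \<inter> V \<subseteq> U"
    using U unfolding openin_contains_ball by blast
  have pV: "p \<in> V" using U openin_subset by fastforce
  have T: "t \<in> T" if "\<bar>t\<bar> * norm v < e" for t
  proof -
    have "p + t *\<^sub>R v \<in> ball p e \<inter> V"
      using that v pV V by (simp add: dist_norm subspace_add subspace_scale)
    then show ?thesis using e by (auto simp: T_def)
  qed
  have op: "ball 0 (e / (norm v + 1)) \<subseteq> T"
  proof
    fix t :: real assume "t \<in> ball 0 (e / (norm v + 1))"
    then have "\<bar>t\<bar> * (norm v + 1) < e" by (simp add: pos_less_divide_eq add_nonneg_pos)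
    then show "t \<in> T" by (intro T) (simp add: algebra_simps)
  qed
  have at: "at 0 within T = at (0::real)"
    by (rule at_within_nhd[of _ "ball 0 (e / (norm v + 1))"]) (use op e in \<open>auto simp: add_nonneg_pos\<close>)
  have l: "((\<lambda>t. p + t *\<^sub>R v) has_derivative (\<lambda>t. t *\<^sub>R v)) (at 0 within T)"
    by (auto intro!: derivative_eq_intros)
  have im: "(\<lambda>t. p + t *\<^sub>R v) ` T \<subseteq> U" by (auto simp: T_def)
  have "((\<lambda>t. f (p + t *\<^sub>R v)) has_derivative (\<lambda>t. D (t *\<^sub>R v))) (at 0 within T)"
    using has_derivative_in_compose[OF l, of f D] has_derivative_subset[OF D(1) im] by simp
  moreover have "((\<lambda>t. f (p + t *\<^sub>R v)) has_derivative (\<lambda>t. E (t *\<^sub>R v))) (at 0 within T)"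
    using has_derivative_in_compose[OF l, of f E] has_derivative_subset[OF D(2) im] by simp
  ultimately have "(\<lambda>t. D (t *\<^sub>R v)) = (\<lambda>t. E (t *\<^sub>R v))"
    unfolding at by (rule has_derivative_unique)
  from fun_cong[OF this, of 1] show ?thesis by simp
qed

section \<open>Mean value estimates on linear subspaces\<close>

lemma has_derivative_within_cong:
  assumes "(f has_derivative D) (at p within S)" "bounded_linear E" "\<And>x. x \<in> S \<Longrightarrow> D (x - p) = E (x - p)"
  shows "(f has_derivative E) (at p within S)"
  using assms unfolding has_derivative_within_alt by auto

lemma orthonormal_basis_subspace_obtain:
  fixes V :: "'e::euclidean_space set"
  assumes "subspace V"
  obtains B where "finite B" "B \<subseteq> V" "\<And>b. b \<in> B \<Longrightarrow> norm b = 1"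
    "\<And>x. x \<in> V \<Longrightarrow> (\<Sum>b\<in>B. (x \<bullet> b) *\<^sub>R b) = x"
proof -
  obtain B where B: "B \<subseteq> V" "pairwise orthogonal B" "\<And>x. x \<in> B \<Longrightarrow> norm x = 1"
    "independent B" "span B = V"
    using orthonormal_basis_subspace[OF assms] by metis
  have fin: "finite B" using B(4) independent_imp_finite by blast
  have "(\<Sum>b\<in>B. (x \<bullet> b) *\<^sub>R b) = x" if "x \<in> V" for x
    using orthonormal_basis_expand[of B] B(2,3,5) that fin by (simp add: orthonormal_basis_expand)
  with that[of B] fin B show thesis by blast
qed

lemma orthogonal_projection_obtain:
  fixes V :: "'e::euclidean_space set"
  assumes V: "subspace V"
  obtains P where "linear P" "\<And>x. P x \<in> V" "\<And>x. x \<in> V \<Longrightarrow> P x = x" "\<And>x. norm (P x) \<le> norm x"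
proof -
  have "\<exists>y. y \<in> V \<and> (\<forall>w\<in>V. orthogonal (x - y) w)" for x
  proof -
    obtain y z where "y \<in> span V" "\<And>w. w \<in> span V \<Longrightarrow> orthogonal z w" "x = y + z"
      using orthogonal_subspace_decomp_exists[of V x] by metis
    then show ?thesis using V by (intro exI[of _ y]) (simp add: span_eq_iff[THEN iffD2])
  qed
  then obtain g where g: "\<And>x. g x \<in> V \<and> (\<forall>y\<in>V. orthogonal (x - g x) y)" by metis
  have uniq: "g x = y" if "y \<in> V" "\<forall>z\<in>V. orthogonal (x - y) z" for x y
  proof -
    have "g x - y \<in> V" using g that subspace_diff[OF V] by blast
    then have "(x - y) \<bullet> (g x - y) = 0" "(x - g x) \<bullet> (g x - y) = 0"
      using g that unfolding orthogonal_def by auto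
    then have "(g x - y) \<bullet> (g x - y) = 0" by (simp add: inner_diff_left)
    then show ?thesis by simp
  qed
  have "linear g"
  proof
    show "g (x + y) = g x + g y" for x y
    proof (rule uniq)
      show "g x + g y \<in> V" using g subspace_add[OF V] by blast
      show "\<forall>z\<in>V. orthogonal (x + y - (g x + g y)) z"
        using g[of x] g[of y] by (auto simp: orthogonal_def inner_diff_left inner_add_left)
    qed
    show "g (r *\<^sub>R x) = r *\<^sub>R g x" for r x
    proof (rule uniq)
      show "r *\<^sub>R g x \<in> V" using g subspace_scale[OF V] by blast
      show "\<forall>z\<in>V. orthogonal (r *\<^sub>R x - r *\<^sub>R g x) z"
        using g[of x] by (auto simp: orthogonal_def inner_diff_left)
    qed
  qed
  moreover have "norm (g x) \<le> norm x" for x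
  proof -
    have "(x - g x) \<bullet> g x = 0" using g[of x] by (auto simp: orthogonal_def)
    then have "g x \<bullet> g x = x \<bullet> g x" by (simp add: inner_diff_left)
    then have "norm (g x) * norm (g x) \<le> norm x * norm (g x)"
      using norm_cauchy_schwarz[of x "g x"] by (simp add: dot_square_norm power2_eq_square)
    then show ?thesis by (cases "g x = 0") auto
  qed
  ultimately show thesis using that[of g] g uniq by (auto simp: orthogonal_def)
qed

text \<open>In the next lemma the derivative is precomposed with the projection to \<open>V\<close>, because off \<open>V\<close>
  the derivative within a subset of \<open>V\<close> is arbitrary.\<close>

lemma differentiable_bound_subspace:
  fixes f :: "'e::euclidean_space \<Rightarrow> 'f::real_normed_vector"
  assumes V: "subspace V" and S: "convex S" "S \<subseteq> V"
    and D: "\<And>x. x \<in> S \<Longrightarrow> (f has_derivative D x) (at x within S)"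
    and B: "\<And>x v. x \<in> S \<Longrightarrow> v \<in> V \<Longrightarrow> norm (D x v) \<le> B * norm v" "0 \<le> B"
    and xy: "x \<in> S" "y \<in> S"
  shows "norm (f x - f y) \<le> B * norm (x - y)"
proof -
  obtain P where P: "linear P" "\<And>x. P x \<in> V" "\<And>x. x \<in> V \<Longrightarrow> P x = x" "\<And>x. norm (P x) \<le> norm x"
    using orthogonal_projection_obtain[OF V] by metis
  have Pb: "bounded_linear P" using P(1) linear_conv_bounded_linear by blast
  show ?thesis
  proof (rule differentiable_bound[OF S(1) _ _ xy])
    fix x assume x: "x \<in> S"
    have bl: "bounded_linear (D x)" using D[OF x] by (rule has_derivative_bounded_linear)
    have "P (y - x) = y - x" if "y \<in> S" for y
      using P(3) subspace_diff[OF V, of y x] that x S(2) by blast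
    then show "(f has_derivative (\<lambda>v. D x (P v))) (at x within S)"
      by (intro has_derivative_within_cong[OF D[OF x] bounded_linear_compose[OF bl Pb]]) simp
    show "onorm (\<lambda>v. D x (P v)) \<le> B"
    proof (rule onorm_bound[OF B(2)])
      fix v
      have "norm (D x (P v)) \<le> B * norm (P v)" using B(1)[OF x] P by simp
      also have "\<dots> \<le> B * norm v" using P B(2) by (intro mult_left_mono) auto
      finally show "norm (D x (P v)) \<le> B * norm v" .
    qed
  qed
qed

text \<open>\<open>Ck_on 2\<close> yields second derivatives that are continuous along each fixed
  pair of directions. For pairs from an orthonormal basis \<open>b\<close> of \<open>V\<close> they
  are bounded on a compact ball, so the first derivative is Lipschitz as an operator on
  \<open>V\<close>, and the mean value inequality gives both estimates.\<close>

lemma Ck_on_2_c11: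
  fixes g :: "'e::euclidean_space \<Rightarrow> 'f::real_normed_vector"
  assumes V: "subspace V" and U: "openin (top_of_set V) U" "p \<in> U" and g: "Ck_on 2 V U g"
  shows "(g has_derivative frechet_derivative g (at p within U)) (at p within U)"
    and "c11 V (\<lambda>x. g (p + x) - g p) (frechet_derivative g (at p within U))"
proof -
  have "2 = Suc (Suc 0)" by simp
  with g obtain D where D: "\<And>x. x \<in> U \<Longrightarrow> (g has_derivative D x) (at x within U)"
    and "\<And>v. v \<in> V \<Longrightarrow> Ck_on (Suc 0) V U (\<lambda>x. D x v)" by (metis Ck_on.simps(2))
  then have "\<forall>v\<in>V. \<exists>E. (\<forall>x\<in>U. ((\<lambda>x. D x v) has_derivative E x) (at x within U)) \<and>
      (\<forall>w\<in>V. continuous_on U (\<lambda>x. E x w))" by simp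
  then obtain E where E: "\<And>v x. v \<in> V \<Longrightarrow> x \<in> U \<Longrightarrow> ((\<lambda>x. D x v) has_derivative E v x) (at x within U)"
    "\<And>v w. v \<in> V \<Longrightarrow> w \<in> V \<Longrightarrow> continuous_on U (\<lambda>x. E v x w)" by metis
  show Dp: "(g has_derivative frechet_derivative g (at p within U)) (at p within U)"
    using D[OF U(2)] differentiableI frechet_derivative_works by blast
  obtain e where e: "e > 0" "cball p e \<inter> V \<subseteq> U"
    using U unfolding openin_contains_cball by blast
  define S where "S = cball p e \<inter> V"
  have pV: "p \<in> V" using U openin_subset by fastforce
  have S: "convex S" "compact S" "S \<subseteq> V" "S \<subseteq> U" "p \<in> S"
    unfolding S_def using subspace_imp_convex[OF V] closed_subspace[OF V] e pV
    by (auto intro: convex_Int compact_Int_closed)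
  obtain b where b: "finite b" "b \<subseteq> V" "\<And>x. x \<in> b \<Longrightarrow> norm x = 1"
    "\<And>x. x \<in> V \<Longrightarrow> (\<Sum>c\<in>b. (x \<bullet> c) *\<^sub>R c) = x"
    using orthonormal_basis_subspace_obtain[OF V] by metis
  have lin_bound: "norm (L v) \<le> (\<Sum>c\<in>b. norm (L c)) * norm v" if "linear L" "v \<in> V"
    for L :: "'e \<Rightarrow> 'f" and v
  proof -
    have "L v = (\<Sum>c\<in>b. (v \<bullet> c) *\<^sub>R L c)"
      using linear_sum[OF that(1), of "\<lambda>c. (v \<bullet> c) *\<^sub>R c" b] unfolding b(4)[OF that(2)] linear_scale[OF that(1)] .
    also have "norm \<dots> \<le> (\<Sum>c\<in>b. norm v * norm (L c))"
    proof (rule sum_norm_le)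
      fix c assume "c \<in> b"
      then have "\<bar>v \<bullet> c\<bar> \<le> norm v" using Cauchy_Schwarz_ineq2[of v c] b(3) by simp
      then show "norm ((v \<bullet> c) *\<^sub>R L c) \<le> norm v * norm (L c)" by (simp add: mult_right_mono)
    qed
    finally show ?thesis by (simp add: sum_distrib_left mult.commute)
  qed
  have "\<forall>c\<in>b. \<forall>d\<in>b. \<exists>M. \<forall>x\<in>S. norm (E c x d) \<le> M"
  proof (intro ballI)
    fix c d assume "c \<in> b" "d \<in> b"
    then have "continuous_on S (\<lambda>x. E c x d)"
      using E(2) b(2) continuous_on_subset[OF _ S(4)] by blast
    then have "bounded ((\<lambda>x. E c x d) ` S)"
      by (intro compact_imp_bounded compact_continuous_image S(2))
    then show "\<exists>M. \<forall>x\<in>S. norm (E c x d) \<le> M"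
      unfolding bounded_iff by simp
  qed
  then obtain M where M: "\<And>c d x. c \<in> b \<Longrightarrow> d \<in> b \<Longrightarrow> x \<in> S \<Longrightarrow> norm (E c x d) \<le> M c d" by metis
  define N where "N c = (\<Sum>d\<in>b. \<bar>M c d\<bar>)" for c
  have N0: "0 \<le> N c" for c unfolding N_def by (simp add: sum_nonneg)
  have Dc: "norm (D x c - D y c) \<le> N c * norm (x - y)" if "c \<in> b" "x \<in> S" "y \<in> S" for c x y
  proof (rule differentiable_bound_subspace[OF V S(1,3) _ _ N0 that(2,3)])
    show "((\<lambda>x. D x c) has_derivative E c z) (at z within S)" if "z \<in> S" for z
      using E(1)[of c z] \<open>c \<in> b\<close> b(2) that S(4) has_derivative_subset by blast
    show "norm (E c z v) \<le> N c * norm v" if "z \<in> S" "v \<in> V" for z v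
    proof -
      have "linear (E c z)"
        using has_derivative_linear[OF E(1)[of c z]] \<open>c \<in> b\<close> b(2) that S(4) by blast
      from lin_bound[OF this that(2)]
      have "norm (E c z v) \<le> (\<Sum>d\<in>b. norm (E c z d)) * norm v" .
      also have "\<dots> \<le> N c * norm v" unfolding N_def
        using M[OF \<open>c \<in> b\<close> _ that(1)] by (intro mult_right_mono sum_mono) (auto intro: order_trans[OF _ abs_ge_self])
      finally show ?thesis .
    qed
  qed
  define K where "K = (\<Sum>c\<in>b. N c)"
  have K0: "0 \<le> K" unfolding K_def using N0 by (simp add: sum_nonneg)
  have linD: "linear (D x)" if "x \<in> S" for x
    using has_derivative_linear[OF D[of x]] that S(4) by blast
  have DD: "norm (D x v - D y v) \<le> K * norm (x - y) * norm v" if "x \<in> S" "y \<in> S" "v \<in> V" for x y v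
  proof -
    have "norm (D x v - D y v) \<le> (\<Sum>c\<in>b. norm (D x c - D y c)) * norm v"
      using lin_bound[OF linear_compose_sub[OF linD linD] that(3)] that by blast
    also have "\<dots> \<le> (\<Sum>c\<in>b. N c * norm (x - y)) * norm v"
      using Dc that by (intro mult_right_mono sum_mono) auto
    finally show ?thesis by (simp add: K_def sum_distrib_right)
  qed
  \<comment> \<open>Three points, so that one estimate serves twice: \<open>z = p\<close> compares
    with the derivative at \<open>p\<close>, and \<open>z = p + m\<close> with the midpoint
    \<open>m\<close> gives the second difference, in which the linear terms cancel.\<close>
  have key: "norm (g x - g y - D z (x - y)) \<le> K * (norm (x - z) + norm (y - z)) * norm (x - y)"
    if "x \<in> S" "y \<in> S" "z \<in> S" for x y z
  proof -
    have seg: "closed_segment x y \<subseteq> S" using S(1) that closed_segment_subset by blast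
    interpret Dz: linear "D z" using linD that by simp
    have "norm ((g x - D z x) - (g y - D z y)) \<le> K * (norm (x - z) + norm (y - z)) * norm (x - y)"
    proof (rule differentiable_bound_subspace[OF V convex_closed_segment])
      show "closed_segment x y \<subseteq> V" using seg S by blast
      show "0 \<le> K * (norm (x - z) + norm (y - z))" using K0 by simp
      show "x \<in> closed_segment x y" "y \<in> closed_segment x y" by auto
      fix w assume w: "w \<in> closed_segment x y"
      then have wS: "w \<in> S" using seg by blast
      have "(D z has_derivative D z) (at w within closed_segment x y)"
        using bounded_linear_imp_has_derivative[OF has_derivative_bounded_linear[OF D[of z]]] that S(4) by blast
      moreover have "(g has_derivative D w) (at w within closed_segment x y)"
        using has_derivative_subset[OF D[of w] subset_trans[OF seg S(4)]] wS S(4) by blast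
      ultimately show "((\<lambda>w. g w - D z w) has_derivative (\<lambda>v. D w v - D z v)) (at w within closed_segment x y)"
        by (intro has_derivative_diff)
      fix v assume v: "v \<in> V"
      have "norm (w - z) \<le> max (norm (x - z)) (norm (y - z))"
      proof -
        obtain u where u: "0 \<le> u" "u \<le> 1" "w = (1 - u) *\<^sub>R x + u *\<^sub>R y"
          using w unfolding closed_segment_def by auto
        have "w - z = (1 - u) *\<^sub>R (x - z) + u *\<^sub>R (y - z)" by (simp add: u algebra_simps)
        then have "norm (w - z) \<le> (1 - u) * norm (x - z) + u * norm (y - z)"
          using norm_triangle_ineq[of "(1 - u) *\<^sub>R (x - z)" "u *\<^sub>R (y - z)"] u by simp
        also have "\<dots> \<le> max (norm (x - z)) (norm (y - z))"
          using u by (intro convex_bound_le) auto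
        finally show ?thesis .
      qed
      also have "\<dots> \<le> norm (x - z) + norm (y - z)" by simp
      finally have "norm (w - z) \<le> norm (x - z) + norm (y - z)" .
      then have "K * norm (w - z) * norm v \<le> K * (norm (x - z) + norm (y - z)) * norm v"
        using K0 by (intro mult_right_mono mult_left_mono) auto
      then show "norm (D w v - D z v) \<le> K * (norm (x - z) + norm (y - z)) * norm v"
        using DD[OF wS that(3) v] by linarith
    qed
    then show ?thesis by (simp add: Dz.diff algebra_simps)
  qed
  define L where "L = frechet_derivative g (at p within U)"
  have L: "L v = D p v" if "v \<in> V" for v
    using has_derivative_unique_on_subspace[OF V U Dp D[OF U(2)] that] by (simp add: L_def)
  have pS: "p + x \<in> S" if "x \<in> V" "norm x < e" for x
    using that pV V by (simp add: S_def dist_norm subspace_add)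
  have "c11_on V e K (\<lambda>x. g (p + x) - g p) L"
    unfolding c11_on_def
  proof (intro ballI impI conjI)
    fix x y assume *: "x \<in> V" "y \<in> V" "norm x < e" "norm y < e"
    show "norm (g (p + x) - g p - (g (p + y) - g p) - L (x - y)) \<le> K * (norm x + norm y) * norm (x - y)"
      using key[OF pS[OF *(1,3)] pS[OF *(2,4)] S(5)] L[of "x - y"] subspace_diff[OF V] * by simp
    define m where "m = (1/2) *\<^sub>R (x + y)"
    have m: "m \<in> V" "norm m < e"
      using norm_half_sum_less[OF *(3,4)] subspace_half_sum[OF V *(1,2)] unfolding m_def by blast+
    have xm: "x - m = (1/2) *\<^sub>R (x - y)" "y - m = - ((1/2) *\<^sub>R (x - y))"
    proof -
      have "(1/2) *\<^sub>R (x + x) - m = (1/2) *\<^sub>R (x - y)"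
        unfolding m_def scaleR_right_diff_distrib[symmetric] by simp
      then show "x - m = (1/2) *\<^sub>R (x - y)" unfolding scaleR_half_double .
      have "(1/2) *\<^sub>R (y + y) - m = (1/2) *\<^sub>R (y - x)"
        unfolding m_def scaleR_right_diff_distrib[symmetric] by simp
      also have "\<dots> = - ((1/2) *\<^sub>R (x - y))"
        unfolding scaleR_minus_right[symmetric] by simp
      finally show "y - m = - ((1/2) *\<^sub>R (x - y))" unfolding scaleR_half_double .
    qed
    have nx: "norm (x - m) = norm (x - y) / 2" "norm (y - m) = norm (x - y) / 2"
      unfolding xm by simp_all
    interpret Dm: linear "D (p + m)" using linD pS[OF m] by simp
    have "D (p + m) (x - m) + D (p + m) (y - m) = 0"
      unfolding xm by (simp add: Dm.neg)
    then have "(g (p + x) - g p) + (g (p + y) - g p) - 2 *\<^sub>R (g (p + m) - g p) =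
      (g (p + x) - g (p + m) - D (p + m) (x - m)) + (g (p + y) - g (p + m) - D (p + m) (y - m))"
      by (simp add: algebra_simps scaleR_2)
    then have "norm ((g (p + x) - g p) + (g (p + y) - g p) - 2 *\<^sub>R (g (p + m) - g p)) \<le>
      norm (g (p + x) - g (p + m) - D (p + m) (x - m)) + norm (g (p + y) - g (p + m) - D (p + m) (y - m))"
      by (simp only: norm_triangle_ineq)
    also have "\<dots> \<le> K * norm (x - m) * norm (x - m) + K * norm (y - m) * norm (y - m)"
      using key[OF pS[OF *(1,3)] pS[OF m] pS[OF m]] key[OF pS[OF *(2,4)] pS[OF m] pS[OF m]]
      by (intro add_mono) simp_all
    also have "\<dots> = K * (norm (x - y))\<^sup>2 / 2" unfolding nx by (simp add: power2_eq_square)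
    also have "\<dots> \<le> K * (norm (x - y))\<^sup>2" using K0 by simp
    finally show "norm ((g (p + x) - g p) + (g (p + y) - g p) - 2 *\<^sub>R (g (p + (1/2) *\<^sub>R (x + y)) - g p))
      \<le> K * (norm (x - y))\<^sup>2" by (simp add: m_def)
  qed
  then show "c11 V (\<lambda>x. g (p + x) - g p) (frechet_derivative g (at p within U))"
    using has_derivative_bounded_linear[OF Dp] e K0 unfolding L_def
    by (intro c11I[of _ _ e K]) auto
qed

text \<open>This is \<open>f^n (x / 2^n)\<close>. In the application \<open>f\<close> is the
  squaring map of the group in coordinates.\<close>

primrec rescaled_iterate :: "('e::real_vector \<Rightarrow> 'e) \<Rightarrow> nat \<Rightarrow> 'e \<Rightarrow> 'e" where
  "rescaled_iterate f 0 x = x"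
| "rescaled_iterate f (Suc n) x = f (rescaled_iterate f n ((1/2) *\<^sub>R x))"

text \<open>Koenigs' construction: when \<open>f\<close> has twice the identity as derivative at its
  fixed point \<open>0\<close>, the maps \<open>f^n (x / 2^n)\<close> converge near
  \<open>0\<close>. Their estimates are uniform in \<open>n\<close>; so the limit is again
  \<open>c11\<close>, and \<open>x\<close> may be replaced by a sequence \<open>u n\<close>
  converging to it.\<close>

lemma koenigs_linearization:
  fixes f :: "'e::euclidean_space \<Rightarrow> 'e"
  assumes f: "c11 V f L" and V: "subspace V" and L: "\<And>x. x \<in> V \<Longrightarrow> L x = 2 *\<^sub>R x"
    and fV: "\<exists>r>0. \<forall>x\<in>V. norm x < r \<longrightarrow> f x \<in> V"
  obtains E r where "r > 0" "c11 V E (\<lambda>x. x)" "\<And>x. x \<in> V \<Longrightarrow> norm x < r \<Longrightarrow> E x \<in> V"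
    "\<And>x n. x \<in> V \<Longrightarrow> norm x < r \<Longrightarrow>
       rescaled_iterate f n x \<in> V \<and> norm (rescaled_iterate f n x) \<le> 2 * norm x"
    "\<And>x y. x \<in> V \<Longrightarrow> y \<in> V \<Longrightarrow> norm x < r \<Longrightarrow> norm y < r \<Longrightarrow> norm (E x - E y) \<le> 2 * norm (x - y)"
    "\<And>x u. x \<in> V \<Longrightarrow> norm x < r \<Longrightarrow> (\<And>n. u n \<in> V) \<Longrightarrow> u \<longlonglongrightarrow> x \<Longrightarrow>
       (\<lambda>n. rescaled_iterate f n (u n)) \<longlonglongrightarrow> E x"
proof -
  obtain r1 C where 1: "r1 > 0" "C \<ge> 0" "c11_on V r1 C f L" "f 0 = 0" "bounded_linear L"
    using f unfolding c11_def by auto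
  obtain r0 where r0: "r0 > 0" "\<And>x. x \<in> V \<Longrightarrow> norm x < r0 \<Longrightarrow> f x \<in> V" using fV by auto
  \<comment> \<open>With \<open>8 C r <= 1\<close> the map \<open>f\<close> has Lipschitz constant
    5/2, and every map with the identity as derivative and constant \<open>4 C\<close> has Lipschitz
    constant 2. The latter keeps \<open>F n (x / 2)\<close> in the ball.\<close>
  define r where "r = min (min r0 r1) (1 / (8 * (C + 1)))"
  have r: "r > 0" "r \<le> r0" "r \<le> r1" using r0 1 by (auto simp: r_def)
  have rC: "8 * C * r \<le> 1"
  proof -
    have "8 * (C + 1) * r \<le> 8 * (C + 1) * (1 / (8 * (C + 1)))"
      using 1 by (intro mult_left_mono) (auto simp: r_def)
    then have "8 * (C + 1) * r \<le> 1" using 1 by simp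
    then show ?thesis using r by (simp add: algebra_simps)
  qed
  have C1: "c11_on V r C f (\<lambda>x. 2 *\<^sub>R x)"
    by (rule c11_on_cong[OF c11_on_mono[OF 1(3) r(3) order_refl] V]) (use L in auto)
  have fV': "f x \<in> V" if "x \<in> V" "norm x < r" for x using r0 r that by simp
  define F where "F = rescaled_iterate f"
  have F0: "F 0 x = x" and FS: "F (Suc n) x = f (F n ((1/2) *\<^sub>R x))" for n x by (simp_all add: F_def)
  have flip: "norm (f x - f y) \<le> (5/2) * norm (x - y)"
    if "x \<in> V" "y \<in> V" "norm x < r" "norm y < r" for x y
  proof -
    have "C * (norm x + norm y) \<le> C * (2 * r)" using that 1 by (intro mult_left_mono) auto
    also have "\<dots> \<le> 1/2" using rC by simp
    finally have "C * (norm x + norm y) * norm (x - y) \<le> 1/2 * norm (x - y)"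
      by (intro mult_right_mono) auto
    then have "norm (f x - f y - 2 *\<^sub>R (x - y)) \<le> 1/2 * norm (x - y)"
      using c11_onD(1)[OF C1 that] by linarith
    then show ?thesis
      using norm_triangle_ineq[of "f x - f y - 2 *\<^sub>R (x - y)" "2 *\<^sub>R (x - y)"] by simp
  qed
  have lip_from: "norm (g x - g y) \<le> 2 * norm (x - y)"
    if g: "c11_on V r (4 * C) g (\<lambda>x. x)" and "x \<in> V" "y \<in> V" "norm x < r" "norm y < r" for g x y
  proof -
    have "4 * C * (norm x + norm y) \<le> 4 * C * (2 * r)" using that 1 by (intro mult_left_mono) auto
    also have "\<dots> \<le> 1" using rC by simp
    finally have "4 * C * (norm x + norm y) * norm (x - y) \<le> 1 * norm (x - y)"
      by (intro mult_right_mono) auto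
    then have "norm (g x - g y - (x - y)) \<le> norm (x - y)"
      using c11_onD(1)[OF that] by linarith
    then show ?thesis
      using norm_triangle_ineq[of "g x - g y - (x - y)" "x - y"] by simp
  qed
  have half: "(1/2) *\<^sub>R x \<in> V" "norm ((1/2) *\<^sub>R x) < r" if "x \<in> V" "norm x < r" for x
    using that subspace_scale[OF V that(1)] r(1) norm_ge_zero[of x] by (simp_all, linarith?)
  have nh: "norm ((1/2) *\<^sub>R x - (1/2) *\<^sub>R y) = norm (x - y) / 2" for x y :: 'e
  proof -
    have "(1/2) *\<^sub>R x - (1/2) *\<^sub>R y = (1/2) *\<^sub>R (x - y)" by (simp only: scaleR_right_diff_distrib)
    then show ?thesis by simp
  qed
  \<comment> \<open>The constant \<open>4 C\<close> reproduces itself. Halving the arguments turns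
    it into \<open>C\<close> in the first estimate, the doubling by \<open>f\<close> makes this
    \<open>2 C\<close>, and the remainder of \<open>f\<close> adds \<open>C\<close>. For second
    differences the total is \<open>C + (5/2) C\<close>.\<close>
  have ind: "c11_on V r (4 * C) (F n) (\<lambda>x. x) \<and> (\<forall>x\<in>V. norm x < r \<longrightarrow> F n x \<in> V) \<and> F n 0 = 0" for n
  proof (induction n)
    case 0
    have "c11_on V r (4 * C) (\<lambda>x. x) (\<lambda>x. x)"
      unfolding c11_on_def using 1 by simp
    then show ?case by (simp add: F0[abs_def])
  next
    case (Suc n)
    then have cn: "c11_on V r (4 * C) (F n) (\<lambda>x. x)" and Vn: "\<And>x. x \<in> V \<Longrightarrow> norm x < r \<Longrightarrow> F n x \<in> V"
      and n0: "F n 0 = 0" by auto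
    define X where "X x = F n ((1/2) *\<^sub>R x)" for x
    have X: "X x \<in> V" "norm (X x) \<le> norm x" "norm (X x) < r" if "x \<in> V" "norm x < r" for x
    proof -
      show "X x \<in> V" using Vn half[OF that] by (simp add: X_def)
      show *: "norm (X x) \<le> norm x"
        using lip_from[OF cn half(1)[OF that] subspace_0[OF V] half(2)[OF that]] r n0 by (simp add: X_def)
      show "norm (X x) < r" using * that by simp
    qed
    have XX: "norm (X x - X y) \<le> norm (x - y)" if "x \<in> V" "norm x < r" "y \<in> V" "norm y < r" for x y
      using lip_from[OF cn half(1)[OF that(1,2)] half(1)[OF that(3,4)] half(2)[OF that(1,2)] half(2)[OF that(3,4)]]
      unfolding nh by (simp add: X_def)
    have "c11_on V r (4 * C) (\<lambda>x. f (X x)) (\<lambda>x. x)"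
      unfolding c11_on_def
    proof (intro ballI impI conjI)
      fix x y assume *: "x \<in> V" "y \<in> V" "norm x < r" "norm y < r"
      note x = *(1,3) and y = *(2,4)
      have a: "norm (f (X x) - f (X y) - 2 *\<^sub>R (X x - X y)) \<le> C * (norm x + norm y) * norm (x - y)"
      proof -
        have "norm (f (X x) - f (X y) - 2 *\<^sub>R (X x - X y)) \<le> C * (norm (X x) + norm (X y)) * norm (X x - X y)"
          using c11_onD(1)[OF C1] X[OF x] X[OF y] by blast
        also have "\<dots> \<le> C * (norm x + norm y) * norm (x - y)"
          using X[OF x] X[OF y] XX[OF x y] 1 by (intro mult_mono add_mono mult_left_mono) auto
        finally show ?thesis .
      qed
      have b: "norm (X x - X y - ((1/2) *\<^sub>R x - (1/2) *\<^sub>R y)) \<le> C * (norm x + norm y) * norm (x - y)"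
      proof -
        have "norm (X x - X y - ((1/2) *\<^sub>R x - (1/2) *\<^sub>R y)) \<le>
            4 * C * (norm ((1/2) *\<^sub>R x) + norm ((1/2) *\<^sub>R y)) * norm ((1/2) *\<^sub>R x - (1/2) *\<^sub>R y)"
          using c11_onD(1)[OF cn half(1)[OF x] half(1)[OF y] half(2)[OF x] half(2)[OF y]] unfolding X_def .
        also have "\<dots> = C * (norm x + norm y) * norm (x - y)" unfolding nh by (simp add: field_simps)
        finally show ?thesis .
      qed
      have "f (X x) - f (X y) - (x - y) =
        (f (X x) - f (X y) - 2 *\<^sub>R (X x - X y)) + 2 *\<^sub>R (X x - X y - ((1/2) *\<^sub>R x - (1/2) *\<^sub>R y))"
        by (simp add: scaleR_right_diff_distrib)
      then have "norm (f (X x) - f (X y) - (x - y)) \<le>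
        norm (f (X x) - f (X y) - 2 *\<^sub>R (X x - X y)) + 2 * norm (X x - X y - ((1/2) *\<^sub>R x - (1/2) *\<^sub>R y))"
        by (metis norm_triangle_ineq norm_scaleR abs_numeral)
      also have "\<dots> \<le> 3 * (C * (norm x + norm y) * norm (x - y))" using a b by linarith
      also have "\<dots> \<le> 4 * (C * (norm x + norm y) * norm (x - y))" using 1 by (intro mult_right_mono) auto
      finally show "norm (f (X x) - f (X y) - (x - y)) \<le> 4 * C * (norm x + norm y) * norm (x - y)"
        by (simp add: mult.assoc)
      define m where "m = (1/2) *\<^sub>R (x + y)"
      define v where "v = (1/2) *\<^sub>R (X x + X y)"
      have m: "m \<in> V" "norm m < r"
        using norm_half_sum_less[OF *(3,4)] subspace_half_sum[OF V *(1,2)] unfolding m_def by blast+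
      have v: "v \<in> V" "norm v < r"
        using norm_half_sum_less[OF X(3)[OF x] X(3)[OF y]] subspace_half_sum[OF V X(1)[OF x] X(1)[OF y]]
        unfolding v_def by blast+
      have c: "norm (f (X x) + f (X y) - 2 *\<^sub>R f v) \<le> C * (norm (x - y))\<^sup>2"
      proof -
        have "norm (f (X x) + f (X y) - 2 *\<^sub>R f v) \<le> C * (norm (X x - X y))\<^sup>2"
          using c11_onD(2)[OF C1] X[OF x] X[OF y] unfolding v_def by blast
        also have "\<dots> \<le> C * (norm (x - y))\<^sup>2"
          using XX[OF x y] 1 by (intro mult_left_mono power_mono) auto
        finally show ?thesis .
      qed
      have d: "2 * norm (v - X m) \<le> C * (norm (x - y))\<^sup>2"
      proof -
        have mm: "(1/2) *\<^sub>R m = (1/2) *\<^sub>R ((1/2) *\<^sub>R x + (1/2) *\<^sub>R y)"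
          unfolding m_def by (simp add: scaleR_add_right)
        have "2 *\<^sub>R (v - X m) = X x + X y - 2 *\<^sub>R X m" by (simp add: v_def scaleR_right_diff_distrib)
        then have "2 * norm (v - X m) = norm (X x + X y - 2 *\<^sub>R X m)" by (metis norm_scaleR abs_numeral)
        also have "\<dots> \<le> 4 * C * (norm ((1/2) *\<^sub>R x - (1/2) *\<^sub>R y))\<^sup>2"
          using c11_onD(2)[OF cn half(1)[OF x] half(1)[OF y] half(2)[OF x] half(2)[OF y]]
          unfolding X_def mm .
        finally show ?thesis unfolding nh by (simp add: power_divide)
      qed
      have "f (X x) + f (X y) - 2 *\<^sub>R f (X m) = (f (X x) + f (X y) - 2 *\<^sub>R f v) + 2 *\<^sub>R (f v - f (X m))"
        by (simp add: scaleR_right_diff_distrib)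
      then have "norm (f (X x) + f (X y) - 2 *\<^sub>R f (X m)) \<le>
        norm (f (X x) + f (X y) - 2 *\<^sub>R f v) + 2 * norm (f v - f (X m))"
        by (metis norm_triangle_ineq norm_scaleR abs_numeral)
      also have "\<dots> \<le> C * (norm (x - y))\<^sup>2 + (5/2) * (C * (norm (x - y))\<^sup>2)"
        using c d flip[OF v(1) X(1)[OF m] v(2) X(3)[OF m]] by linarith
      also have "\<dots> \<le> 4 * C * (norm (x - y))\<^sup>2" using 1 by simp
      finally show "norm (f (X x) + f (X y) - 2 *\<^sub>R f (X ((1/2) *\<^sub>R (x + y)))) \<le> 4 * C * (norm (x - y))\<^sup>2"
        by (simp add: m_def)
    qed
    moreover have "F (Suc n) = (\<lambda>x. f (X x))" by (auto simp: FS X_def)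
    moreover have "f (X 0) = 0" using n0 1 by (simp add: X_def)
    ultimately show ?case using X fV' by auto
  qed
  have Fc: "c11_on V r (4 * C) (F n) (\<lambda>x. x)" and FV: "x \<in> V \<Longrightarrow> norm x < r \<Longrightarrow> F n x \<in> V" and Fn0: "F n 0 = 0"
    for n x using ind by auto
  have FL: "norm (F n x - F n y) \<le> 2 * norm (x - y)"
    if "x \<in> V" "y \<in> V" "norm x < r" "norm y < r" for n x y
    using lip_from[OF Fc that] .
  have Fh: "norm (F n ((1/2) *\<^sub>R x)) < r" if "x \<in> V" "norm x < r" for n x
    using FL[OF half(1)[OF that] subspace_0[OF V] half(2)[OF that], of n] r Fn0 that by simp
  \<comment> \<open>\<open>f\<close> expands by at most 5/2, while halving the argument divides the
    quadratic bound by 4; the ratio 5/8 makes the differences summable.\<close>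
  have step: "norm (F (Suc n) x - F n x) \<le> C * (5/8)^n * (norm x)\<^sup>2" if "x \<in> V" "norm x < r" for n x
    using that
  proof (induction n arbitrary: x)
    case 0
    note x = half[OF 0]
    have "norm (f ((1/2) *\<^sub>R x) - x) \<le> C * norm ((1/2) *\<^sub>R x) * norm ((1/2) *\<^sub>R x)"
      using c11_onD(1)[OF C1 x(1) subspace_0[OF V] x(2)] r 1 by simp
    also have "\<dots> \<le> C * (norm x)\<^sup>2" using 1 by (simp add: power2_eq_square)
    finally show ?case by (simp add: FS F0)
  next
    case (Suc n)
    note x = half[OF Suc.prems]
    have "norm (F (Suc (Suc n)) x - F (Suc n) x) \<le> (5/2) * norm (F (Suc n) ((1/2) *\<^sub>R x) - F n ((1/2) *\<^sub>R x))"
      unfolding FS[of "Suc n" x] FS[of n x]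
      by (intro flip FV x Fh[OF Suc.prems])
    also have "\<dots> \<le> (5/2) * (C * (5/8)^n * (norm ((1/2) *\<^sub>R x))\<^sup>2)"
      using Suc.IH[OF x] by simp
    also have "\<dots> = C * (5/8)^Suc n * (norm x)\<^sup>2" by (simp add: power_divide)
    finally show ?case .
  qed
  have conv: "convergent (\<lambda>n. F n x)" if "x \<in> V" "norm x < r" for x
  proof -
    have "summable (\<lambda>n. F (Suc n) x - F n x)"
    proof (rule summable_comparison_test'[where N = 0])
      show "summable (\<lambda>n. C * (5/8)^n * (norm x)\<^sup>2)"
        by (intro summable_mult2 summable_mult summable_geometric) simp
      show "norm (F (Suc n) x - F n x) \<le> C * (5/8)^n * (norm x)\<^sup>2" for n using step[OF that] .
    qed
    then have "convergent (\<lambda>n. \<Sum>k<n. F (Suc k) x - F k x)"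
      using summable_iff_convergent by blast
    then have "convergent (\<lambda>n. F n x - F 0 x)" unfolding sum_lessThan_telescope[of "\<lambda>k. F k x"] .
    then show ?thesis using convergent_diff_const_right_iff by blast
  qed
  define E where "E x = lim (\<lambda>n. F n x)" for x
  have E: "(\<lambda>n. F n x) \<longlonglongrightarrow> E x" if "x \<in> V" "norm x < r" for x
    using conv[OF that] unfolding E_def convergent_LIMSEQ_iff .
  have "c11_on V r (4 * C) E (\<lambda>x. x)"
    unfolding c11_on_def
  proof (intro ballI impI conjI)
    fix x y assume *: "x \<in> V" "y \<in> V" "norm x < r" "norm y < r"
    have m: "(1/2) *\<^sub>R (x + y) \<in> V" "norm ((1/2) *\<^sub>R (x + y)) < r"
      using norm_half_sum_less[OF *(3,4)] subspace_half_sum[OF V *(1,2)] by blast+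
    show "norm (E x - E y - (x - y)) \<le> 4 * C * (norm x + norm y) * norm (x - y)"
      by (rule LIMSEQ_le_const2[OF tendsto_norm[OF tendsto_diff[OF tendsto_diff[OF E[OF *(1,3)] E[OF *(2,4)]] tendsto_const]]])
        (use c11_onD(1)[OF Fc *] in blast)
    show "norm (E x + E y - 2 *\<^sub>R E ((1/2) *\<^sub>R (x + y))) \<le> 4 * C * (norm (x - y))\<^sup>2"
      by (rule LIMSEQ_le_const2[OF tendsto_norm[OF tendsto_diff[OF tendsto_add[OF E[OF *(1,3)] E[OF *(2,4)]]
          tendsto_scaleR[OF tendsto_const E[OF m]]]]])
        (use c11_onD(2)[OF Fc *] in blast)
  qed
  note Ec = this
  have "(\<lambda>n. F n 0) \<longlonglongrightarrow> E 0" using E subspace_0[OF V] r by simp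
  then have "E 0 = 0" using Fn0 by (simp add: LIMSEQ_const_iff)
  show thesis
  proof (rule that[OF r(1), of E])
    show "c11 V E (\<lambda>x. x)"
      using \<open>E 0 = 0\<close> r 1 Ec by (intro c11I[of _ _ r "4 * C"]) (auto simp: bounded_linear_ident)
    show "E x \<in> V" if "x \<in> V" "norm x < r" for x
      using closed_sequentially[OF closed_subspace[OF V] _ E[OF that]] FV[OF that] by blast
    show "rescaled_iterate f n x \<in> V \<and> norm (rescaled_iterate f n x) \<le> 2 * norm x" if "x \<in> V" "norm x < r" for x n
      using FV[OF that, of n] FL[OF that(1) subspace_0[OF V] that(2), of n] Fn0[of n] r by (simp add: F_def)
    show "norm (E x - E y) \<le> 2 * norm (x - y)" if "x \<in> V" "y \<in> V" "norm x < r" "norm y < r" for x y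
      using lip_from[OF Ec that] .
    fix x u assume x: "x \<in> V" "norm x < r" and u: "\<And>n. u n \<in> V" "u \<longlonglongrightarrow> x"
    have "\<forall>\<^sub>F n in sequentially. norm (u n) < r"
      using order_tendstoD(2)[OF tendsto_norm[OF u(2)] x(2)] .
    then have ev: "\<forall>\<^sub>F n in sequentially. norm (F n (u n) - F n x) \<le> 2 * norm (u n - x)"
      using FL[OF u(1) x(1) _ x(2)] by (auto elim: eventually_mono)
    have "(\<lambda>n. 2 * norm (u n - x)) \<longlonglongrightarrow> 0"
      using tendsto_mult_right_zero[OF tendsto_norm_zero[OF LIM_zero[OF u(2)]]] .
    then have "(\<lambda>n. F n (u n) - F n x) \<longlonglongrightarrow> 0"
      by (rule Lim_null_comparison[OF ev])
    from tendsto_add[OF this E[OF x]] show "(\<lambda>n. rescaled_iterate f n (u n)) \<longlonglongrightarrow> E x"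
      by (simp add: F_def)
  qed
qed

section \<open>Charts, derivatives and tangent vectors\<close>

lemma c11_small:
  assumes f: "c11 V f L" and V: "subspace V" and e: "0 < e"
  obtains r where "0 < r" "\<And>x. x \<in> V \<Longrightarrow> norm x < r \<Longrightarrow> norm (f x) < e"
proof -
  obtain r C where 1: "r > 0" "C \<ge> 0" "c11_on V r C f L" "f 0 = 0" "bounded_linear L"
    using f unfolding c11_def by auto
  define K where "K = onorm L + 2 * C * r"
  have K0: "0 \<le> K" using onorm_pos_le[OF 1(5)] 1 by (simp add: K_def)
  show thesis
  proof (rule that[of "min r (e / (K + 1))"])
    show "0 < min r (e / (K + 1))" using 1 K0 e by simp
    fix x assume x: "x \<in> V" "norm x < min r (e / (K + 1))"
    have "norm (f x) \<le> K * norm x"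
      using c11_on_lipschitz[OF 1(3,5,2) x(1) subspace_0[OF V]] x 1 by (simp add: K_def)
    also have "\<dots> \<le> (K + 1) * norm x" by (simp add: distrib_right)
    also have "\<dots> < e" using x K0 by (simp add: pos_less_divide_eq mult.commute)
    finally show "norm (f x) < e" .
  qed
qed

lemma smooth_manifoldD:
  assumes "smooth_manifold M"
  shows "Hausdorff_space (mtop M)" "subspace (model M)"
    "\<And>c. c \<in> charts M \<Longrightarrow> is_chart (mtop M) (model M) c"
    "(\<Union>c\<in>charts M. fst c) = topspace (mtop M)"
  using assms unfolding smooth_manifold_def by auto

lemma is_chartD:
  assumes "is_chart T V c"
  shows "openin T (fst c)" "openin (top_of_set V) (snd c ` fst c)" "inj_on (snd c) (fst c)"
    "snd c ` fst c \<subseteq> V" "continuous_map (subtopology T (fst c)) euclidean (snd c)"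
    "\<And>U. openin T U \<Longrightarrow> openin (top_of_set V) (snd c ` (U \<inter> fst c))"
proof -
  note * = assms[unfolded is_chart_def]
  then show o: "openin T (fst c)" "openin (top_of_set V) (snd c ` fst c)" by auto
  have ts: "topspace (subtopology T (fst c)) = fst c"
    using o(1) openin_subset by fastforce
  show "inj_on (snd c) (fst c)" using * ts by (simp add: homeomorphic_map_def)
  show "snd c ` fst c \<subseteq> V" using openin_subset[OF o(2)] by simp
  show "continuous_map (subtopology T (fst c)) euclidean (snd c)"
    using * homeomorphic_imp_continuous_map continuous_map_in_subtopology by blast
  fix U assume "openin T U"
  then have "openin (subtopology T (fst c)) (U \<inter> fst c)" by (simp add: openin_subtopology_Int)
  moreover have "open_map (subtopology T (fst c)) (top_of_set (snd c ` fst c)) (snd c)"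
    using * homeomorphic_imp_open_map by blast
  ultimately have "openin (top_of_set (snd c ` fst c)) (snd c ` (U \<inter> fst c))"
    unfolding open_map_def by blast
  then show "openin (top_of_set V) (snd c ` (U \<inter> fst c))"
    using openin_trans o(2) by blast
qed

lemma chart_limitin_iff:
  assumes c: "is_chart T V c" and p: "p \<in> fst c"
  shows "limitin T a p F \<longleftrightarrow> (\<forall>\<^sub>F i in F. a i \<in> fst c) \<and> ((\<lambda>i. snd c (a i)) \<longlongrightarrow> snd c p) F"
proof
  assume l: "limitin T a p F"
  have ev: "\<forall>\<^sub>F i in F. a i \<in> fst c" using limitinD[OF l is_chartD(1)[OF c] p] .
  then have "limitin (subtopology T (fst c)) a p F" using l p by (simp add: limitin_subtopology)
  then have "limitin euclidean (snd c \<circ> a) (snd c p) F"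
    using continuous_map_limit[OF is_chartD(5)[OF c]] by blast
  then show "(\<forall>\<^sub>F i in F. a i \<in> fst c) \<and> ((\<lambda>i. snd c (a i)) \<longlongrightarrow> snd c p) F"
    using ev by (simp add: o_def)
next
  assume *: "(\<forall>\<^sub>F i in F. a i \<in> fst c) \<and> ((\<lambda>i. snd c (a i)) \<longlongrightarrow> snd c p) F"
  show "limitin T a p F"
    unfolding limitin_def
  proof (intro conjI allI impI)
    show "p \<in> topspace T" using p openin_subset[OF is_chartD(1)[OF c]] by blast
    fix U assume U: "openin T U \<and> p \<in> U"
    obtain W where W: "open W" "snd c ` (U \<inter> fst c) = V \<inter> W"
      using is_chartD(6)[OF c] U unfolding openin_open by blast
    have "snd c p \<in> W" using W(2) U p by blast
    then have "\<forall>\<^sub>F i in F. snd c (a i) \<in> W" using * W(1) topological_tendstoD by blast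
    with * have "\<forall>\<^sub>F i in F. a i \<in> fst c \<and> snd c (a i) \<in> W" by (auto elim: eventually_elim2)
    then show "\<forall>\<^sub>F i in F. a i \<in> U"
    proof (rule eventually_mono)
      fix i assume i: "a i \<in> fst c \<and> snd c (a i) \<in> W"
      then have "snd c (a i) \<in> snd c ` (U \<inter> fst c)" using W(2) is_chartD(4)[OF c] by blast
      then show "a i \<in> U" using i is_chartD(3)[OF c] unfolding inj_on_def by blast
    qed
  qed
qed

lemma coord_rep_apply:
  "is_chart T V c \<Longrightarrow> x \<in> fst c \<Longrightarrow> coord_rep c d f (snd c x) = snd d (f x)"
  unfolding coord_rep_def o_def by (simp add: inv_into_f_f[OF is_chartD(3)])

lemma openin_coord_dom:
  assumes "is_chart (mtop M) V c" "is_chart (mtop N) W d" "continuous_map (mtop M) (mtop N) f"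
  shows "openin (top_of_set V) (coord_dom c d f)"
proof -
  have "openin (mtop M) {x \<in> topspace (mtop M). f x \<in> fst d}"
    using openin_continuous_map_preimage[OF assms(3) is_chartD(1)[OF assms(2)]] .
  from is_chartD(6)[OF assms(1) this] show ?thesis
    unfolding coord_dom_def using openin_subset[OF is_chartD(1)[OF assms(1)]]
    by (elim back_subst[of "openin _"]) auto
qed

text \<open>The derivative \<open>L\<close> is an argument because \<open>coord_deriv\<close> is
  determined on \<open>model M\<close> only. The radius condition keeps the coordinate
  representation away from points where \<open>inv_into\<close> takes arbitrary values or
  \<open>f\<close> leaves the target chart.\<close>

definition local_c11 ::
  "('a, 'e::euclidean_space) manifold \<Rightarrow> ('a, 'e) chart \<Rightarrow> ('b, 'f::euclidean_space) chart \<Rightarrow>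
    ('a \<Rightarrow> 'b) \<Rightarrow> 'a \<Rightarrow> ('e \<Rightarrow> 'f) \<Rightarrow> bool"
  where "local_c11 M c d f p L \<longleftrightarrow> p \<in> fst c \<and> f p \<in> fst d \<and>
    (\<exists>r>0. \<forall>y\<in>model M. norm y < r \<longrightarrow> snd c p + y \<in> coord_dom c d f) \<and>
    c11 (model M) (\<lambda>y. coord_rep c d f (snd c p + y) - snd d (f p)) L"

lemma openin_subspace_ball:
  assumes "openin (top_of_set V) U" "p \<in> U" "subspace V"
  obtains r where "r > 0" "\<And>y. y \<in> V \<Longrightarrow> norm y < r \<Longrightarrow> p + y \<in> U"
proof -
  obtain r where r: "r > 0" "ball p r \<inter> V \<subseteq> U" using assms unfolding openin_contains_ball by blast
  have "p \<in> V" using openin_subset[OF assms(1)] assms(2) by auto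
  then have "p + y \<in> U" if "y \<in> V" "norm y < r" for y
    using r that subspace_add[OF assms(3)] by (auto simp: dist_norm)
  with that r show thesis by blast
qed

lemma smooth_map_local_c11:
  assumes c': "is_chart (mtop M) (model M) c" and d': "is_chart (mtop N) (model N) d"
    and V: "subspace (model M)" and f: "smooth_map M N f"
    and c: "c \<in> charts M" and d: "d \<in> charts N" and p: "p \<in> fst c" "f p \<in> fst d"
  shows "local_c11 M c d f p (coord_deriv c d f p)"
proof -
  have op: "openin (top_of_set (model M)) (coord_dom c d f)"
    using openin_coord_dom[OF c' d'] f unfolding smooth_map_def by blast
  have pd: "snd c p \<in> coord_dom c d f" using p unfolding coord_dom_def by auto
  have "Ck_on 2 (model M) (coord_dom c d f) (coord_rep c d f)"
    using f c d unfolding smooth_map_def smooth_on_def by blast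
  from Ck_on_2_c11(2)[OF V op pd this] show ?thesis
    unfolding local_c11_def coord_deriv_def
    using p openin_subspace_ball[OF op pd V] coord_rep_apply[OF c' p(1)] by metis
qed

lemma local_c11_range:
  assumes c: "is_chart T (model M) c" and d: "is_chart T' W d" and W: "subspace W"
    and f: "local_c11 M c d f p L"
  obtains r where "r > 0"
    "\<And>y. y \<in> model M \<Longrightarrow> norm y < r \<Longrightarrow> snd c p + y \<in> coord_dom c d f \<and>
       coord_rep c d f (snd c p + y) \<in> snd d ` fst d \<and>
       coord_rep c d f (snd c p + y) - snd d (f p) \<in> W"
proof -
  obtain r where r: "r > 0" "\<And>y. y \<in> model M \<Longrightarrow> norm y < r \<Longrightarrow> snd c p + y \<in> coord_dom c d f"
    using f unfolding local_c11_def by blast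
  have fp: "snd d (f p) \<in> W" using f is_chartD(4)[OF d] unfolding local_c11_def by blast
  have 2: "coord_rep c d f (snd c p + y) \<in> snd d ` fst d" if y: "y \<in> model M" "norm y < r" for y
  proof -
    obtain x where x: "snd c p + y = snd c x" "x \<in> fst c" "f x \<in> fst d"
      using r(2)[OF y] unfolding coord_dom_def by auto
    show ?thesis using coord_rep_apply[OF c x(2), of d f] x by simp
  qed
  show thesis
    by (rule that[OF r(1)]) (use r 2 is_chartD(4)[OF d] subspace_diff[OF W _ fp] in blast)
qed

lemma local_c11_linear_range:
  assumes c: "is_chart T (model M) c" and d: "is_chart T' W d" and V: "subspace (model M)" and W: "subspace W"
    and f: "local_c11 M c d f p L" and v: "v \<in> model M"
  shows "L v \<in> W"
proof -
  obtain r where r: "r > 0" "\<And>y. y \<in> model M \<Longrightarrow> norm y < r \<Longrightarrow> coord_rep c d f (snd c p + y) - snd d (f p) \<in> W"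
    using local_c11_range[OF c d W f] by metis
  have "c11 (model M) (\<lambda>y. coord_rep c d f (snd c p + y) - snd d (f p)) L"
    using f unfolding local_c11_def by blast
  from c11_derivative_range[OF this V closed_subspace[OF W] W r v] show ?thesis .
qed

text \<open>Derivatives are unique on \<open>model M\<close>, so two expressions \<open>L\<close>
  obtained for one map in different ways agree there. Several identities between differentials below
  are proved in this manner.\<close>

lemma local_c11_coord_deriv:
  assumes c: "is_chart T (model M) c" and V: "subspace (model M)"
    and f: "local_c11 M c d f p L" and v: "v \<in> model M"
  shows "coord_deriv c d f p v = L v"
proof -
  obtain r where r: "r > 0" "\<And>y. y \<in> model M \<Longrightarrow> norm y < r \<Longrightarrow> snd c p + y \<in> coord_dom c d f"
    and p: "p \<in> fst c"
    and cl: "c11 (model M) (\<lambda>y. coord_rep c d f (snd c p + y) - snd d (f p)) L"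
    using f unfolding local_c11_def by blast
  define g where "g = coord_rep c d f"
  define q where "q = snd c p"
  \<comment> \<open>\<open>coord_dom c d f\<close> need not be open when \<open>f\<close> is
    controlled only near \<open>p\<close>; uniqueness is therefore applied on the relatively open
    ball \<open>U\<close> inside it.\<close>
  define U where "U = ball q r \<inter> model M"
  have qV: "q \<in> model M" using is_chartD(4)[OF c] p by (auto simp: q_def)
  have dV: "coord_dom c d f \<subseteq> model M" using is_chartD(4)[OF c] by (auto simp: coord_dom_def)
  have Us: "U \<subseteq> coord_dom c d f"
  proof
    fix x assume "x \<in> U"
    then have "x - q \<in> model M" "norm (x - q) < r"
      using subspace_diff[OF V] qV by (auto simp: U_def dist_norm norm_minus_commute)
    from r(2)[OF this] show "x \<in> coord_dom c d f" by (simp add: q_def)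
  qed
  have tr: "(\<lambda>x. x - q) ` coord_dom c d f \<subseteq> model M" using dV qV subspace_diff[OF V] by auto
  have "((\<lambda>y. g (q + y) - snd d (f p)) has_derivative L) (at (q - q) within (\<lambda>x. x - q) ` coord_dom c d f)"
    using has_derivative_subset[OF c11_derivative[OF cl V] tr] by (simp add: g_def q_def)
  moreover have "((\<lambda>x. x - q) has_derivative (\<lambda>x. x)) (at q within coord_dom c d f)"
    by (auto intro!: derivative_eq_intros)
  ultimately have "((\<lambda>x. g (q + (x - q)) - snd d (f p)) has_derivative (\<lambda>x. L x)) (at q within coord_dom c d f)"
    by (rule has_derivative_in_compose[rotated])
  then have "((\<lambda>x. (g x - snd d (f p)) + snd d (f p)) has_derivative (\<lambda>x. L x + 0)) (at q within coord_dom c d f)"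
    by (intro has_derivative_add has_derivative_const) simp
  then have D: "(g has_derivative L) (at q within coord_dom c d f)" by simp
  have D': "(g has_derivative coord_deriv c d f p) (at q within coord_dom c d f)"
    using D differentiableI frechet_derivative_works unfolding coord_deriv_def g_def q_def by blast
  have "openin (top_of_set (model M)) U" unfolding U_def openin_open by (auto intro: exI[of _ "ball q r"])
  from has_derivative_unique_on_subspace[OF V this _ has_derivative_subset[OF D' Us] has_derivative_subset[OF D Us] v]
  show ?thesis using r qV by (simp add: U_def)
qed

lemma local_c11_compose:
  assumes c': "is_chart S (model M) c" and d': "is_chart T (model N) d"
    and V: "subspace (model M)" and W: "subspace (model N)"
    and f: "local_c11 M c d f p L" and g: "local_c11 N d e g (f p) K"
  shows "local_c11 M c e (\<lambda>x. g (f x)) p (\<lambda>v. K (L v))"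
proof -
  have p: "p \<in> fst c" "f p \<in> fst d" "g (f p) \<in> fst e"
    and fc: "c11 (model M) (\<lambda>y. coord_rep c d f (snd c p + y) - snd d (f p)) L" (is "c11 _ ?f _")
    and gc: "c11 (model N) (\<lambda>y. coord_rep d e g (snd d (f p) + y) - snd e (g (f p))) K" (is "c11 _ ?g _")
    using f g unfolding local_c11_def by auto
  obtain r where r: "r > 0" "\<And>y. y \<in> model M \<Longrightarrow> norm y < r \<Longrightarrow> snd c p + y \<in> coord_dom c d f \<and> ?f y \<in> model N"
    using local_c11_range[OF c' d' W f] by metis
  obtain s where s: "s > 0" "\<And>y. y \<in> model N \<Longrightarrow> norm y < s \<Longrightarrow> snd d (f p) + y \<in> coord_dom d e g"
    using g unfolding local_c11_def by blast
  obtain t where t: "t > 0" "\<And>y. y \<in> model M \<Longrightarrow> norm y < t \<Longrightarrow> norm (?f y) < s"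
    using c11_small[OF fc V s(1)] by metis
  have key: "snd c p + y \<in> coord_dom c e (\<lambda>x. g (f x)) \<and>
     coord_rep d e g (snd d (f p) + ?f y) = coord_rep c e (\<lambda>x. g (f x)) (snd c p + y)"
    if y: "y \<in> model M" "norm y < min r t" for y
  proof -
    obtain x where x: "snd c p + y = snd c x" "x \<in> fst c" "f x \<in> fst d"
      using r(2)[of y] y unfolding coord_dom_def by auto
    have fx: "?f y = snd d (f x) - snd d (f p)" using x coord_rep_apply[OF c' x(2), of d f] by simp
    then have "snd d (f x) \<in> coord_dom d e g" using s(2)[of "?f y"] r(2)[of y] t(2)[of y] y by simp
    then have "g (f x) \<in> fst e"
      unfolding coord_dom_def using x(3) is_chartD(3)[OF d'] unfolding inj_on_def by auto
    then show ?thesis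
      using x coord_rep_apply[OF c' x(2), of e "\<lambda>x. g (f x)"] coord_rep_apply[OF d' x(3), of e g]
      unfolding fx by (auto simp: coord_dom_def)
  qed
  have "c11 (model M) (\<lambda>y. ?g (?f y)) (\<lambda>v. K (L v))"
    by (rule c11_compose[OF fc gc V W]) (use r in blast)
  then have "c11 (model M) (\<lambda>y. coord_rep c e (\<lambda>x. g (f x)) (snd c p + y) - snd e (g (f p))) (\<lambda>v. K (L v))"
    by (rule c11_cong[OF _ V, of _ _ "min r t"])
      (use r(1) t(1) key fc gc bounded_linear_compose in \<open>auto simp: c11_def\<close>)
  then show ?thesis
    unfolding local_c11_def using p key r(1) t(1) by (intro conjI exI[of _ "min r t"]) auto
qed

lemma local_c11_cong_near:
  assumes f: "local_c11 M c d f p L" and r0: "r0 > 0"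
    and eq: "\<And>x. x \<in> fst c \<Longrightarrow> norm (snd c x - snd c p) < r0 \<Longrightarrow> f x = g x"
    and c: "is_chart T (model M) c" and V: "subspace (model M)"
  shows "local_c11 M c d g p L"
proof -
  have p: "p \<in> fst c" "f p \<in> fst d" using f by (simp_all add: local_c11_def)
  have fgp: "f p = g p" using eq[OF p(1)] r0 by simp
  obtain r where r: "r > 0" "\<And>y. y \<in> model M \<Longrightarrow> norm y < r \<Longrightarrow> snd c p + y \<in> coord_dom c d f"
    using f unfolding local_c11_def by blast
  have near: "snd c p + y \<in> coord_dom c d g \<and> coord_rep c d f (snd c p + y) = coord_rep c d g (snd c p + y)"
    if y: "y \<in> model M" "norm y < min r r0" for y
  proof -
    obtain x where x: "snd c p + y = snd c x" "x \<in> fst c" "f x \<in> fst d"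
      using r(2)[of y] y unfolding coord_dom_def by auto
    have "norm (snd c x - snd c p) < r0" unfolding x(1)[symmetric] using y by simp
    from eq[OF x(2) this] have e: "f x = g x" .
    show ?thesis
      unfolding x(1) coord_rep_apply[OF c x(2)] using x e by (auto simp: coord_dom_def)
  qed
  have cf: "c11 (model M) (\<lambda>y. coord_rep c d f (snd c p + y) - snd d (f p)) L"
    using f unfolding local_c11_def by blast
  then have bl: "bounded_linear L" by (simp add: c11_def)
  have m: "0 < min r r0" using r(1) r0 by simp
  have "c11 (model M) (\<lambda>y. coord_rep c d g (snd c p + y) - snd d (g p)) L"
    by (rule c11_cong[OF cf V m _ bl]) (use near fgp in auto)
  then show ?thesis unfolding local_c11_def using p fgp near m by (intro conjI exI[of _ "min r r0"]) auto
qed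

lemma local_c11_cong:
  assumes "local_c11 M c d f p L" "\<And>x. x \<in> fst c \<Longrightarrow> f x = g x" "is_chart T (model M) c" "subspace (model M)"
  shows "local_c11 M c d g p L"
  by (rule local_c11_cong_near[OF assms(1) zero_less_one assms(2) assms(3,4)])

text \<open>With \<open>F = at 0\<close> and \<open>s h = 1/h\<close> this describes the velocity of a curve, with \<open>s n = 2\<^sup>n\<close> the
  direction in which a sequence approaches \<open>p\<close>.\<close>

definition tangent_limit ::
  "('a, 'e::euclidean_space) chart \<Rightarrow> 'a \<Rightarrow> 'i filter \<Rightarrow> ('i \<Rightarrow> real) \<Rightarrow> ('i \<Rightarrow> 'a) \<Rightarrow> 'e \<Rightarrow> bool"
  where "tangent_limit c p F s a v \<longleftrightarrow> (\<forall>\<^sub>F i in F. a i \<in> fst c) \<and> ((\<lambda>i. snd c (a i)) \<longlongrightarrow> snd c p) F \<and>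
    ((\<lambda>i. s i *\<^sub>R (snd c (a i) - snd c p)) \<longlongrightarrow> v) F"

lemma tangent_limit_map:
  assumes c: "is_chart T (model M) c" and V: "subspace (model M)"
    and a: "tangent_limit c p F s a v" and f: "local_c11 M c d f p L"
  shows "tangent_limit d (f p) F s (\<lambda>i. f (a i)) (L v)"
proof -
  have p: "p \<in> fst c"
    and fc: "c11 (model M) (\<lambda>y. coord_rep c d f (snd c p + y) - snd d (f p)) L" (is "c11 _ ?f _")
    using f unfolding local_c11_def by auto
  obtain r where r: "r > 0" "\<And>y. y \<in> model M \<Longrightarrow> norm y < r \<Longrightarrow> snd c p + y \<in> coord_dom c d f"
    using f unfolding local_c11_def by blast
  define x where "x i = snd c (a i) - snd c p" for i
  have ev: "\<forall>\<^sub>F i in F. a i \<in> fst c" and l: "((\<lambda>i. snd c (a i)) \<longlongrightarrow> snd c p) F"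
    and sx: "((\<lambda>i. s i *\<^sub>R x i) \<longlongrightarrow> v) F"
    using a unfolding tangent_limit_def x_def by auto
  have x0: "(x \<longlongrightarrow> 0) F" unfolding x_def using LIM_zero[OF l] .
  have xV: "\<forall>\<^sub>F i in F. x i \<in> model M"
    using ev by (rule eventually_mono)
      (use is_chartD(4)[OF c] p in \<open>unfold x_def, blast intro: subspace_diff[OF V]\<close>)
  have eq: "\<forall>\<^sub>F i in F. ?f (x i) = snd d (f (a i)) - snd d (f p)"
    using ev by (rule eventually_mono) (use coord_rep_apply[OF c, of _ d f] in \<open>simp add: x_def\<close>)
  have "\<forall>\<^sub>F i in F. norm (x i) < r" using order_tendstoD(2)[OF tendsto_norm[OF x0], of r] r(1) by simp
  with xV ev have "\<forall>\<^sub>F i in F. f (a i) \<in> fst d"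
  proof eventually_elim
    case (elim i)
    then have "snd c (a i) \<in> coord_dom c d f" using r(2)[of "x i"] by (simp add: x_def)
    then show ?case
      unfolding coord_dom_def using elim(2) is_chartD(3)[OF c] unfolding inj_on_def by auto
  qed
  moreover have "((\<lambda>i. snd d (f (a i)) - snd d (f p)) \<longlongrightarrow> 0) F"
    by (rule Lim_transform_eventually[OF c11_tendsto(1)[OF fc V xV x0 sx] eq])
  then have "((\<lambda>i. snd d (f (a i))) \<longlongrightarrow> snd d (f p)) F" by (rule LIM_zero_cancel)
  moreover have "((\<lambda>i. s i *\<^sub>R (snd d (f (a i)) - snd d (f p))) \<longlongrightarrow> L v) F"
    by (rule Lim_transform_eventually[OF c11_tendsto(2)[OF fc V xV x0 sx]])
      (use eq in \<open>auto elim: eventually_mono\<close>)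
  ultimately show ?thesis unfolding tangent_limit_def by blast
qed

lemma tangent_limit_in_model:
  assumes c: "is_chart T V c" and V: "subspace V" and p: "p \<in> fst c"
    and a: "tangent_limit c p F s a v" and F: "F \<noteq> bot"
  shows "v \<in> V"
proof (rule Lim_in_closed_set[OF closed_subspace[OF V] _ F])
  show "((\<lambda>i. s i *\<^sub>R (snd c (a i) - snd c p)) \<longlongrightarrow> v) F" using a unfolding tangent_limit_def by blast
  show "\<forall>\<^sub>F i in F. s i *\<^sub>R (snd c (a i) - snd c p) \<in> V"
    using conjunct1[OF a[unfolded tangent_limit_def]]
    by (rule eventually_mono) (use is_chartD(4)[OF c] p in \<open>blast intro: subspace_scale[OF V] subspace_diff[OF V]\<close>)
qed

text \<open>The derivative of \<open>snd d o \<gamma>\<close> does not notice whether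
  \<open>\<gamma>\<close> stays in the chart, hence the separate conjunct about membership.\<close>

lemma has_vector_derivative_iff_tangent_limit:
  fixes d :: "('a, 'e::euclidean_space) chart"
  assumes d: "is_chart T V d" and p: "\<gamma> t \<in> fst d"
  shows "tangent_limit d (\<gamma> t) (at 0) (\<lambda>h. 1 / h) (\<lambda>h. \<gamma> (t + h)) v \<longleftrightarrow>
    (\<forall>\<^sub>F h in at 0. \<gamma> (t + h) \<in> fst d) \<and> ((snd d \<circ> \<gamma>) has_vector_derivative v) (at t)"
proof -
  have "((snd d \<circ> \<gamma>) has_vector_derivative v) (at t) \<longleftrightarrow>
    ((\<lambda>h. (1 / h) *\<^sub>R (snd d (\<gamma> (t + h)) - snd d (\<gamma> t))) \<longlongrightarrow> v) (at 0)"
    unfolding has_vector_derivative_def has_derivative_at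
  proof -
    have bl: "bounded_linear (\<lambda>x. x *\<^sub>R v)" by (rule bounded_linear_scaleR_left)
    have "((\<lambda>h. norm ((snd d \<circ> \<gamma>) (t + h) - (snd d \<circ> \<gamma>) t - h *\<^sub>R v) / norm h) \<longlongrightarrow> 0) (at 0) \<longleftrightarrow>
        ((\<lambda>h. norm ((1 / h) *\<^sub>R (snd d (\<gamma> (t + h)) - snd d (\<gamma> t)) - v)) \<longlongrightarrow> 0) (at 0)"
    proof (rule filterlim_cong[OF refl refl])
      show "\<forall>\<^sub>F h in at 0. norm ((snd d \<circ> \<gamma>) (t + h) - (snd d \<circ> \<gamma>) t - h *\<^sub>R v) / norm h =
          norm ((1 / h) *\<^sub>R (snd d (\<gamma> (t + h)) - snd d (\<gamma> t)) - v)"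
        unfolding eventually_at_filter
      proof (rule always_eventually, intro allI impI)
        fix h :: real assume h: "h \<noteq> 0"
        have "(1 / h) *\<^sub>R (snd d (\<gamma> (t + h)) - snd d (\<gamma> t)) - v = (1 / h) *\<^sub>R (snd d (\<gamma> (t + h)) - snd d (\<gamma> t) - h *\<^sub>R v)"
          using h by (simp add: scaleR_right_diff_distrib)
        then show "norm ((snd d \<circ> \<gamma>) (t + h) - (snd d \<circ> \<gamma>) t - h *\<^sub>R v) / norm h =
          norm ((1 / h) *\<^sub>R (snd d (\<gamma> (t + h)) - snd d (\<gamma> t)) - v)" by (simp add: divide_inverse mult.commute)
      qed
    qed
    then show "(bounded_linear (\<lambda>x. x *\<^sub>R v) \<and>
      ((\<lambda>h. norm ((snd d \<circ> \<gamma>) (t + h) - (snd d \<circ> \<gamma>) t - h *\<^sub>R v) / norm h) \<longlongrightarrow> 0) (at 0)) \<longleftrightarrow>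
      ((\<lambda>h. (1 / h) *\<^sub>R (snd d (\<gamma> (t + h)) - snd d (\<gamma> t))) \<longlongrightarrow> v) (at 0)"
      using bl by (simp add: tendsto_norm_zero_iff LIM_zero_iff)
  qed
  moreover have "((\<lambda>h. snd d (\<gamma> (t + h))) \<longlongrightarrow> snd d (\<gamma> t)) (at 0)"
    if "((snd d \<circ> \<gamma>) has_vector_derivative v) (at t)"
    using has_vector_derivative_continuous[OF that] unfolding isCont_iff o_def .
  ultimately show ?thesis
    unfolding tangent_limit_def by blast
qed

lemma smooth_map_id:
  assumes "smooth_manifold M"
  shows "smooth_map M M id"
  using assms unfolding smooth_manifold_def smooth_map_def by simp

lemma coord_change_self:
  assumes M: "smooth_manifold M" and c: "c \<in> charts M" and p: "p \<in> fst c" and v: "v \<in> model M"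
  shows "coord_deriv c c id p v = v"
proof -
  note c' = smooth_manifoldD(3)[OF M c] and V = smooth_manifoldD(2)[OF M]
  have l: "local_c11 M c c id p (coord_deriv c c id p)"
    using smooth_map_local_c11[OF c' c' V smooth_map_id[OF M] c c p] p by simp
  obtain r where r: "r > 0" "\<And>y. y \<in> model M \<Longrightarrow> norm y < r \<Longrightarrow> snd c p + y \<in> coord_dom c c id"
    using l unfolding local_c11_def by blast
  have cl: "c11 (model M) (\<lambda>y. coord_rep c c id (snd c p + y) - snd c (id p)) (coord_deriv c c id p)" (is "c11 _ ?f _")
    using l unfolding local_c11_def by blast
  have fy: "?f y = y" if y: "y \<in> model M" "norm y < r" for y
  proof -
    obtain x where x: "snd c p + y = snd c x" "x \<in> fst c"
      using r(2)[OF y] unfolding coord_dom_def by auto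
    have "?f y = (snd c p + y) - snd c p"
      unfolding x(1) coord_rep_apply[OF c' x(2)] by simp
    then show ?thesis by simp
  qed
  have "local_c11 M c c id p (\<lambda>y. y)"
    unfolding local_c11_def
  proof (intro conjI)
    show "c11 (model M) ?f (\<lambda>y. y)"
      by (rule c11_cong[OF c11_linear[OF bounded_linear_ident] V r(1)]) (use fy in \<open>auto simp: bounded_linear_ident\<close>)
  qed (use p r in auto)
  from local_c11_coord_deriv[OF c' V this v] show ?thesis .
qed

lemma coord_deriv_comp:
  assumes M: "smooth_manifold M" and N: "smooth_manifold N" and f: "smooth_map M N f"
    and c: "c \<in> charts M" "p \<in> fst c" and c1: "c1 \<in> charts M" "p \<in> fst c1" and d: "d \<in> charts N" "f p \<in> fst d"
    and v: "v \<in> model M"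
  shows "coord_deriv c1 d f p (coord_deriv c c1 id p v) = coord_deriv c d f p v"
proof -
  note c' = smooth_manifoldD(3)[OF M c(1)] and V = smooth_manifoldD(2)[OF M]
  note c1' = smooth_manifoldD(3)[OF M c1(1)] and d' = smooth_manifoldD(3)[OF N d(1)]
  have 1: "local_c11 M c c1 id p (coord_deriv c c1 id p)"
    using smooth_map_local_c11[OF c' c1' V smooth_map_id[OF M] c(1) c1(1) c(2)] c1(2) by simp
  have 2: "local_c11 M c1 d f (id p) (coord_deriv c1 d f p)"
    using smooth_map_local_c11[OF c1' d' V f c1(1) d(1) c1(2) d(2)] by simp
  have "local_c11 M c d f p (\<lambda>v. coord_deriv c1 d f p (coord_deriv c c1 id p v))"
    using local_c11_compose[OF c' c1' V V 1 2] by simp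
  from local_c11_coord_deriv[OF c' V this v] show ?thesis by simp
qed

lemma coord_vector_tangent:
  assumes M: "smooth_manifold M" and c: "c \<in> charts M" "p \<in> fst c" and v: "v \<in> model M"
  shows "coord_vector M c v p \<in> tangent_space M p" "coord_vector M c v p c = v"
proof -
  note V = smooth_manifoldD(2)[OF M] and c' = smooth_manifoldD(3)[OF M]
  show "coord_vector M c v p c = v"
    using coord_change_self[OF M c v] c by (simp add: coord_vector_def)
  have "coord_deriv c d id p v \<in> model M" if "d \<in> charts M" "p \<in> fst d" for d
    using local_c11_linear_range[OF c'[OF c(1)] c'[OF that(1)] V V smooth_map_local_c11[OF c'[OF c(1)] c'[OF that(1)] V smooth_map_id[OF M] c(1) that(1) c(2)] v]
      that by simp
  moreover have "coord_deriv d e id p (coord_deriv c d id p v) = coord_deriv c e id p v"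
    if "d \<in> charts M" "e \<in> charts M" "p \<in> fst d" "p \<in> fst e" for d e
    using coord_deriv_comp[OF M M smooth_map_id[OF M] c that(1,3,2) _ v] that by simp
  ultimately show "coord_vector M c v p \<in> tangent_space M p"
    unfolding tangent_space_def coord_vector_def by auto
qed

lemma chart_at:
  assumes "smooth_manifold M" "p \<in> topspace (mtop M)"
  shows "chart_at M p \<in> charts M" "p \<in> fst (chart_at M p)"
proof -
  have "\<exists>c. c \<in> charts M \<and> p \<in> fst c" using smooth_manifoldD(4)[OF assms(1)] assms(2) by blast
  from someI_ex[OF this] show "chart_at M p \<in> charts M" "p \<in> fst (chart_at M p)"
    unfolding chart_at_def by auto
qed

section \<open>Lie groups near the identity\<close>

definition chart_prod :: "('a, 'e) chart \<Rightarrow> ('b, 'f) chart \<Rightarrow> ('a \<times> 'b, 'e \<times> 'f) chart" where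
  "chart_prod c d = (fst c \<times> fst d, map_prod (snd c) (snd d))"

lemma chart_prod_simps [simp]:
  "fst (chart_prod c d) = fst c \<times> fst d" "snd (chart_prod c d) (x, y) = (snd c x, snd d y)"
  by (simp_all add: chart_prod_def)

lemma is_chart_prod:
  assumes c: "is_chart S V c" and d: "is_chart T W d"
  shows "is_chart (prod_topology S T) (V \<times> W) (chart_prod c d)"
proof -
  have im: "snd (chart_prod c d) ` (fst c \<times> fst d) = (snd c ` fst c) \<times> (snd d ` fst d)"
    unfolding chart_prod_def snd_conv by (rule map_prod_surj_on) simp_all
  obtain f g where "homeomorphic_maps (subtopology S (fst c)) (top_of_set (snd c ` fst c)) (snd c) f"
    "homeomorphic_maps (subtopology T (fst d)) (top_of_set (snd d ` fst d)) (snd d) g"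
    using c d unfolding is_chart_def homeomorphic_map_maps by blast
  then have "homeomorphic_maps (prod_topology (subtopology S (fst c)) (subtopology T (fst d)))
     (prod_topology (top_of_set (snd c ` fst c)) (top_of_set (snd d ` fst d)))
     (\<lambda>(x, y). (snd c x, snd d y)) (\<lambda>(x, y). (f x, g y))"
    unfolding homeomorphic_maps_prod by blast
  then have "homeomorphic_map (subtopology (prod_topology S T) (fst c \<times> fst d))
     (top_of_set (snd c ` fst c \<times> snd d ` fst d)) (snd (chart_prod c d))"
    unfolding homeomorphic_map_maps chart_prod_def subtopology_Times[symmetric] prod_topology_euclidean
      snd_conv map_prod_def by blast
  moreover have "openin (prod_topology S T) (fst c \<times> fst d)"
    using c d unfolding is_chart_def openin_prod_Times_iff by blast
  moreover have "openin (top_of_set (V \<times> W)) ((snd c ` fst c) \<times> (snd d ` fst d))"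
    using c d unfolding is_chart_def by (blast intro: openin_Times)
  ultimately show ?thesis unfolding is_chart_def chart_prod_simps(1) im by blast
qed

lemma local_c11_cong_deriv:
  assumes f: "local_c11 M c d f p L" and V: "subspace (model M)" and K: "bounded_linear K"
    and eq: "\<And>v. v \<in> model M \<Longrightarrow> L v = K v"
  shows "local_c11 M c d f p K"
proof -
  have "c11 (model M) (\<lambda>y. coord_rep c d f (snd c p + y) - snd d (f p)) L"
    using f unfolding local_c11_def by blast
  from c11_cong[OF this V zero_less_one refl K eq] show ?thesis
    using f unfolding local_c11_def by blast
qed

lemma local_c11_Pair:
  assumes c: "is_chart T (model M) c" and V: "subspace (model M)"
    and f: "local_c11 M c d f p L" and g: "local_c11 M c e g p K"
  shows "local_c11 M c (chart_prod d e) (\<lambda>x. (f x, g x)) p (\<lambda>v. (L v, K v))"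
proof -
  have p: "p \<in> fst c" "f p \<in> fst d" "g p \<in> fst e"
    and fc: "c11 (model M) (\<lambda>y. coord_rep c d f (snd c p + y) - snd d (f p)) L"
    and gc: "c11 (model M) (\<lambda>y. coord_rep c e g (snd c p + y) - snd e (g p)) K"
    using f g unfolding local_c11_def by auto
  obtain r where r: "r > 0" "\<And>y. y \<in> model M \<Longrightarrow> norm y < r \<Longrightarrow> snd c p + y \<in> coord_dom c d f"
    using f unfolding local_c11_def by blast
  obtain s where s: "s > 0" "\<And>y. y \<in> model M \<Longrightarrow> norm y < s \<Longrightarrow> snd c p + y \<in> coord_dom c e g"
    using g unfolding local_c11_def by blast
  have dom: "snd c p + y \<in> coord_dom c (chart_prod d e) (\<lambda>x. (f x, g x))"
    if y: "y \<in> model M" "norm y < min r s" for y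
  proof -
    obtain x where x: "snd c p + y = snd c x" "x \<in> fst c" "f x \<in> fst d"
      using r(2)[of y] y unfolding coord_dom_def by auto
    obtain x' where x': "snd c p + y = snd c x'" "x' \<in> fst c" "g x' \<in> fst e"
      using s(2)[of y] y unfolding coord_dom_def by auto
    have "x = x'" using x x' is_chartD(3)[OF c] by (metis inj_onD)
    then show ?thesis using x x' unfolding coord_dom_def by auto
  qed
  have "(\<lambda>y. (coord_rep c d f (snd c p + y) - snd d (f p), coord_rep c e g (snd c p + y) - snd e (g p))) =
    (\<lambda>y. coord_rep c (chart_prod d e) (\<lambda>x. (f x, g x)) (snd c p + y) - snd (chart_prod d e) (f p, g p))"
    by (auto simp: coord_rep_def)
  with c11_Pair[OF fc gc] have "c11 (model M) (\<lambda>y. coord_rep c (chart_prod d e) (\<lambda>x. (f x, g x)) (snd c p + y)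
      - snd (chart_prod d e) (f p, g p)) (\<lambda>v. (L v, K v))" by simp
  then show ?thesis
    unfolding local_c11_def using p dom r(1) s(1) by (intro conjI exI[of _ "min r s"]) auto
qed

lemma local_c11_const:
  assumes c: "is_chart T (model M) c" and V: "subspace (model M)" and p: "p \<in> fst c" and k: "k \<in> fst d"
  shows "local_c11 M c d (\<lambda>x. k) p (\<lambda>v. 0)"
proof -
  have "coord_dom c d (\<lambda>x. k) = snd c ` fst c" using k by (auto simp: coord_dom_def)
  moreover have "snd c p \<in> snd c ` fst c" using p by simp
  ultimately obtain r where "r > 0" "\<And>y. y \<in> model M \<Longrightarrow> norm y < r \<Longrightarrow> snd c p + y \<in> coord_dom c d (\<lambda>x. k)"
    using openin_subspace_ball[OF is_chartD(2)[OF c] _ V] by metis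
  moreover have "(\<lambda>y. coord_rep c d (\<lambda>x. k) (snd c p + y) - snd d k) = (\<lambda>y. 0)" by (simp add: coord_rep_def)
  ultimately show ?thesis
    unfolding local_c11_def using p k c11_linear[OF bounded_linear_zero] by metis
qed

lemma local_c11_ident:
  assumes c: "is_chart T (model M) c" and V: "subspace (model M)" and p: "p \<in> fst c"
  shows "local_c11 M c c (\<lambda>x. x) p (\<lambda>v. v)"
proof -
  have "coord_dom c c (\<lambda>x. x) = snd c ` fst c" by (auto simp: coord_dom_def)
  moreover have "snd c p \<in> snd c ` fst c" using p by simp
  ultimately obtain r where r: "r > 0" "\<And>y. y \<in> model M \<Longrightarrow> norm y < r \<Longrightarrow> snd c p + y \<in> coord_dom c c (\<lambda>x. x)"
    using openin_subspace_ball[OF is_chartD(2)[OF c] _ V] by metis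
  have "y = coord_rep c c (\<lambda>x. x) (snd c p + y) - snd c p" if y: "y \<in> model M" "norm y < r" for y
  proof -
    obtain x where x: "snd c p + y = snd c x" "x \<in> fst c"
      using r(2)[OF y] unfolding coord_dom_def by auto
    have "coord_rep c c (\<lambda>x. x) (snd c p + y) = snd c p + y"
      unfolding x(1) coord_rep_apply[OF c x(2)] ..
    then show ?thesis by simp
  qed
  then have "c11 (model M) (\<lambda>y. coord_rep c c (\<lambda>x. x) (snd c p + y) - snd c p) (\<lambda>v. v)"
    by (intro c11_cong[OF c11_linear[OF bounded_linear_ident] V r(1)]) (auto simp: bounded_linear_ident)
  then show ?thesis unfolding local_c11_def using p r by blast
qed

lemma tangent_limit_Pair:
  assumes "tangent_limit c p F s a v" "tangent_limit d q F s b w"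
  shows "tangent_limit (chart_prod c d) (p, q) F s (\<lambda>i. (a i, b i)) (v, w)"
proof -
  have ev: "\<forall>\<^sub>F i in F. a i \<in> fst c" "\<forall>\<^sub>F i in F. b i \<in> fst d"
    and l: "((\<lambda>i. snd c (a i)) \<longlongrightarrow> snd c p) F" "((\<lambda>i. snd d (b i)) \<longlongrightarrow> snd d q) F"
    and sl: "((\<lambda>i. s i *\<^sub>R (snd c (a i) - snd c p)) \<longlongrightarrow> v) F" "((\<lambda>i. s i *\<^sub>R (snd d (b i) - snd d q)) \<longlongrightarrow> w) F"
    using assms unfolding tangent_limit_def by auto
  show ?thesis
    unfolding tangent_limit_def
  proof (intro conjI)
    show "\<forall>\<^sub>F i in F. (a i, b i) \<in> fst (chart_prod c d)" using ev by (auto elim: eventually_elim2)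
    show "((\<lambda>i. snd (chart_prod c d) (a i, b i)) \<longlongrightarrow> snd (chart_prod c d) (p, q)) F"
      using tendsto_Pair[OF l] by simp
    show "((\<lambda>i. s i *\<^sub>R (snd (chart_prod c d) (a i, b i) - snd (chart_prod c d) (p, q))) \<longlongrightarrow> (v, w)) F"
      using tendsto_Pair[OF sl] by simp
  qed
qed

locale lie_group_on = group G for G :: "('a, 'b) monoid_scheme" (structure) +
  fixes M :: "('a, 'e::euclidean_space) manifold"
  assumes lie: "lie_group G M"
begin

lemma M: "smooth_manifold M" and carrier: "topspace (mtop M) = carrier G"
  and mult_smooth: "smooth_map (prod_manifold M M) M (\<lambda>(x, y). x \<otimes> y)"
  and inv_smooth: "smooth_map M M (\<lambda>x. inv x)"
  using lie unfolding lie_group_def by auto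

abbreviation V :: "'e set" where "V \<equiv> model M"
abbreviation T :: "'a topology" where "T \<equiv> mtop M"
abbreviation c0 :: "('a, 'e) chart" where "c0 \<equiv> chart_at M \<one>"

lemma V: "subspace V" using smooth_manifoldD(2)[OF M] .

lemma VV: "subspace (V \<times> V)" using V by (simp add: subspace_Times)

lemma Hausdorff: "Hausdorff_space T" using smooth_manifoldD(1)[OF M] .

lemma c0: "c0 \<in> charts M" "\<one> \<in> fst c0"
  using chart_at[OF M] carrier by auto

lemma chart: "c \<in> charts M \<Longrightarrow> is_chart T V c" using smooth_manifoldD(3)[OF M] .

lemmas c0_chart = chart[OF c0(1)]

lemma chart_carrier: "c \<in> charts M \<Longrightarrow> fst c \<subseteq> carrier G"
  using openin_subset[OF is_chartD(1)[OF chart]] carrier by simp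

lemma prod_manifold_simps [simp]:
  "model (prod_manifold M M) = V \<times> V" "mtop (prod_manifold M M) = prod_topology T T"
  by (simp_all add: prod_manifold_def)

lemma chart_prod_mem: "c \<in> charts M \<Longrightarrow> d \<in> charts M \<Longrightarrow> chart_prod c d \<in> charts (prod_manifold M M)"
  unfolding prod_manifold_def chart_prod_def manifold.simps by blast

lemma continuous_mult: "continuous_map (prod_topology T T) T (\<lambda>(x, y). x \<otimes> y)"
  using mult_smooth by (simp add: smooth_map_def)

lemma continuous_inv: "continuous_map T T (\<lambda>x. inv x)"
  using inv_smooth by (simp add: smooth_map_def)

lemma continuous_map_mult:
  assumes "continuous_map X T f" "continuous_map X T g"
  shows "continuous_map X T (\<lambda>x. f x \<otimes> g x)"
  using continuous_map_compose[OF continuous_map_pairedI[OF assms] continuous_mult] by (simp add: o_def)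

lemma continuous_map_inv:
  assumes "continuous_map X T f"
  shows "continuous_map X T (\<lambda>x. inv (f x))"
  using continuous_map_compose[OF assms continuous_inv] by (simp add: o_def)

lemma limitin_mult:
  assumes "limitin T a g F" "limitin T b h F"
  shows "limitin T (\<lambda>i. a i \<otimes> b i) (g \<otimes> h) F"
proof -
  have "limitin (prod_topology T T) (\<lambda>i. (a i, b i)) (g, h) F"
    using assms by (simp add: limitin_pairwise o_def)
  from continuous_map_limit[OF continuous_mult this] show ?thesis by (simp add: o_def)
qed

lemma limitin_inv:
  assumes "limitin T a g F"
  shows "limitin T (\<lambda>i. inv (a i)) (inv g) F"
  using continuous_map_limit[OF continuous_inv assms] by (simp add: o_def)

lemma limitin_pow:
  assumes "limitin T a g F"
  shows "limitin T (\<lambda>i. a i [^] (n::nat)) (g [^] n) F"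
proof (induction n)
  case 0
  then show ?case by (simp add: carrier)
next
  case (Suc n)
  then show ?case using limitin_mult[OF Suc assms] by simp
qed

lemma local_c11_mult:
  assumes c: "is_chart S (model N) c" and W: "subspace (model N)"
    and f: "local_c11 N c d f p L" and g: "local_c11 N c e g p K"
    and ch: "d \<in> charts M" "e \<in> charts M" "k \<in> charts M" and k: "f p \<otimes> g p \<in> fst k"
  shows "local_c11 N c k (\<lambda>x. f x \<otimes> g x) p
    (\<lambda>v. coord_deriv (chart_prod d e) k (\<lambda>(x, y). x \<otimes> y) (f p, g p) (L v, K v))"
proof -
  have p: "f p \<in> fst d" "g p \<in> fst e" using f g by (auto simp: local_c11_def)
  have de: "is_chart (mtop (prod_manifold M M)) (model (prod_manifold M M)) (chart_prod d e)"
    using is_chart_prod[OF chart[OF ch(1)] chart[OF ch(2)]] by simp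
  have VV': "subspace (model (prod_manifold M M))" using VV by simp
  have "local_c11 (prod_manifold M M) (chart_prod d e) k (\<lambda>(x, y). x \<otimes> y) (f p, g p)
    (coord_deriv (chart_prod d e) k (\<lambda>(x, y). x \<otimes> y) (f p, g p))"
    by (rule smooth_map_local_c11[OF de chart[OF ch(3)] VV' mult_smooth chart_prod_mem[OF ch(1,2)] ch(3)])
      (use p k in auto)
  from local_c11_compose[OF c de W VV' local_c11_Pair[OF c W f g] this]
  show ?thesis by simp
qed

text \<open>\<open>x \<otimes> \<one> = x\<close> and \<open>\<one> \<otimes> x = x\<close> make
  both partial derivatives the identity, and linearity adds them.\<close>

lemma mult_deriv_one:
  assumes v: "v \<in> V" "w \<in> V"
  shows "coord_deriv (chart_prod c0 c0) c0 (\<lambda>(x, y). x \<otimes> y) (\<one>, \<one>) (v, w) = v + w"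
proof -
  define D where "D = coord_deriv (chart_prod c0 c0) c0 (\<lambda>(x, y). x \<otimes> y) (\<one>, \<one>)"
  have 11: "\<one> \<otimes> \<one> \<in> fst c0" using c0 by simp
  note id = local_c11_ident[OF c0_chart V c0(2)] and k = local_c11_const[OF c0_chart V c0(2,2)]
  have l: "local_c11 M c0 c0 (\<lambda>x. x \<otimes> \<one>) \<one> (\<lambda>v. D (v, 0))"
    "local_c11 M c0 c0 (\<lambda>x. \<one> \<otimes> x) \<one> (\<lambda>v. D (0, v))"
    using local_c11_mult[OF c0_chart V id k c0(1,1,1) 11] local_c11_mult[OF c0_chart V k id c0(1,1,1) 11] unfolding D_def by auto
  have "local_c11 M c0 c0 (\<lambda>x. x) \<one> (\<lambda>v. D (v, 0))"
    by (rule local_c11_cong[OF l(1) _ c0_chart V]) (use chart_carrier[OF c0(1)] in auto)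
  from local_c11_coord_deriv[OF c0_chart V this] local_c11_coord_deriv[OF c0_chart V id]
  have 1: "D (v, 0) = v" using v by metis
  have "local_c11 M c0 c0 (\<lambda>x. x) \<one> (\<lambda>v. D (0, v))"
    by (rule local_c11_cong[OF l(2) _ c0_chart V]) (use chart_carrier[OF c0(1)] in auto)
  from local_c11_coord_deriv[OF c0_chart V this] local_c11_coord_deriv[OF c0_chart V id]
  have 2: "D (0, w) = w" using v by metis
  have cc: "is_chart (mtop (prod_manifold M M)) (model (prod_manifold M M)) (chart_prod c0 c0)"
    using is_chart_prod[OF c0_chart c0_chart] by simp
  have VV': "subspace (model (prod_manifold M M))" using VV by simp
  have "local_c11 (prod_manifold M M) (chart_prod c0 c0) c0 (\<lambda>(x, y). x \<otimes> y) (\<one>, \<one>) D"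
    unfolding D_def
    by (rule smooth_map_local_c11[OF cc c0_chart VV' mult_smooth chart_prod_mem[OF c0(1,1)] c0(1)])
      (use c0 in auto)
  then have "bounded_linear D" unfolding local_c11_def c11_def by blast
  then interpret D: bounded_linear D .
  show ?thesis using D.add[of "(v, 0)" "(0, w)"] 1 2 by (simp add: D_def)
qed

lemma local_c11_mult_one:
  assumes c: "is_chart S (model N) c" and W: "subspace (model N)"
    and f: "local_c11 N c c0 f p L" "f p = \<one>" and g: "local_c11 N c c0 g p K" "g p = \<one>"
  shows "local_c11 N c c0 (\<lambda>x. f x \<otimes> g x) p (\<lambda>v. L v + K v)"
proof -
  have "f p \<otimes> g p \<in> fst c0" using f g c0 by simp
  note l = local_c11_mult[OF c W f(1) g(1) c0(1,1,1) this]
  have r: "L v \<in> V" "K v \<in> V" if "v \<in> model N" for v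
    using local_c11_linear_range[OF c c0_chart W V f(1) that] local_c11_linear_range[OF c c0_chart W V g(1) that] by auto
  have bl: "bounded_linear (\<lambda>v. L v + K v)"
    using f g unfolding local_c11_def c11_def by (blast intro: bounded_linear_add)
  show ?thesis
    by (rule local_c11_cong_deriv[OF l W bl]) (use mult_deriv_one r f(2) g(2) in simp)
qed

text \<open>Differentiating \<open>x \<otimes> inv x = \<one>\<close> at the identity leaves
  \<open>v + D v = 0\<close>.\<close>

lemma local_c11_inv_one: "local_c11 M c0 c0 (\<lambda>x. inv x) \<one> uminus"
proof -
  define D where "D = coord_deriv c0 c0 (\<lambda>x. inv x) \<one>"
  have l: "local_c11 M c0 c0 (\<lambda>x. inv x) \<one> D"
    unfolding D_def
    by (rule smooth_map_local_c11[OF c0_chart c0_chart V inv_smooth c0(1,1)]) (use c0 in auto)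
  have "local_c11 M c0 c0 (\<lambda>x. x \<otimes> inv x) \<one> (\<lambda>v. v + D v)"
    by (rule local_c11_mult_one[OF c0_chart V local_c11_ident[OF c0_chart V c0(2)] _ l]) auto
  then have "local_c11 M c0 c0 (\<lambda>x. \<one>) \<one> (\<lambda>v. v + D v)"
    by (rule local_c11_cong[OF _ _ c0_chart V]) (use chart_carrier[OF c0(1)] in auto)
  from local_c11_coord_deriv[OF c0_chart V this]
    local_c11_coord_deriv[OF c0_chart V local_c11_const[OF c0_chart V c0(2,2)]]
  have 0: "v + D v = 0" if "v \<in> V" for v using that by metis
  have "D v = - v" if "v \<in> V" for v using 0[OF that] by (simp add: eq_neg_iff_add_eq_0 add.commute)
  then show ?thesis
    by (rule local_c11_cong_deriv[OF l V bounded_linear_minus[OF bounded_linear_ident]])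
qed

end

section \<open>The exponential map\<close>

context lie_group_on
begin

text \<open>Coordinates are recentred at the identity, so that maps fixing \<open>\<one>\<close>
  become maps fixing \<open>0\<close>, as \<open>c11\<close> requires.\<close>

definition from_coord :: "'e \<Rightarrow> 'a" where
  "from_coord y = inv_into (fst c0) (snd c0) (snd c0 \<one> + y)"

definition coord :: "'a \<Rightarrow> 'e" where
  "coord g = snd c0 g - snd c0 \<one>"

abbreviation tangent_at_one :: "'i filter \<Rightarrow> ('i \<Rightarrow> real) \<Rightarrow> ('i \<Rightarrow> 'a) \<Rightarrow> 'e \<Rightarrow> bool" where
  "tangent_at_one \<equiv> tangent_limit c0 \<one>"

lemma coord_one [simp]: "coord \<one> = 0" by (simp add: coord_def)

lemma coord_in_V: "g \<in> fst c0 \<Longrightarrow> coord g \<in> V"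
  unfolding coord_def using is_chartD(4)[OF c0_chart] c0(2) by (blast intro: subspace_diff[OF V])

lemma from_coord_coord: "g \<in> fst c0 \<Longrightarrow> from_coord (coord g) = g"
  unfolding from_coord_def coord_def using is_chartD(3)[OF c0_chart] by (simp add: inv_into_f_f)

lemma coord_inj: "g \<in> fst c0 \<Longrightarrow> h \<in> fst c0 \<Longrightarrow> coord g = coord h \<Longrightarrow> g = h"
  using from_coord_coord by metis

lemma from_coord_obtain:
  obtains r where "r > 0" "\<And>y. y \<in> V \<Longrightarrow> norm y < r \<Longrightarrow> from_coord y \<in> fst c0 \<and> coord (from_coord y) = y"
proof -
  obtain r where r: "r > 0" "\<And>y. y \<in> V \<Longrightarrow> norm y < r \<Longrightarrow> snd c0 \<one> + y \<in> snd c0 ` fst c0"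
    using openin_subspace_ball[OF is_chartD(2)[OF c0_chart] _ V] c0(2) by (metis imageI)
  have "from_coord y \<in> fst c0 \<and> coord (from_coord y) = y" if y: "y \<in> V" "norm y < r" for y
    using inv_into_into[OF r(2)[OF y]] f_inv_into_f[OF r(2)[OF y]] unfolding from_coord_def coord_def by simp
  with r that show thesis by blast
qed

lemma limitin_iff_coord:
  assumes "g \<in> fst c0"
  shows "limitin T a g F \<longleftrightarrow> (\<forall>\<^sub>F i in F. a i \<in> fst c0) \<and> ((\<lambda>i. coord (a i)) \<longlongrightarrow> coord g) F"
proof -
  have "((\<lambda>i. coord (a i)) \<longlongrightarrow> coord g) F \<longleftrightarrow> ((\<lambda>i. coord (a i) - coord g) \<longlongrightarrow> 0) F"
    by (rule LIM_zero_iff[symmetric])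
  also have "(\<lambda>i. coord (a i) - coord g) = (\<lambda>i. snd c0 (a i) - snd c0 g)" by (simp add: coord_def)
  finally show ?thesis unfolding chart_limitin_iff[OF c0_chart assms] LIM_zero_iff by blast
qed

lemma tangent_at_one_iff:
  "tangent_at_one F s a v \<longleftrightarrow> (\<forall>\<^sub>F i in F. a i \<in> fst c0) \<and> ((\<lambda>i. coord (a i)) \<longlongrightarrow> 0) F \<and>
    ((\<lambda>i. s i *\<^sub>R coord (a i)) \<longlongrightarrow> v) F"
  unfolding tangent_limit_def coord_def LIM_zero_iff ..

lemma tangent_at_one_in_V: "tangent_at_one F s a v \<Longrightarrow> F \<noteq> bot \<Longrightarrow> v \<in> V"
  using tangent_limit_in_model[OF c0_chart V c0(2)] .

lemma tangent_at_one_mult: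
  assumes "tangent_at_one F s a v" "tangent_at_one F s b w" "F \<noteq> bot"
  shows "tangent_at_one F s (\<lambda>i. a i \<otimes> b i) (v + w)"
proof -
  have vw: "v \<in> V" "w \<in> V" using assms tangent_at_one_in_V by blast+
  have cc: "is_chart (mtop (prod_manifold M M)) (model (prod_manifold M M)) (chart_prod c0 c0)"
    using is_chart_prod[OF c0_chart c0_chart] by simp
  have VV': "subspace (model (prod_manifold M M))" using VV by simp
  have "local_c11 (prod_manifold M M) (chart_prod c0 c0) c0 (\<lambda>(x, y). x \<otimes> y) (\<one>, \<one>)
      (coord_deriv (chart_prod c0 c0) c0 (\<lambda>(x, y). x \<otimes> y) (\<one>, \<one>))"
    by (rule smooth_map_local_c11[OF cc c0_chart VV' mult_smooth chart_prod_mem[OF c0(1,1)] c0(1)])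
      (use c0 in auto)
  from tangent_limit_map[OF cc VV' tangent_limit_Pair[OF assms(1,2)] this] mult_deriv_one[OF vw]
  show ?thesis by simp
qed

lemma tangent_at_one_map:
  assumes "tangent_at_one F s a v" "local_c11 M c0 c0 f \<one> L" "f \<one> = \<one>"
  shows "tangent_at_one F s (\<lambda>i. f (a i)) (L v)"
  using tangent_limit_map[OF c0_chart V assms(1,2)] assms(3) by simp

lemma tangent_at_one_inv:
  assumes "tangent_at_one F s a v"
  shows "tangent_at_one F s (\<lambda>i. inv (a i)) (- v)"
  by (rule tangent_at_one_map[OF assms local_c11_inv_one inv_one])

lemma tangent_at_one_const: "tangent_at_one F s (\<lambda>i. \<one>) 0"
  by (simp add: tangent_at_one_iff c0)

lemma tangent_at_one_pow:
  assumes "tangent_at_one F s a v" "F \<noteq> bot"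
  shows "tangent_at_one F s (\<lambda>i. a i [^] (n::nat)) (real n *\<^sub>R v)"
proof (induction n)
  case 0
  show ?case unfolding nat_pow_0 of_nat_0 scaleR_zero_left by (rule tangent_at_one_const)
next
  case (Suc n)
  from tangent_at_one_mult[OF Suc assms] show ?case
    by (simp only: nat_pow_Suc of_nat_Suc scaleR_add_left scaleR_one add.commute)
qed

lemma two_pow_tendsto_zero: "(\<lambda>n. (1/2::real)^n *\<^sub>R (v::'e)) \<longlonglongrightarrow> 0"
proof -
  have "(\<lambda>n. (1/2::real)^n) \<longlonglongrightarrow> 0" by (rule LIMSEQ_realpow_zero) auto
  from tendsto_scaleR[OF this tendsto_const[of v]] show ?thesis by simp
qed

lemma tangent_at_one_from_coord:
  assumes v: "v \<in> V"
  shows "tangent_at_one sequentially (\<lambda>n. 2^n) (\<lambda>n. from_coord ((1/2)^n *\<^sub>R v)) v"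
proof -
  obtain r where r: "r > 0" "\<And>y. y \<in> V \<Longrightarrow> norm y < r \<Longrightarrow> from_coord y \<in> fst c0 \<and> coord (from_coord y) = y"
    by (rule from_coord_obtain) blast
  have l: "(\<lambda>n. (1/2::real)^n *\<^sub>R v) \<longlonglongrightarrow> 0" by (rule two_pow_tendsto_zero)
  have "\<forall>\<^sub>F n in sequentially. norm ((1/2::real)^n *\<^sub>R v) < r"
    using order_tendstoD(2)[OF tendsto_norm[OF l], of r] r(1) by simp
  then have ev: "\<forall>\<^sub>F n in sequentially. from_coord ((1/2)^n *\<^sub>R v) \<in> fst c0 \<and>
      (1/2)^n *\<^sub>R v = coord (from_coord ((1/2)^n *\<^sub>R v))"
    by (rule eventually_mono) (use r(2) subspace_scale[OF V v] in metis)
  show ?thesis unfolding tangent_at_one_iff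
  proof (intro conjI)
    show "\<forall>\<^sub>F n in sequentially. from_coord ((1/2)^n *\<^sub>R v) \<in> fst c0"
      using ev by (rule eventually_mono) simp
    show "(\<lambda>n. coord (from_coord ((1/2)^n *\<^sub>R v))) \<longlonglongrightarrow> 0"
      by (rule Lim_transform_eventually[OF l]) (use ev in \<open>auto elim: eventually_mono\<close>)
    have "\<forall>\<^sub>F n in sequentially. v = 2^n *\<^sub>R coord (from_coord ((1/2)^n *\<^sub>R v))"
      using ev
    proof (rule eventually_mono)
      fix n assume *: "from_coord ((1/2)^n *\<^sub>R v) \<in> fst c0 \<and> (1/2)^n *\<^sub>R v = coord (from_coord ((1/2)^n *\<^sub>R v))"
      have "(2::real)^n * (1/2)^n = 1" by (simp add: power_mult_distrib[symmetric])
      then have "2^n *\<^sub>R ((1/2)^n *\<^sub>R v) = v" by simp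
      with * show "v = 2^n *\<^sub>R coord (from_coord ((1/2)^n *\<^sub>R v))" by simp
    qed
    then show "(\<lambda>n. 2^n *\<^sub>R coord (from_coord ((1/2)^n *\<^sub>R v))) \<longlonglongrightarrow> v"
      by (rule Lim_transform_eventually[OF tendsto_const])
  qed
qed

lemma pow_two_pow_Suc: "a \<in> carrier G \<Longrightarrow> a [^] (2^Suc n :: nat) = a [^] (2^n :: nat) \<otimes> a [^] (2^n :: nat)"
  by (simp add: nat_pow_mult mult_2)

lemma squaring_obtain:
  obtains r where "r > 0" "c11 V (\<lambda>y. coord (from_coord y \<otimes> from_coord y)) (\<lambda>v. v + v)"
    "\<And>y. y \<in> V \<Longrightarrow> norm y < r \<Longrightarrow> from_coord y \<in> fst c0 \<and> coord (from_coord y) = y \<and>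
       from_coord y \<otimes> from_coord y \<in> fst c0"
proof -
  note id = local_c11_ident[OF c0_chart V c0(2)]
  have l: "local_c11 M c0 c0 (\<lambda>x. x \<otimes> x) \<one> (\<lambda>v. v + v)"
    by (rule local_c11_mult_one[OF c0_chart V id _ id]) auto
  have eq: "(\<lambda>y. coord (from_coord y \<otimes> from_coord y)) =
    (\<lambda>y. coord_rep c0 c0 (\<lambda>x. x \<otimes> x) (snd c0 \<one> + y) - snd c0 (\<one> \<otimes> \<one>))"
    by (simp add: coord_rep_def coord_def from_coord_def)
  then have c: "c11 V (\<lambda>y. coord (from_coord y \<otimes> from_coord y)) (\<lambda>v. v + v)"
    using l unfolding local_c11_def by simp
  obtain r where r: "r > 0" "\<And>y. y \<in> V \<Longrightarrow> norm y < r \<Longrightarrow> from_coord y \<in> fst c0 \<and> coord (from_coord y) = y"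
    by (rule from_coord_obtain) blast
  obtain s where s: "s > 0" "\<And>y. y \<in> V \<Longrightarrow> norm y < s \<Longrightarrow> snd c0 \<one> + y \<in> coord_dom c0 c0 (\<lambda>x. x \<otimes> x)"
    using l unfolding local_c11_def by blast
  have "from_coord y \<otimes> from_coord y \<in> fst c0" if y: "y \<in> V" "norm y < min r s" for y
  proof -
    obtain x where x: "snd c0 \<one> + y = snd c0 x" "x \<in> fst c0" "x \<otimes> x \<in> fst c0"
      using s(2)[of y] y unfolding coord_dom_def by auto
    have "coord x = y" unfolding coord_def x(1)[symmetric] by simp
    then have "from_coord y = x" using from_coord_coord[OF x(2)] by simp
    then show ?thesis using x by simp
  qed
  with c r s show thesis by (intro that[of "min r s"]) auto
qed

text \<open>If \<open>f\<close> is squaring in coordinates, then \<open>a n [^] 2^n\<close> has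
  coordinates \<open>f^n (coord (a n))\<close>, that is \<open>rescaled_iterate f n\<close> at
  \<open>2^n *\<^sub>R coord (a n)\<close>, and these arguments tend to \<open>v\<close>. So the
  limit exists and depends on the sequence only through \<open>v\<close>.\<close>

lemma dyadic_limit_local:
  obtains E r where "r > 0" "c11 V E (\<lambda>v. v)" "\<And>v. v \<in> V \<Longrightarrow> norm v < r \<Longrightarrow> E v \<in> V \<and>
      from_coord (E v) \<in> fst c0 \<and> coord (from_coord (E v)) = E v"
    "\<And>a v. v \<in> V \<Longrightarrow> norm v < r \<Longrightarrow> tangent_at_one sequentially (\<lambda>n. 2^n) a v \<Longrightarrow>
      limitin T (\<lambda>n. a n [^] (2^n::nat)) (from_coord (E v)) sequentially"
proof -
  define f where "f y = coord (from_coord y \<otimes> from_coord y)" for y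
  obtain r0 where r0: "r0 > 0" "c11 V f (\<lambda>v. v + v)"
    "\<And>y. y \<in> V \<Longrightarrow> norm y < r0 \<Longrightarrow> from_coord y \<in> fst c0 \<and> coord (from_coord y) = y \<and>
       from_coord y \<otimes> from_coord y \<in> fst c0"
    unfolding f_def[abs_def] by (rule squaring_obtain) blast
  have fV: "\<exists>r>0. \<forall>x\<in>V. norm x < r \<longrightarrow> f x \<in> V"
    using r0(1,3) coord_in_V unfolding f_def by blast
  obtain E r1 where E: "r1 > 0" "c11 V E (\<lambda>x. x)" "\<And>x. x \<in> V \<Longrightarrow> norm x < r1 \<Longrightarrow> E x \<in> V"
    "\<And>x n. x \<in> V \<Longrightarrow> norm x < r1 \<Longrightarrow>
       rescaled_iterate f n x \<in> V \<and> norm (rescaled_iterate f n x) \<le> 2 * norm x"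
    "\<And>x y. x \<in> V \<Longrightarrow> y \<in> V \<Longrightarrow> norm x < r1 \<Longrightarrow> norm y < r1 \<Longrightarrow> norm (E x - E y) \<le> 2 * norm (x - y)"
    "\<And>x u. x \<in> V \<Longrightarrow> norm x < r1 \<Longrightarrow> (\<And>n. u n \<in> V) \<Longrightarrow> u \<longlonglongrightarrow> x \<Longrightarrow>
       (\<lambda>n. rescaled_iterate f n (u n)) \<longlonglongrightarrow> E x"
    by (rule koenigs_linearization[OF r0(2) V _ fV]) (auto simp: scaleR_2)
  define r where "r = min (r0 / 2) r1"
  have r: "r > 0" "2 * r \<le> r0" "r \<le> r1" using r0 E by (auto simp: r_def)
  have E0: "E 0 = 0" using E(2) by (simp add: c11_def)
  have Er: "norm (E v) < r0" if "v \<in> V" "norm v < r" for v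
    using E(5)[OF that(1) subspace_0[OF V]] that r E0 by fastforce
  \<comment> \<open>All intermediate powers have to stay in the chart. They do because the iterates
    are bounded by \<open>2 |x|\<close> and \<open>r <= r0 / 2\<close>.\<close>
  have it: "from_coord (rescaled_iterate f n x) = from_coord ((1/2)^n *\<^sub>R x) [^] (2^n::nat) \<and>
      from_coord (rescaled_iterate f n x) \<in> fst c0 \<and>
      coord (from_coord (rescaled_iterate f n x)) = rescaled_iterate f n x"
    if "x \<in> V" "norm x < r" for n x
    using that
  proof (induction n arbitrary: x)
    case 0
    have "norm x < r0" using 0 r norm_ge_zero[of x] by linarith
    with r0(3)[OF 0(1)] chart_carrier[OF c0(1)] show ?case by auto
  next
    case (Suc n)
    define y where "y = (1/2) *\<^sub>R x"
    have y: "y \<in> V" "norm y < r" "norm y = norm x / 2"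
      using Suc.prems subspace_scale[OF V] norm_ge_zero[of x] r(1) unfolding y_def by (auto simp del: norm_ge_zero)
    define z where "z = rescaled_iterate f n y"
    have z: "z \<in> V" "norm z < r0"
      using E(4)[OF y(1), of n] y Suc.prems r unfolding z_def by auto
    have IH: "from_coord z = from_coord ((1/2)^n *\<^sub>R y) [^] (2^n::nat)" using Suc.IH[OF y(1,2)] by (simp add: z_def)
    have sm: "norm ((1/2)^n *\<^sub>R y) < r0"
    proof -
      have "(1/2)^n * norm y \<le> 1 * norm y" by (intro mult_right_mono power_le_one) auto
      also have "1 * norm y < r0" using y(2) r(1,2) by linarith
      finally show ?thesis by simp
    qed
    have cy: "from_coord ((1/2)^n *\<^sub>R y) \<in> carrier G"
      using r0(3)[OF subspace_scale[OF V y(1)] sm] chart_carrier[OF c0(1)] by blast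
    have rs: "rescaled_iterate f (Suc n) x = coord (from_coord z \<otimes> from_coord z)"
      by (simp add: z_def y_def f_def)
    have zz: "from_coord z \<otimes> from_coord z \<in> fst c0" using r0(3)[OF z] by blast
    have "from_coord (rescaled_iterate f (Suc n) x) = from_coord z \<otimes> from_coord z"
      unfolding rs using from_coord_coord[OF zz] .
    moreover have "from_coord z \<otimes> from_coord z = from_coord ((1/2)^Suc n *\<^sub>R x) [^] (2^Suc n::nat)"
      unfolding IH pow_two_pow_Suc[OF cy, symmetric] by (simp add: y_def mult.commute)
    ultimately show ?case using zz rs by simp
  qed
  show thesis
  proof (rule that[of r E])
    show "r > 0" "c11 V E (\<lambda>v. v)" using r E by auto
    show "E v \<in> V \<and> from_coord (E v) \<in> fst c0 \<and> coord (from_coord (E v)) = E v" if "v \<in> V" "norm v < r" for v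
      using E(3)[OF that(1)] r0(3)[OF _ Er[OF that]] that r by simp
    fix a v assume v: "v \<in> V" "norm v < r" and a: "tangent_at_one sequentially (\<lambda>n. 2^n) a v"
    have aev: "\<forall>\<^sub>F n in sequentially. a n \<in> fst c0" and al: "(\<lambda>n. 2^n *\<^sub>R coord (a n)) \<longlonglongrightarrow> v"
      using a unfolding tangent_at_one_iff by auto
    \<comment> \<open>The default \<open>0\<close> for \<open>a n\<close> outside the chart, which
      happens for finitely many \<open>n\<close> only, keeps \<open>u\<close> in \<open>V\<close>,
      as the linearization demands.\<close>
    define u where "u n = (if a n \<in> fst c0 then 2^n *\<^sub>R coord (a n) else 0)" for n
    have uV: "u n \<in> V" for n
      unfolding u_def using coord_in_V subspace_scale[OF V] subspace_0[OF V] by auto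
    have "u \<longlonglongrightarrow> v"
      by (rule Lim_transform_eventually[OF al]) (use aev in \<open>auto simp: u_def elim: eventually_mono\<close>)
    then have lim: "(\<lambda>n. rescaled_iterate f n (u n)) \<longlonglongrightarrow> E v"
      using E(6)[OF v(1) _ uV] v r by simp
    have "\<forall>\<^sub>F n in sequentially. norm (u n) < r"
      using order_tendstoD(2)[OF tendsto_norm[OF \<open>u \<longlonglongrightarrow> v\<close>] v(2)] .
    with aev have ev: "\<forall>\<^sub>F n in sequentially. a n [^] (2^n::nat) \<in> fst c0 \<and>
        rescaled_iterate f n (u n) = coord (a n [^] (2^n::nat))"
    proof eventually_elim
      case (elim n)
      have "(1/2::real)^n * 2^n = 1" by (simp add: power_mult_distrib[symmetric])
      then have "(1/2)^n *\<^sub>R u n = coord (a n)" using elim by (simp add: u_def)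
      then have "from_coord ((1/2)^n *\<^sub>R u n) = a n" using from_coord_coord elim by simp
      then show ?case using it[OF uV elim(2), of n] by metis
    qed
    have Ev: "from_coord (E v) \<in> fst c0" "coord (from_coord (E v)) = E v"
      using E(3)[OF v(1)] r0(3)[OF _ Er[OF v]] v r by auto
    show "limitin T (\<lambda>n. a n [^] (2^n::nat)) (from_coord (E v)) sequentially"
      unfolding limitin_iff_coord[OF Ev(1)] Ev(2)
    proof
      show "\<forall>\<^sub>F n in sequentially. a n [^] (2^n::nat) \<in> fst c0" using ev by (rule eventually_mono) simp
      show "(\<lambda>n. coord (a n [^] (2^n::nat))) \<longlonglongrightarrow> E v"
        by (rule Lim_transform_eventually[OF lim]) (use ev in \<open>auto elim: eventually_mono\<close>)
    qed
  qed
qed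

text \<open>The analogue of \<open>(1 + v / 2^n)^(2^n)\<close> for matrices. The argument is a
  coordinate vector in \<open>c0\<close>, whereas \<open>lie_exp\<close> takes tangent vectors. The
  limit is unique because \<open>T\<close> is Hausdorff.\<close>

definition expo :: "'e \<Rightarrow> 'a" where
  "expo v = (THE g. limitin T (\<lambda>n. from_coord ((1/2)^n *\<^sub>R v) [^] (2^n::nat)) g sequentially)"

lemma limitin_unique: "limitin T a g F \<Longrightarrow> limitin T a h F \<Longrightarrow> F \<noteq> bot \<Longrightarrow> g = h"
  using limitin_Hausdorff_unique[OF _ _ _ Hausdorff] by blast

text \<open>The shifted sequence \<open>a (n + N)\<close> belongs to the vector
  \<open>v / 2^N\<close>, which is small enough for the local result; the limit found there is
  raised to the power \<open>2^N\<close>.\<close>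

lemma dyadic_limit_global:
  assumes v: "v \<in> V"
  obtains g where "\<And>a. (\<And>n. a n \<in> carrier G) \<Longrightarrow> tangent_at_one sequentially (\<lambda>n. 2^n) a v \<Longrightarrow>
      limitin T (\<lambda>n. a n [^] (2^n::nat)) g sequentially"
proof -
  obtain E r where E: "r > 0"
    "\<And>a v. v \<in> V \<Longrightarrow> norm v < r \<Longrightarrow> tangent_at_one sequentially (\<lambda>n. 2^n) a v \<Longrightarrow>
      limitin T (\<lambda>n. a n [^] (2^n::nat)) (from_coord (E v)) sequentially"
    by (rule dyadic_limit_local) blast
  have "\<forall>\<^sub>F n in sequentially. norm ((1/2::real)^n *\<^sub>R v) < r"
    using order_tendstoD(2)[OF tendsto_norm[OF two_pow_tendsto_zero], of r v] E(1) by simp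
  then obtain N where N: "norm ((1/2::real)^N *\<^sub>R v) < r" by (auto simp: eventually_sequentially)
  show thesis
  proof (rule that[of "from_coord (E ((1/2)^N *\<^sub>R v)) [^] (2^N::nat)"])
    fix a assume a: "\<And>n. a n \<in> carrier G" "tangent_at_one sequentially (\<lambda>n. 2^n) a v"
    have "tangent_at_one sequentially (\<lambda>n. 2^n) (\<lambda>n. a (n + N)) ((1/2)^N *\<^sub>R v)"
      unfolding tangent_at_one_iff
    proof (intro conjI)
      show "\<forall>\<^sub>F n in sequentially. a (n + N) \<in> fst c0"
        using sequentially_offset[OF conjunct1[OF a(2)[unfolded tangent_at_one_iff]]] .
      show "(\<lambda>n. coord (a (n + N))) \<longlonglongrightarrow> 0"
        by (rule LIMSEQ_ignore_initial_segment) (use a(2) in \<open>unfold tangent_at_one_iff, blast\<close>)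
      have "(\<lambda>n. 2^(n + N) *\<^sub>R coord (a (n + N))) \<longlonglongrightarrow> v"
        by (rule LIMSEQ_ignore_initial_segment[of "\<lambda>n. 2^n *\<^sub>R coord (a n)"])
          (use a(2) in \<open>unfold tangent_at_one_iff, blast\<close>)
      then have "(\<lambda>n. (1/2)^N *\<^sub>R (2^(n + N) *\<^sub>R coord (a (n + N)))) \<longlonglongrightarrow> (1/2)^N *\<^sub>R v"
        by (intro tendsto_intros)
      moreover have "(1/2::real)^N * 2^(n + N) = 2^n" for n
        by (simp add: power_add power_divide)
      ultimately show "(\<lambda>n. 2^n *\<^sub>R coord (a (n + N))) \<longlonglongrightarrow> (1/2)^N *\<^sub>R v" by simp
    qed
    from limitin_pow[OF E(2)[OF subspace_scale[OF V v] N this], of "2^N"]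
    have "limitin T (\<lambda>n. a (n + N) [^] (2^(n + N)::nat)) (from_coord (E ((1/2)^N *\<^sub>R v)) [^] (2^N::nat)) sequentially"
      by (simp add: nat_pow_pow a(1) power_add)
    then show "limitin T (\<lambda>n. a n [^] (2^n::nat)) (from_coord (E ((1/2)^N *\<^sub>R v)) [^] (2^N::nat)) sequentially"
      by (rule limitin_sequentially_offset_rev)
  qed
qed

text \<open>Initial terms outside the chart are replaced by \<open>\<one>\<close>, because the laws
  of powers need every term in the carrier.\<close>

lemma tangent_sequence_obtain:
  assumes v: "v \<in> V"
  obtains a where "\<And>n. a n \<in> carrier G" "tangent_at_one sequentially (\<lambda>n. 2^n) a v"
    "\<forall>\<^sub>F n in sequentially. from_coord ((1/2)^n *\<^sub>R v) = a n"
proof -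
  define b where "b n = (if from_coord ((1/2)^n *\<^sub>R v) \<in> fst c0 then from_coord ((1/2)^n *\<^sub>R v) else \<one>)" for n
  have bc: "b n \<in> carrier G" for n unfolding b_def using chart_carrier[OF c0(1)] by auto
  have ev: "\<forall>\<^sub>F n in sequentially. from_coord ((1/2)^n *\<^sub>R v) = b n"
    using tangent_at_one_from_coord[OF v] unfolding tangent_at_one_iff
    by (auto simp: b_def elim: eventually_mono)
  have "tangent_at_one sequentially (\<lambda>n. 2^n) b v"
    unfolding tangent_at_one_iff
  proof (intro conjI)
    note * = tangent_at_one_from_coord[OF v, unfolded tangent_at_one_iff]
    show "\<forall>\<^sub>F n in sequentially. b n \<in> fst c0" by (simp add: b_def c0(2))
    show "(\<lambda>n. coord (b n)) \<longlonglongrightarrow> 0"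
      by (rule Lim_transform_eventually[OF conjunct1[OF conjunct2[OF *]]]) (use ev in \<open>auto elim: eventually_mono\<close>)
    show "(\<lambda>n. 2^n *\<^sub>R coord (b n)) \<longlonglongrightarrow> v"
      by (rule Lim_transform_eventually[OF conjunct2[OF conjunct2[OF *]]]) (use ev in \<open>auto elim: eventually_mono\<close>)
  qed
  with bc ev that show thesis by blast
qed

text \<open>Any sequence with the right direction computes \<open>expo v\<close>. Laws of the
  exponential map follow by choosing a suitable one, such as \<open>a n [^] k\<close> for the
  multiple by \<open>k\<close>, or \<open>f (a n)\<close> for a homomorphism
  \<open>f\<close>.\<close>

lemma expo_limit:
  assumes a: "\<And>n. a n \<in> carrier G" "tangent_at_one sequentially (\<lambda>n. 2^n) a v"
  shows "limitin T (\<lambda>n. a n [^] (2^n::nat)) (expo v) sequentially"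
proof -
  have v: "v \<in> V" using tangent_at_one_in_V[OF a(2)] by simp
  obtain g where g: "\<And>a. (\<And>n. a n \<in> carrier G) \<Longrightarrow> tangent_at_one sequentially (\<lambda>n. 2^n) a v \<Longrightarrow>
      limitin T (\<lambda>n. a n [^] (2^n::nat)) g sequentially"
    using dyadic_limit_global[OF v] by metis
  obtain b where b: "\<And>n. b n \<in> carrier G" "tangent_at_one sequentially (\<lambda>n. 2^n) b v"
    "\<forall>\<^sub>F n in sequentially. from_coord ((1/2)^n *\<^sub>R v) = b n"
    by (rule tangent_sequence_obtain[OF v]) blast
  from g[OF b(1,2)] have "limitin T (\<lambda>n. b n [^] (2^n::nat)) g sequentially" .
  then have "limitin T (\<lambda>n. from_coord ((1/2)^n *\<^sub>R v) [^] (2^n::nat)) g sequentially"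
    by (rule limitin_transform_eventually[rotated]) (use b(3) in \<open>auto elim: eventually_mono\<close>)
  then have "expo v = g"
    unfolding expo_def by (intro the_equality) (auto intro: limitin_unique)
  with g[OF a] show ?thesis by simp
qed

lemma expo_eqI:
  assumes "\<And>n. a n \<in> carrier G" "tangent_at_one sequentially (\<lambda>n. 2^n) a v" "\<And>n. a n [^] (2^n::nat) = g" "g \<in> carrier G"
  shows "expo v = g"
proof -
  have "limitin T (\<lambda>n. a n [^] (2^n::nat)) g sequentially" using assms(3,4) by (simp add: carrier)
  with expo_limit[OF assms(1,2)] show ?thesis by (rule limitin_unique) simp
qed

end

section \<open>Laws, local inverse and continuity of the exponential map\<close>

context lie_group_on
begin

lemma expo_closed: "v \<in> V \<Longrightarrow> expo v \<in> carrier G"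
proof -
  assume "v \<in> V"
  then obtain a where a: "\<And>n. a n \<in> carrier G" "tangent_at_one sequentially (\<lambda>n. 2^n) a v"
    by (rule tangent_sequence_obtain) blast
  from limitin_topspace[OF expo_limit[OF a]] show ?thesis by (simp add: carrier)
qed

lemma tangent_at_one_int_pow:
  assumes a: "\<And>i. a i \<in> carrier G" "tangent_at_one F s a v" "F \<noteq> bot"
  shows "tangent_at_one F s (\<lambda>i. a i [^] (k::int)) (real_of_int k *\<^sub>R v)"
proof (cases k rule: int_cases2)
  case (nonneg n)
  then show ?thesis using tangent_at_one_pow[OF a(2,3), of n] by (simp add: int_pow_int)
next
  case (nonpos n)
  have "(\<lambda>i. a i [^] k) = (\<lambda>i. inv (a i [^] n))" by (simp add: nonpos int_pow_neg_int a(1))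
  moreover have "real_of_int k *\<^sub>R v = - (real n *\<^sub>R v)" by (simp add: nonpos)
  ultimately show ?thesis using tangent_at_one_inv[OF tangent_at_one_pow[OF a(2,3), of n]] by simp
qed

lemma expo_int_scale:
  assumes v: "v \<in> V"
  shows "expo (real_of_int k *\<^sub>R v) = expo v [^] k"
proof -
  obtain a where a: "\<And>n. a n \<in> carrier G" "tangent_at_one sequentially (\<lambda>n. 2^n) a v"
    by (rule tangent_sequence_obtain[OF v]) blast
  have "limitin T (\<lambda>n. (a n [^] k) [^] (2^n::nat)) (expo (real_of_int k *\<^sub>R v)) sequentially"
    using a by (intro expo_limit tangent_at_one_int_pow) auto
  moreover have "(a n [^] k) [^] (2^n::nat) = (a n [^] (2^n::nat)) [^] k" for n
    using int_pow_pow[OF a(1), of n k "int (2^n)"] int_pow_pow[OF a(1), of n "int (2^n)" k]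
    by (simp add: int_pow_int mult.commute flip: int_pow_int)
  moreover have "limitin T (\<lambda>n. (a n [^] (2^n::nat)) [^] k) (expo v [^] k) sequentially"
  proof (cases k rule: int_cases2)
    case (nonneg n)
    show ?thesis unfolding nonneg int_pow_int by (rule limitin_pow[OF expo_limit[OF a]])
  next
    case (nonpos n)
    show ?thesis using limitin_inv[OF limitin_pow[OF expo_limit[OF a], of n]]
      unfolding nonpos by (simp add: int_pow_neg_int a(1) expo_closed[OF v])
  qed
  ultimately show ?thesis using limitin_unique by fastforce
qed

lemma expo_zero [simp]: "expo 0 = \<one>"
  using expo_int_scale[OF subspace_0[OF V], of 0] by simp

lemma expo_nat_scale: "v \<in> V \<Longrightarrow> expo (real n *\<^sub>R v) = expo v [^] n"
  using expo_int_scale[of v "int n"] by (simp add: int_pow_int)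

lemma expo_minus: "v \<in> V \<Longrightarrow> expo (- v) = inv (expo v)"
  using expo_int_scale[of v "-1"] expo_closed[of v] int_pow_neg[of "expo v" 1] by simp

lemma expo_hom:
  assumes f: "f \<in> hom G G" "continuous_map T T f" "local_c11 M c0 c0 f \<one> L" and v: "v \<in> V"
  shows "f (expo v) = expo (L v)"
proof -
  have f1: "f \<one> = \<one>" using hom_one[OF f(1)] is_group by simp
  have fc: "f x \<in> carrier G" if "x \<in> carrier G" for x using hom_in_carrier[OF f(1) that] .
  obtain a where a: "\<And>n. a n \<in> carrier G" "tangent_at_one sequentially (\<lambda>n. 2^n) a v"
    by (rule tangent_sequence_obtain[OF v]) blast
  have "limitin T (\<lambda>n. f (a n) [^] (2^n::nat)) (expo (L v)) sequentially"
    by (rule expo_limit[OF fc[OF a(1)] tangent_at_one_map[OF a(2) f(3) f1]])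
  moreover have "f (a n) [^] (2^n::nat) = f (a n [^] (2^n::nat))" for n
    using hom_nat_pow[OF f(1) a(1) is_group is_group] by simp
  moreover have "limitin T (\<lambda>n. f (a n [^] (2^n::nat))) (f (expo v)) sequentially"
    using continuous_map_limit[OF f(2) expo_limit[OF a]] by (simp add: o_def)
  ultimately show ?thesis using limitin_unique by fastforce
qed

lemma expo_coord_obtain:
  obtains r where "r > 0" "c11 V (\<lambda>v. coord (expo v)) (\<lambda>v. v)"
    "\<And>v. v \<in> V \<Longrightarrow> norm v < r \<Longrightarrow> expo v \<in> fst c0"
proof -
  obtain E r where E: "r > 0" "c11 V E (\<lambda>v. v)" "\<And>v. v \<in> V \<Longrightarrow> norm v < r \<Longrightarrow> E v \<in> V \<and>
      from_coord (E v) \<in> fst c0 \<and> coord (from_coord (E v)) = E v"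
    "\<And>a v. v \<in> V \<Longrightarrow> norm v < r \<Longrightarrow> tangent_at_one sequentially (\<lambda>n. 2^n) a v \<Longrightarrow>
      limitin T (\<lambda>n. a n [^] (2^n::nat)) (from_coord (E v)) sequentially"
    by (rule dyadic_limit_local) blast
  have eq: "expo v = from_coord (E v)" if v: "v \<in> V" "norm v < r" for v
  proof -
    obtain a where a: "\<And>n. a n \<in> carrier G" "tangent_at_one sequentially (\<lambda>n. 2^n) a v"
      by (rule tangent_sequence_obtain[OF v(1)]) blast
    show ?thesis using limitin_unique[OF expo_limit[OF a] E(4)[OF v a(2)]] by simp
  qed
  show thesis
  proof (rule that[OF E(1)])
    show "c11 V (\<lambda>v. coord (expo v)) (\<lambda>v. v)"
      by (rule c11_cong[OF E(2) V E(1)]) (use eq E(3) in \<open>auto simp: bounded_linear_ident\<close>)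
    show "expo v \<in> fst c0" if "v \<in> V" "norm v < r" for v using eq[OF that] E(3)[OF that] by simp
  qed
qed

lemma log_obtain:
  obtains lg r where "r > 0" "c11 V lg (\<lambda>v. v)" "c11 V (\<lambda>v. coord (expo v)) (\<lambda>v. v)"
    "\<And>v. v \<in> V \<Longrightarrow> norm v < r \<Longrightarrow> expo v \<in> fst c0 \<and> lg (coord (expo v)) = v"
    "\<And>g. g \<in> fst c0 \<Longrightarrow> norm (coord g) < r \<Longrightarrow> lg (coord g) \<in> V \<and> expo (lg (coord g)) = g"
proof -
  obtain r where r: "r > 0" "c11 V (\<lambda>v. coord (expo v)) (\<lambda>v. v)"
    "\<And>v. v \<in> V \<Longrightarrow> norm v < r \<Longrightarrow> expo v \<in> fst c0"
    by (rule expo_coord_obtain) blast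
  have "\<exists>r>0. \<forall>x\<in>V. norm x < r \<longrightarrow> coord (expo x) \<in> V" using r coord_in_V by blast
  then obtain lg s where s: "c11 V lg (\<lambda>x. x)" "s > 0"
    "\<And>y. y \<in> V \<Longrightarrow> norm y < s \<Longrightarrow> lg y \<in> V \<and> coord (expo (lg y)) = y"
    "\<And>x. x \<in> V \<Longrightarrow> norm x < s \<Longrightarrow> coord (expo x) \<in> V \<and> lg (coord (expo x)) = x"
    using c11_inverse[OF r(2) V] by metis
  \<comment> \<open>\<open>coord_inj\<close> needs \<open>expo (lg (coord g))\<close> in the chart,
    so \<open>lg\<close> must take values below the radius \<open>r\<close>.\<close>
  obtain t where t: "0 < t" "\<And>x. x \<in> V \<Longrightarrow> norm x < t \<Longrightarrow> norm (lg x) < r"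
    using c11_small[OF s(1) V r(1)] by metis
  show thesis
  proof (rule that[of "min t (min r s)" lg])
    show "0 < min t (min r s)" "c11 V lg (\<lambda>v. v)" "c11 V (\<lambda>v. coord (expo v)) (\<lambda>v. v)" using r s t by auto
    show "expo v \<in> fst c0 \<and> lg (coord (expo v)) = v" if "v \<in> V" "norm v < min t (min r s)" for v
      using r s that by simp
    fix g assume g: "g \<in> fst c0" "norm (coord g) < min t (min r s)"
    note gV = coord_in_V[OF g(1)]
    have lgg: "lg (coord g) \<in> V" "coord (expo (lg (coord g))) = coord g" using s(3)[OF gV] g(2) by auto
    have "expo (lg (coord g)) \<in> fst c0" using r(3)[OF lgg(1) t(2)[OF gV]] g(2) by simp
    from coord_inj[OF this g(1) lgg(2)] lgg show "lg (coord g) \<in> V \<and> expo (lg (coord g)) = g" by simp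
  qed
qed

lemma expo_inj_obtain:
  obtains r where "r > 0" "\<And>v w. v \<in> V \<Longrightarrow> w \<in> V \<Longrightarrow> norm v < r \<Longrightarrow> norm w < r \<Longrightarrow> expo v = expo w \<Longrightarrow> v = w"
proof -
  obtain lg r where "r > 0" "\<And>v. v \<in> V \<Longrightarrow> norm v < r \<Longrightarrow> expo v \<in> fst c0 \<and> lg (coord (expo v)) = v"
    by (rule log_obtain) blast
  with that show thesis by metis
qed

lemma expo_nhd_obtain:
  assumes "e > 0"
  obtains N where "openin T N" "\<one> \<in> N" "\<And>g. g \<in> N \<Longrightarrow> \<exists>v\<in>V. norm v < e \<and> g = expo v"
proof -
  obtain lg r where r: "r > 0" "c11 V lg (\<lambda>v. v)"
    "\<And>g. g \<in> fst c0 \<Longrightarrow> norm (coord g) < r \<Longrightarrow> lg (coord g) \<in> V \<and> expo (lg (coord g)) = g"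
    by (rule log_obtain) blast
  obtain t where t: "0 < t" "\<And>x. x \<in> V \<Longrightarrow> norm x < t \<Longrightarrow> norm (lg x) < e"
    using c11_small[OF r(2) V assms] by metis
  define W where "W = {y. norm (y - snd c0 \<one>) < min r t}"
  have W: "open W"
  proof -
    have "W = ball (snd c0 \<one>) (min r t)" by (auto simp: W_def dist_norm norm_minus_commute)
    then show ?thesis by simp
  qed
  have "openin (subtopology T (fst c0)) {x \<in> topspace (subtopology T (fst c0)). snd c0 x \<in> W}"
    using openin_continuous_map_preimage[OF is_chartD(5)[OF c0_chart]] W by simp
  moreover have "topspace (subtopology T (fst c0)) = fst c0"
    using openin_subset[OF is_chartD(1)[OF c0_chart]] by auto
  ultimately have "openin (subtopology T (fst c0)) {x \<in> fst c0. snd c0 x \<in> W}" by (simp only:)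
  from openin_trans_full[OF this is_chartD(1)[OF c0_chart]]
  have op: "openin T {x \<in> fst c0. snd c0 x \<in> W}" .
  show thesis
  proof (rule that[OF op])
    show "\<one> \<in> {x \<in> fst c0. snd c0 x \<in> W}" using c0 r t by (simp add: W_def)
    fix g assume "g \<in> {x \<in> fst c0. snd c0 x \<in> W}"
    then have g: "g \<in> fst c0" "norm (coord g) < r" "norm (coord g) < t" by (auto simp: W_def coord_def)
    show "\<exists>v\<in>V. norm v < e \<and> g = expo v"
      using r(3)[OF g(1,2)] t(2)[OF coord_in_V[OF g(1)] g(3)] by metis
  qed
qed

text \<open>Near \<open>0\<close> continuity is a Lipschitz bound in the chart. In general
  \<open>v\<close> and \<open>x i\<close> are divided by \<open>2^N\<close>, and the power
  \<open>2^N\<close>, a continuous map, restores them.\<close>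

lemma expo_tendsto:
  assumes v: "v \<in> V" and x: "\<forall>\<^sub>F i in F. x i \<in> V" "(x \<longlongrightarrow> v) F"
  shows "limitin T (\<lambda>i. expo (x i)) (expo v) F"
proof -
  obtain r where r: "r > 0" "c11 V (\<lambda>v. coord (expo v)) (\<lambda>v. v)"
    "\<And>v. v \<in> V \<Longrightarrow> norm v < r \<Longrightarrow> expo v \<in> fst c0"
    by (rule expo_coord_obtain) blast
  obtain s C where C: "s > 0" "C \<ge> 0" "c11_on V s C (\<lambda>v. coord (expo v)) (\<lambda>v. v)" "bounded_linear (\<lambda>v::'e. v)"
    using r(2) unfolding c11_def by blast
  define K where "K = onorm (\<lambda>v::'e. v) + 2 * C * s"
  define t where "t = min r s"
  have "\<forall>\<^sub>F n in sequentially. norm ((1/2::real)^n *\<^sub>R v) < t"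
    using order_tendstoD(2)[OF tendsto_norm[OF two_pow_tendsto_zero], of t v] r C by (simp add: t_def)
  then obtain N where N: "norm ((1/2::real)^N *\<^sub>R v) < t" by (auto simp: eventually_sequentially)
  define w where "w = (1/2::real)^N *\<^sub>R v"
  define y where "y i = (1/2::real)^N *\<^sub>R x i" for i
  have w: "w \<in> V" "norm w < t" using N subspace_scale[OF V v] by (auto simp: w_def)
  have yw: "(y \<longlongrightarrow> w) F" unfolding y_def w_def by (intro tendsto_intros x)
  have yV: "\<forall>\<^sub>F i in F. y i \<in> V" using x(1) by (rule eventually_mono) (simp add: y_def subspace_scale[OF V])
  have yt: "\<forall>\<^sub>F i in F. norm (y i) < t" using order_tendstoD(2)[OF tendsto_norm[OF yw] w(2)] .
  have "limitin T (\<lambda>i. expo (y i)) (expo w) F"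
  proof -
    have ew: "expo w \<in> fst c0" using r(3)[OF w(1)] w(2) by (simp add: t_def)
    have e1: "\<forall>\<^sub>F i in F. expo (y i) \<in> fst c0"
      using yV yt by eventually_elim (simp add: r(3) t_def)
    have e2: "\<forall>\<^sub>F i in F. norm (coord (expo (y i)) - coord (expo w)) \<le> K * norm (y i - w)"
      using yV yt
    proof eventually_elim
      case (elim i)
      then show ?case
        using c11_on_lipschitz[OF C(3,4,2) elim(1) w(1)] w(2) by (simp add: t_def K_def)
    qed
    have "((\<lambda>i. K * norm (y i - w)) \<longlongrightarrow> 0) F"
      using tendsto_mult_right_zero[OF tendsto_norm_zero[OF LIM_zero[OF yw]]] .
    then have "((\<lambda>i. coord (expo (y i)) - coord (expo w)) \<longlongrightarrow> 0) F"
      by (rule Lim_null_comparison[OF e2])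
    then show ?thesis unfolding limitin_iff_coord[OF ew] LIM_zero_iff using e1 by blast
  qed
  from limitin_pow[OF this, of "2^N"]
  have l: "limitin T (\<lambda>i. expo (y i) [^] (2^N::nat)) (expo w [^] (2^N::nat)) F" .
  have sc: "expo ((1/2::real)^N *\<^sub>R u) [^] (2^N::nat) = expo u" if "u \<in> V" for u
  proof -
    have "(2::real)^N * (1/2)^N = 1" by (simp add: power_mult_distrib[symmetric])
    then have "real (2^N) *\<^sub>R ((1/2::real)^N *\<^sub>R u) = u" by simp
    then show ?thesis using expo_nat_scale[OF subspace_scale[OF V that], of "2^N" "(1/2)^N"] by simp
  qed
  have ev: "\<forall>\<^sub>F i in F. expo (y i) [^] (2^N::nat) = expo (x i)"
    using x(1) by (rule eventually_mono) (simp add: y_def sc)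
  show ?thesis
    using limitin_transform_eventually[OF ev l] sc[OF v] by (simp add: w_def)
qed

text \<open>For integer multiples of one vector \<open>w\<close> this is the law of integer powers.
  \<open>q s n\<close> and \<open>q t n\<close> approximate \<open>s\<close> and \<open>t\<close> by
  integer multiples of the same \<open>(1/2)^n\<close>, and \<open>expo\<close> is
  continuous.\<close>

lemma expo_real_add:
  assumes v: "v \<in> V"
  shows "expo ((s + t) *\<^sub>R v) = expo (s *\<^sub>R v) \<otimes> expo (t *\<^sub>R v)"
proof -
  define q where "q u n = real_of_int \<lfloor>u * 2^n\<rfloor> * (1/2)^n" for u :: real and n :: nat
  have q: "q u \<longlonglongrightarrow> u" for u
  proof -
    have "\<bar>q u n - u\<bar> \<le> (1/2)^n" for n
    proof -
      have "(2::real)^n * (1/2)^n = 1" by (simp add: power_mult_distrib[symmetric])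
      then have "q u n - u = (real_of_int \<lfloor>u * 2^n\<rfloor> - u * 2^n) * (1/2)^n"
        by (simp add: q_def left_diff_distrib)
      also have "\<bar>\<dots>\<bar> = \<bar>real_of_int \<lfloor>u * 2^n\<rfloor> - u * 2^n\<bar> * (1/2)^n" by (simp add: abs_mult)
      also have "\<dots> \<le> 1 * (1/2)^n" by (intro mult_right_mono) (auto, linarith)
      finally show ?thesis by simp
    qed
    moreover have "(\<lambda>n. (1/2::real)^n) \<longlonglongrightarrow> 0" by (rule LIMSEQ_realpow_zero) auto
    ultimately have "(\<lambda>n. q u n - u) \<longlonglongrightarrow> 0"
      by (intro Lim_null_comparison[of "\<lambda>n. q u n - u"]) auto
    then show ?thesis by (rule LIM_zero_cancel)
  qed
  have qv: "(\<lambda>n. q u n *\<^sub>R v) \<longlonglongrightarrow> u *\<^sub>R v" for u by (intro tendsto_intros q)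
  have qq: "(\<lambda>n. (q s n + q t n) *\<^sub>R v) \<longlonglongrightarrow> (s + t) *\<^sub>R v" by (intro tendsto_intros q)
  have "expo ((q s n + q t n) *\<^sub>R v) = expo (q s n *\<^sub>R v) \<otimes> expo (q t n *\<^sub>R v)" for n
  proof -
    define w where "w = (1/2::real)^n *\<^sub>R v"
    have w: "w \<in> V" using subspace_scale[OF V v] by (simp add: w_def)
    have qw: "q u n *\<^sub>R v = real_of_int \<lfloor>u * 2^n\<rfloor> *\<^sub>R w" for u by (simp add: q_def w_def)
    have "(q s n + q t n) *\<^sub>R v = real_of_int (\<lfloor>s * 2^n\<rfloor> + \<lfloor>t * 2^n\<rfloor>) *\<^sub>R w"
      by (simp add: scaleR_add_left qw)
    then show ?thesis
      unfolding qw by (simp only: expo_int_scale[OF w] int_pow_mult[OF expo_closed[OF w]])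
  qed
  note eq = this
  have l1: "limitin T (\<lambda>n. expo ((q s n + q t n) *\<^sub>R v)) (expo ((s + t) *\<^sub>R v)) sequentially"
    by (rule expo_tendsto[OF subspace_scale[OF V v] _ qq]) (simp add: subspace_scale[OF V v])
  have l2: "limitin T (\<lambda>n. expo (q u n *\<^sub>R v)) (expo (u *\<^sub>R v)) sequentially" for u
    by (rule expo_tendsto[OF subspace_scale[OF V v] _ qv]) (simp add: subspace_scale[OF V v])
  from l1 limitin_mult[OF l2 l2] show ?thesis unfolding eq by (rule limitin_unique) simp
qed

lemma expo_continuous: "continuous_map (top_of_set V) T expo"
  unfolding continuous_map_atin
proof
  fix v assume "v \<in> topspace (top_of_set V)"
  then have v: "v \<in> V" by simp
  have ev: "\<forall>\<^sub>F x in atin (top_of_set V) v. x \<in> V"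
    unfolding eventually_atin using v by (intro disjI2 exI[of _ V]) auto
  have "limitin euclidean id v (atin (top_of_set V) v)"
    using limitin_continuous_map[of "top_of_set V" euclidean id v v] v by simp
  then have "((\<lambda>x. x) \<longlongrightarrow> v) (atin (top_of_set V) v)" by (simp add: id_def)
  from expo_tendsto[OF v ev this] show "limitin T expo (expo v) (atin (top_of_set V) v)" .
qed

lemma expo_line_continuous:
  assumes v: "v \<in> V"
  shows "continuous_map euclideanreal T (\<lambda>t. expo (t *\<^sub>R v))"
proof -
  have "continuous_map euclideanreal (top_of_set V) (\<lambda>t. t *\<^sub>R v)"
    unfolding continuous_map_in_subtopology
    by (auto simp: subspace_scale[OF V v] intro!: continuous_intros)
  from continuous_map_compose[OF this expo_continuous] show ?thesis by (simp add: o_def)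
qed

lemma tangent_expo_line:
  assumes v: "v \<in> V"
  shows "tangent_at_one (at 0) (\<lambda>h. 1 / h) (\<lambda>h. expo (h *\<^sub>R v)) v"
proof -
  obtain r where r: "r > 0" "c11 V (\<lambda>v. coord (expo v)) (\<lambda>v. v)"
    "\<And>v. v \<in> V \<Longrightarrow> norm v < r \<Longrightarrow> expo v \<in> fst c0"
    by (rule expo_coord_obtain) blast
  have hv: "((\<lambda>h. h *\<^sub>R v) \<longlongrightarrow> 0) (at 0)"
    using tendsto_scaleR[OF tendsto_ident_at tendsto_const[of v]] by (metis scaleR_zero_left)
  have hV: "\<forall>\<^sub>F h in at 0. h *\<^sub>R v \<in> V" by (simp add: subspace_scale[OF V v])
  have "\<forall>\<^sub>F h in at (0::real). v = (1 / h) *\<^sub>R (h *\<^sub>R v)"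
    unfolding eventually_at_filter by simp
  then have s: "((\<lambda>h. (1 / h) *\<^sub>R (h *\<^sub>R v)) \<longlongrightarrow> v) (at 0)"
    by (rule Lim_transform_eventually[OF tendsto_const])
  have "\<forall>\<^sub>F h in at (0::real). norm (h *\<^sub>R v) < r"
    using order_tendstoD(2)[OF tendsto_norm[OF hv], of r] r(1) by simp
  then have "\<forall>\<^sub>F h in at (0::real). expo (h *\<^sub>R v) \<in> fst c0"
    by (rule eventually_mono) (simp add: r(3) subspace_scale[OF V v])
  with c11_tendsto[OF r(2) V hV hv s] show ?thesis unfolding tangent_at_one_iff by blast
qed

end

section \<open>Smoothness of one-parameter subgroups\<close>

lemma Ck_on_SucE:
  assumes "Ck_on (Suc k) V U f"
  obtains D where "\<And>x. x \<in> U \<Longrightarrow> (f has_derivative D x) (at x within U)"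
    "\<And>v. v \<in> V \<Longrightarrow> Ck_on k V U (\<lambda>x. D x v)"
  using assms by (metis Ck_on.simps(2))

lemma Ck_on_subset: "Ck_on k V U f \<Longrightarrow> S \<subseteq> U \<Longrightarrow> Ck_on k V S f"
proof (induction k arbitrary: f)
  case 0
  then show ?case using continuous_on_subset by simp
next
  case (Suc k)
  obtain D where D: "\<And>x. x \<in> U \<Longrightarrow> (f has_derivative D x) (at x within U)"
    "\<And>v. v \<in> V \<Longrightarrow> Ck_on k V U (\<lambda>x. D x v)" using Ck_on_SucE[OF Suc.prems(1)] by metis
  have "\<forall>x\<in>S. (f has_derivative D x) (at x within S)" using D(1) has_derivative_subset Suc.prems(2) by blast
  moreover have "\<forall>v\<in>V. Ck_on k V S (\<lambda>x. D x v)" using Suc.IH D(2) Suc.prems(2) by blast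
  ultimately show ?case unfolding Ck_on.simps by blast
qed

lemma Ck_on_cong: "Ck_on k V U f \<Longrightarrow> (\<And>x. x \<in> U \<Longrightarrow> f x = g x) \<Longrightarrow> Ck_on k V U g"
proof (cases k)
  case 0
  assume *: "Ck_on k V U f" "\<And>x. x \<in> U \<Longrightarrow> f x = g x"
  from *(1) have "continuous_on U f" by (simp add: 0)
  then have "continuous_on U g" using continuous_on_eq *(2) by blast
  then show ?thesis by (simp add: 0)
next
  case (Suc n)
  assume *: "Ck_on k V U f" "\<And>x. x \<in> U \<Longrightarrow> f x = g x"
  obtain D where D: "\<And>x. x \<in> U \<Longrightarrow> (f has_derivative D x) (at x within U)"
    "\<And>v. v \<in> V \<Longrightarrow> Ck_on n V U (\<lambda>x. D x v)" using Ck_on_SucE[OF *(1)[unfolded Suc]] by metis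
  have "\<forall>x\<in>U. (g has_derivative D x) (at x within U)"
    using has_derivative_transform[OF _ _ D(1)] *(2) by metis
  with D(2) show ?thesis unfolding Suc Ck_on.simps by blast
qed

lemma Ck_on_Suc_imp: "Ck_on (Suc k) V U f \<Longrightarrow> Ck_on k V U f"
proof (induction k arbitrary: f)
  case 0
  then show ?case by (auto intro: has_derivative_continuous_on)
next
  case (Suc k)
  from Suc.prems obtain D where D: "\<forall>x\<in>U. (f has_derivative D x) (at x within U)"
    "\<forall>v\<in>V. Ck_on (Suc k) V U (\<lambda>x. D x v)" using Ck_on.simps(2) by blast
  then have "\<forall>v\<in>V. Ck_on k V U (\<lambda>x. D x v)" using Suc.IH by blast
  with D(1) show ?case unfolding Ck_on.simps by blast
qed

lemma Ck_on_add: "Ck_on k V U f \<Longrightarrow> Ck_on k V U g \<Longrightarrow> Ck_on k V U (\<lambda>x. f x + g x)"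
proof (induction k arbitrary: f g)
  case 0
  then show ?case by (auto intro: continuous_on_add)
next
  case (Suc k)
  obtain D where D: "\<And>x. x \<in> U \<Longrightarrow> (f has_derivative D x) (at x within U)"
    "\<And>v. v \<in> V \<Longrightarrow> Ck_on k V U (\<lambda>x. D x v)" using Ck_on_SucE[OF Suc.prems(1)] by metis
  obtain E where E: "\<And>x. x \<in> U \<Longrightarrow> (g has_derivative E x) (at x within U)"
    "\<And>v. v \<in> V \<Longrightarrow> Ck_on k V U (\<lambda>x. E x v)" using Ck_on_SucE[OF Suc.prems(2)] by metis
  have "\<forall>x\<in>U. ((\<lambda>x. f x + g x) has_derivative (\<lambda>v. D x v + E x v)) (at x within U)"
    using has_derivative_add D(1) E(1) by blast
  moreover have "\<forall>v\<in>V. Ck_on k V U (\<lambda>x. D x v + E x v)" using Suc.IH D(2) E(2) by blast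
  ultimately show ?case
    unfolding Ck_on.simps by (intro exI[of _ "\<lambda>x v. D x v + E x v"] conjI)
qed

lemma Ck_on_zero: "Ck_on k V U (\<lambda>x. 0)"
proof (induction k)
  case (Suc k)
  then show ?case by (auto intro!: exI[of _ "\<lambda>x v. 0"])
qed simp

lemma Ck_on_sum: "finite B \<Longrightarrow> (\<And>b. b \<in> B \<Longrightarrow> Ck_on k V U (f b)) \<Longrightarrow> Ck_on k V U (\<lambda>x. \<Sum>b\<in>B. f b x)"
  by (induction B rule: finite_induct) (auto simp: Ck_on_zero Ck_on_add)

lemma Ck_on_linear_comp: "bounded_linear L \<Longrightarrow> Ck_on k V U f \<Longrightarrow> Ck_on k V U (\<lambda>x. L (f x))"
proof (induction k arbitrary: f)
  case 0
  then show ?case by (auto intro: bounded_linear.continuous_on)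
next
  case (Suc k)
  obtain D where D: "\<And>x. x \<in> U \<Longrightarrow> (f has_derivative D x) (at x within U)"
    "\<And>v. v \<in> V \<Longrightarrow> Ck_on k V U (\<lambda>x. D x v)" using Ck_on_SucE[OF Suc.prems(2)] by metis
  have "\<forall>x\<in>U. ((\<lambda>x. L (f x)) has_derivative (\<lambda>v. L (D x v))) (at x within U)"
    using bounded_linear.has_derivative[OF Suc.prems(1)] D(1) by blast
  moreover have "\<forall>v\<in>V. Ck_on k V U (\<lambda>x. L (D x v))" using Suc.IH Suc.prems(1) D(2) by blast
  ultimately show ?case
    unfolding Ck_on.simps by (intro exI[of _ "\<lambda>x v. L (D x v)"] conjI)
qed

lemma Ck_on_scaleR: "Ck_on k V U f \<Longrightarrow> Ck_on k V U g \<Longrightarrow> Ck_on k V U (\<lambda>x. f x *\<^sub>R g x)"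
proof (induction k arbitrary: f g)
  case 0
  then show ?case by (auto intro: continuous_on_scaleR)
next
  case (Suc k)
  obtain D where D: "\<And>x. x \<in> U \<Longrightarrow> (f has_derivative D x) (at x within U)"
    "\<And>v. v \<in> V \<Longrightarrow> Ck_on k V U (\<lambda>x. D x v)" using Ck_on_SucE[OF Suc.prems(1)] by metis
  obtain E where E: "\<And>x. x \<in> U \<Longrightarrow> (g has_derivative E x) (at x within U)"
    "\<And>v. v \<in> V \<Longrightarrow> Ck_on k V U (\<lambda>x. E x v)" using Ck_on_SucE[OF Suc.prems(2)] by metis
  have "\<forall>x\<in>U. ((\<lambda>x. f x *\<^sub>R g x) has_derivative (\<lambda>v. f x *\<^sub>R E x v + D x v *\<^sub>R g x)) (at x within U)"
    using has_derivative_scaleR D(1) E(1) by blast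
  moreover have "\<forall>v\<in>V. Ck_on k V U (\<lambda>x. f x *\<^sub>R E x v + D x v *\<^sub>R g x)"
    by (intro ballI Ck_on_add Suc.IH D(2) E(2) Ck_on_Suc_imp[OF Suc.prems(1)] Ck_on_Suc_imp[OF Suc.prems(2)])
  ultimately show ?case
    unfolding Ck_on.simps by (intro exI[of _ "\<lambda>x v. f x *\<^sub>R E x v + D x v *\<^sub>R g x"] conjI)
qed

text \<open>Used with \<open>L y = (y, 0)\<close> and \<open>L y = (0, y)\<close> to freeze one
  factor of the multiplication in coordinates.\<close>

lemma Ck_on_affine_comp:
  assumes "bounded_linear L" "L ` W \<subseteq> V"
  shows "Ck_on k V U f \<Longrightarrow> Ck_on k W {y. a + L y \<in> U} (\<lambda>y. f (a + L y))"
proof (induction k arbitrary: f)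
  case 0
  have "continuous_on {y. a + L y \<in> U} (\<lambda>y. a + L y)"
    by (intro continuous_intros bounded_linear.continuous_on[OF assms(1)])
  then show ?case using continuous_on_compose2[of U f] 0 by fastforce
next
  case (Suc k)
  obtain D where D: "\<And>x. x \<in> U \<Longrightarrow> (f has_derivative D x) (at x within U)"
    "\<And>v. v \<in> V \<Longrightarrow> Ck_on k V U (\<lambda>x. D x v)" using Ck_on_SucE[OF Suc.prems] by metis
  define S where "S = {y. a + L y \<in> U}"
  have "\<forall>y\<in>S. ((\<lambda>y. f (a + L y)) has_derivative (\<lambda>v. D (a + L y) (L v))) (at y within S)"
  proof
    fix y assume y: "y \<in> S"
    have "((\<lambda>y. a + L y) has_derivative L) (at y within S)"
      using has_derivative_add[OF has_derivative_const bounded_linear_imp_has_derivative[OF assms(1)]] by simp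
    moreover have "(f has_derivative D (a + L y)) (at (a + L y) within (\<lambda>y. a + L y) ` S)"
      by (rule has_derivative_subset[OF D(1)]) (use y in \<open>auto simp: S_def\<close>)
    ultimately show "((\<lambda>y. f (a + L y)) has_derivative (\<lambda>v. D (a + L y) (L v))) (at y within S)"
      by (rule has_derivative_in_compose)
  qed
  moreover have "\<forall>v\<in>W. Ck_on k W S (\<lambda>y. D (a + L y) (L v))"
  proof
    fix v assume "v \<in> W"
    then have "L v \<in> V" using assms(2) by blast
    from Suc.IH[OF D(2)[OF this]] show "Ck_on k W S (\<lambda>y. D (a + L y) (L v))" by (simp add: S_def)
  qed
  ultimately show ?case
    unfolding Ck_on.simps S_def by (intro exI[of _ "\<lambda>y v. D (a + L y) (L v)"] conjI)
qed

lemma smooth_on_subset: "smooth_on V U f \<Longrightarrow> S \<subseteq> U \<Longrightarrow> smooth_on V S f"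
  unfolding smooth_on_def using Ck_on_subset by blast

lemma smooth_on_has_derivative:
  assumes "smooth_on V U f" "x \<in> U"
  shows "(f has_derivative frechet_derivative f (at x within U)) (at x within U)"
proof -
  have "Ck_on (Suc 0) V U f" using assms(1) unfolding smooth_on_def by blast
  then obtain D where "\<And>x. x \<in> U \<Longrightarrow> (f has_derivative D x) (at x within U)" using Ck_on_SucE by metis
  then show ?thesis using assms(2) differentiableI frechet_derivative_works by blast
qed

text \<open>The derivatives witnessing \<open>Ck_on (Suc k)\<close> may vary with \<open>k\<close>.
  On \<open>V\<close> they all agree with \<open>frechet_derivative\<close>, so this one function is
  \<open>Ck_on k\<close> for every \<open>k\<close>.\<close>

lemma smooth_on_directional_derivative:
  assumes f: "smooth_on V U f" and V: "subspace V" and U: "openin (top_of_set V) U" and v: "v \<in> V"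
  shows "smooth_on V U (\<lambda>x. frechet_derivative f (at x within U) v)"
  unfolding smooth_on_def
proof
  fix k
  have "Ck_on (Suc k) V U f" using f unfolding smooth_on_def by blast
  then obtain D where D: "\<And>x. x \<in> U \<Longrightarrow> (f has_derivative D x) (at x within U)"
    "\<And>v. v \<in> V \<Longrightarrow> Ck_on k V U (\<lambda>x. D x v)" using Ck_on_SucE by metis
  show "Ck_on k V U (\<lambda>x. frechet_derivative f (at x within U) v)"
    by (rule Ck_on_cong[OF D(2)[OF v]])
      (rule has_derivative_unique_on_subspace[OF V U _ D(1) smooth_on_has_derivative[OF f] v])
qed

text \<open>The derivative depends smoothly on \<open>x\<close> for a fixed direction, but
  \<open>xi x\<close> varies; it is expanded in an orthonormal basis of \<open>V\<close>, which
  reduces the claim to sums of products.\<close>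

lemma smooth_on_lie_derivative:
  fixes f :: "'e::euclidean_space \<Rightarrow> 'f::real_normed_vector"
  assumes f: "smooth_on V U f" and xi: "smooth_on V U xi" "xi ` U \<subseteq> V"
    and V: "subspace V" and U: "openin (top_of_set V) U"
  shows "smooth_on V U (\<lambda>x. frechet_derivative f (at x within U) (xi x))"
proof -
  obtain B where B: "finite B" "B \<subseteq> V" "\<And>x. x \<in> V \<Longrightarrow> (\<Sum>b\<in>B. (x \<bullet> b) *\<^sub>R b) = x"
    using orthonormal_basis_subspace_obtain[OF V] by metis
  define D where "D x = frechet_derivative f (at x within U)" for x
  have D: "linear (D x)" if "x \<in> U" for x
    using has_derivative_linear[OF smooth_on_has_derivative[OF f that]] by (simp add: D_def)
  have eq: "(\<Sum>b\<in>B. (xi x \<bullet> b) *\<^sub>R D x b) = D x (xi x)" if x: "x \<in> U" for x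
  proof -
    have "xi x \<in> V" using xi(2) x by blast
    from B(3)[OF this] show ?thesis
      using linear_sum[OF D[OF x], of "\<lambda>b. (xi x \<bullet> b) *\<^sub>R b" B] linear_scale[OF D[OF x]] by simp
  qed
  show ?thesis
    unfolding smooth_on_def D_def[symmetric]
  proof
    fix k
    have "Ck_on k V U (\<lambda>x. \<Sum>b\<in>B. (xi x \<bullet> b) *\<^sub>R D x b)"
    proof (intro Ck_on_sum B(1) Ck_on_scaleR)
      fix b assume b: "b \<in> B"
      show "Ck_on k V U (\<lambda>x. xi x \<bullet> b)"
        using Ck_on_linear_comp[OF bounded_linear_inner_left] xi(1) unfolding smooth_on_def by blast
      show "Ck_on k V U (\<lambda>x. D x b)"
        using smooth_on_directional_derivative[OF f V U] b B(2) unfolding smooth_on_def D_def by blast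
    qed
    then show "Ck_on k V U (\<lambda>x. D x (xi x))" by (rule Ck_on_cong) (use eq in auto)
  qed
qed

text \<open>The class of functions that are locally \<open>t \<mapsto> h (x (t - t0))\<close> with \<open>h\<close> smooth is closed under
  differentiation, since \<open>x\<close> is an integral curve; this replaces a chain rule for \<open>Ck_on\<close>.\<close>

lemma integral_curve_smooth:
  fixes x :: "real \<Rightarrow> 'e::euclidean_space" and f :: "real \<Rightarrow> 'f::real_normed_vector"
  assumes V: "subspace V" and U0: "openin (top_of_set V) U0" and xi: "smooth_on V U0 xi" "xi ` U0 \<subseteq> V"
    and e: "e > 0" and xU: "\<And>s. \<bar>s\<bar> < e \<Longrightarrow> x s \<in> U0"
    and xd: "\<And>s. \<bar>s\<bar> < e \<Longrightarrow> (x has_vector_derivative xi (x s)) (at s)"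
    and f: "\<And>t. t \<in> S \<Longrightarrow> \<exists>h U d. openin (top_of_set V) U \<and> U \<subseteq> U0 \<and> x 0 \<in> U \<and> smooth_on V U h \<and>
       d > 0 \<and> (\<forall>s. \<bar>s\<bar> < d \<longrightarrow> f (t + s) = h (x s))"
  shows "smooth_on UNIV S f"
  unfolding smooth_on_def
proof
  fix k
  define P where "P f t \<longleftrightarrow> (\<exists>h U d. openin (top_of_set V) U \<and> U \<subseteq> U0 \<and> x 0 \<in> U \<and> smooth_on V U h \<and>
       d > 0 \<and> (\<forall>s. \<bar>s\<bar> < d \<longrightarrow> f (t + s) = h (x s)))" for f :: "real \<Rightarrow> 'f" and t
  \<comment> \<open>By the chain rule and the equation of \<open>x\<close>, the derivative of
    \<open>h o x\<close> is \<open>D o x\<close>, where \<open>D\<close> is the derivative of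
    \<open>h\<close> along \<open>xi\<close> and again smooth. The factor \<open>c\<close> serves
    \<open>Ck_on\<close>, which asks for the derivative in each direction \<open>v\<close>, that is
    \<open>v\<close> times the derivative of \<open>f\<close>.\<close>
  have deriv: "P (\<lambda>t. c *\<^sub>R vector_derivative f (at t)) t \<and>
      (f has_vector_derivative vector_derivative f (at t)) (at t)"
    if Pf: "P f t" for f t c
  proof -
    obtain h U d where h: "openin (top_of_set V) U" "U \<subseteq> U0" "x 0 \<in> U" "smooth_on V U h"
      "d > 0" "\<forall>s. \<bar>s\<bar> < d \<longrightarrow> f (t + s) = h (x s)"
      by (rule exE[OF Pf[unfolded P_def]], elim exE conjE) (rule that)
    obtain W where W: "open W" "U = V \<inter> W" using h(1) unfolding openin_open by blast
    have "isCont x 0" using has_vector_derivative_continuous[OF xd[of 0]] e by simp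
    then have "(x \<longlongrightarrow> x 0) (nhds 0)" unfolding isCont_def tendsto_at_iff_tendsto_nhds .
    then have "\<forall>\<^sub>F s in nhds 0. x s \<in> W"
      using W h(3) by (intro topological_tendstoD) auto
    then obtain d1 where d1: "d1 > 0" "\<And>s. dist s 0 < d1 \<Longrightarrow> x s \<in> W"
      unfolding eventually_nhds_metric by blast
    have d1': "x s \<in> W" if "\<bar>s\<bar> < d1" for s using d1(2)[of s] that by simp
    define d2 where "d2 = min d (min d1 e)"
    have d2: "d2 > 0" "d2 \<le> d" "d2 \<le> e" using h d1 e by (auto simp: d2_def)
    have xW: "x s \<in> U" if "\<bar>s\<bar> < d2" for s
      using d1'[of s] xU[of s] that openin_subset[OF U0] W by (auto simp: d2_def)
    define D where "D y = frechet_derivative h (at y within U) (xi y)" for y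
    define J where "J = {-d2<..<d2}"
    have J: "open J" by (simp add: J_def)
    have fd: "(f has_vector_derivative D (x s)) (at (t + s))" if s: "\<bar>s\<bar> < d2" for s
    proof -
      have sJ: "s \<in> J" using s by (auto simp: J_def)
      have im: "x ` J \<subseteq> U" using xW by (auto simp: J_def)
      have "(x has_vector_derivative xi (x s)) (at s within J)"
        using xd[of s] s d2 has_vector_derivative_at_within by fastforce
      moreover have "(h has_derivative frechet_derivative h (at (x s) within U)) (at (x s) within x ` J)"
        by (rule has_derivative_subset[OF smooth_on_has_derivative[OF h(4) xW[OF s]] im])
      ultimately have "((h \<circ> x) has_vector_derivative D (x s)) (at s within J)"
        unfolding D_def by (rule vector_derivative_diff_chain_within)
      then have "((h \<circ> x) has_vector_derivative D (x s)) (at s)"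
        using has_vector_derivative_within_open[OF sJ J] by blast
      then have "((h \<circ> x) has_vector_derivative D (x s)) (at (t + s - t))" by simp
      then have "((h \<circ> x \<circ> (\<lambda>r. r - t)) has_vector_derivative (1 *\<^sub>R D (x s))) (at (t + s))"
        by (intro vector_diff_chain_at) (auto intro!: derivative_eq_intros)
      then have hd: "((h \<circ> x \<circ> (\<lambda>r. r - t)) has_vector_derivative D (x s)) (at (t + s))" by simp
      have "open {t - d2<..<t + d2}" "t + s \<in> {t - d2<..<t + d2}" using s by auto
      then show ?thesis
      proof (rule has_vector_derivative_transform_within_open[OF hd])
        fix r assume "r \<in> {t - d2<..<t + d2}"
        then have "\<bar>r - t\<bar> < d" using d2 by auto
        from h(6)[rule_format, OF this] show "(h \<circ> x \<circ> (\<lambda>r. r - t)) r = f r" by simp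
      qed
    qed
    have vd: "vector_derivative f (at (t + s)) = D (x s)" if "\<bar>s\<bar> < d2" for s
      using vector_derivative_at[OF fd[OF that]] .
    have "smooth_on V U D"
      unfolding D_def
      by (rule smooth_on_lie_derivative[OF h(4) smooth_on_subset[OF xi(1) h(2)] _ V h(1)]) (use xi(2) h(2) in blast)
    then have "smooth_on V U (\<lambda>y. c *\<^sub>R D y)"
      using Ck_on_linear_comp[OF bounded_linear_scaleR_right] unfolding smooth_on_def by blast
    then have "P (\<lambda>t. c *\<^sub>R vector_derivative f (at t)) t"
      unfolding P_def using h(1,2,3) d2(1) vd by (intro exI[of _ "\<lambda>y. c *\<^sub>R D y"] exI[of _ U] exI[of _ d2]) auto
    then show ?thesis using fd[of 0] vd[of 0] d2(1) by simp
  qed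
  have "Ck_on k UNIV S f" if "\<And>t. t \<in> S \<Longrightarrow> P f t" for f
    using that
  proof (induction k arbitrary: f)
    case 0
    have "isCont f t" if "t \<in> S" for t
      using deriv[OF 0[OF that]] has_vector_derivative_continuous by blast
    then show ?case by (simp add: continuous_at_imp_continuous_on)
  next
    case (Suc k)
    have "\<forall>t\<in>S. (f has_derivative (\<lambda>v. v *\<^sub>R vector_derivative f (at t))) (at t within S)"
      using deriv[OF Suc.prems] has_derivative_at_withinI unfolding has_vector_derivative_def by blast
    moreover have "\<forall>v\<in>UNIV. Ck_on k UNIV S (\<lambda>t. v *\<^sub>R vector_derivative f (at t))"
      using Suc.IH deriv[OF Suc.prems] by blast
    ultimately show ?case
      unfolding Ck_on.simps by (intro exI[of _ "\<lambda>t v. v *\<^sub>R vector_derivative f (at t)"] conjI)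
  qed
  then show "Ck_on k UNIV S f" using f unfolding P_def by blast
qed

section \<open>One-parameter subgroups and the identification of \<open>lie_exp\<close> with
  \<open>expo\<close>\<close>

lemma tangent_spaceD:
  assumes "X \<in> tangent_space M p"
  shows "c \<in> charts M \<Longrightarrow> p \<in> fst c \<Longrightarrow> X c \<in> model M"
    and "\<not> (c \<in> charts M \<and> p \<in> fst c) \<Longrightarrow> X c = 0"
    and "c \<in> charts M \<Longrightarrow> d \<in> charts M \<Longrightarrow> p \<in> fst c \<Longrightarrow> p \<in> fst d \<Longrightarrow> X d = coord_deriv c d id p (X c)"
proof -
  have *: "\<forall>c. if c \<in> charts M \<and> p \<in> fst c then X c \<in> model M else X c = 0"
    "\<forall>c\<in>charts M. \<forall>d\<in>charts M. p \<in> fst c \<longrightarrow> p \<in> fst d \<longrightarrow> X d = coord_deriv c d id p (X c)"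
    using assms unfolding tangent_space_def mem_Collect_eq by (rule conjunct1, rule conjunct2)
  show "c \<in> charts M \<Longrightarrow> p \<in> fst c \<Longrightarrow> X c \<in> model M"
    and "\<not> (c \<in> charts M \<and> p \<in> fst c) \<Longrightarrow> X c = 0"
    using spec[OF *(1), of c] by presburger+
  show "c \<in> charts M \<Longrightarrow> d \<in> charts M \<Longrightarrow> p \<in> fst c \<Longrightarrow> p \<in> fst d \<Longrightarrow> X d = coord_deriv c d id p (X c)"
    using *(2) by blast
qed

lemma real_line_chart: "is_chart (mtop real_line) (model real_line) (UNIV, id)"
  by (simp add: is_chart_def real_line_def)

lemma real_line_simps [simp]: "model real_line = UNIV" "charts real_line = {(UNIV, id)}" "mtop real_line = euclideanreal"
  by (simp_all add: real_line_def)

context lie_group_on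
begin

text \<open>The limit vector is the value at \<open>g\<close> of the left-invariant field of
  \<open>v\<close>. As a partial derivative of the multiplication it visibly depends smoothly on
  \<open>g\<close>.\<close>

lemma tangent_limit_translate:
  assumes a: "tangent_at_one F s a v" and g: "g \<in> fst d" and d: "d \<in> charts M" and v: "v \<in> V"
  shows "tangent_limit d g F s (\<lambda>i. g \<otimes> a i) (coord_deriv (chart_prod d c0) d (\<lambda>(x, y). x \<otimes> y) (g, \<one>) (0, v))"
    and "coord_deriv (chart_prod d c0) d (\<lambda>(x, y). x \<otimes> y) (g, \<one>) (0, v) \<in> V"
proof -
  have gc: "g \<in> carrier G" using g chart_carrier[OF d] by blast
  have g1: "g \<otimes> \<one> \<in> fst d" using g gc by simp
  have l: "local_c11 M c0 d (\<lambda>x. g \<otimes> x) \<one>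
     (\<lambda>v. coord_deriv (chart_prod d c0) d (\<lambda>(x, y). x \<otimes> y) (g, \<one>) (0, v))"
    by (rule local_c11_mult[OF c0_chart V local_c11_const[OF c0_chart V c0(2) g]
          local_c11_ident[OF c0_chart V c0(2)] d c0(1) d g1])
  show "tangent_limit d g F s (\<lambda>i. g \<otimes> a i) (coord_deriv (chart_prod d c0) d (\<lambda>(x, y). x \<otimes> y) (g, \<one>) (0, v))"
    using tangent_limit_map[OF c0_chart V a l] gc by simp
  show "coord_deriv (chart_prod d c0) d (\<lambda>(x, y). x \<otimes> y) (g, \<one>) (0, v) \<in> V"
    by (rule local_c11_linear_range[OF c0_chart chart[OF d] V V l v])
qed

lemma openin_coord_dom_mult:
  assumes "c \<in> charts M" "d \<in> charts M" "e \<in> charts M"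
  shows "openin (top_of_set (V \<times> V)) (coord_dom (chart_prod c d) e (\<lambda>(x, y). x \<otimes> y))"
  using openin_coord_dom[of "prod_manifold M M" "V \<times> V" "chart_prod c d" M V e "\<lambda>(x, y). x \<otimes> y"]
    is_chart_prod[OF chart[OF assms(1)] chart[OF assms(2)]] chart[OF assms(3)] continuous_mult by simp

lemma smooth_on_coord_rep_mult:
  assumes "c \<in> charts M" "d \<in> charts M" "e \<in> charts M"
  shows "smooth_on (V \<times> V) (coord_dom (chart_prod c d) e (\<lambda>(x, y). x \<otimes> y))
    (coord_rep (chart_prod c d) e (\<lambda>(x, y). x \<otimes> y))"
  using mult_smooth chart_prod_mem[OF assms(1,2)] assms(3) unfolding smooth_map_def by simp

lemma coord_rep_mult:
  assumes "c \<in> charts M" "d \<in> charts M" "x \<in> fst c" "y \<in> fst d"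
  shows "coord_rep (chart_prod c d) e (\<lambda>(x, y). x \<otimes> y) (snd c x, snd d y) = snd e (x \<otimes> y)"
  using coord_rep_apply[OF is_chart_prod[OF chart[OF assms(1)] chart[OF assms(2)]], of "(x, y)" e "\<lambda>(x, y). x \<otimes> y"]
    assms(3,4) by simp

text \<open>In the chart \<open>c0\<close> the curve solves \<open>x' = xi x\<close> near
  \<open>0\<close>, with \<open>xi\<close> the left-invariant field of \<open>v\<close>. Near
  another time \<open>t\<close> and in any chart \<open>d\<close> it is \<open>h o x\<close>, where
  \<open>h\<close> is left translation by \<open>\<gamma> t\<close> in coordinates, again
  smooth.\<close>

lemma expo_line_smooth:
  assumes v: "v \<in> V" and d: "d \<in> charts M"
  shows "smooth_on UNIV {t. expo (t *\<^sub>R v) \<in> fst d} (\<lambda>t. snd d (expo (t *\<^sub>R v)))"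
proof -
  define \<gamma> where "\<gamma> t = expo (t *\<^sub>R v)" for t
  define m where "m = (\<lambda>(x, y). x \<otimes> y)"
  have \<gamma>0: "\<gamma> 0 = \<one>" by (simp add: \<gamma>_def)
  have \<gamma>c: "\<gamma> t \<in> carrier G" for t using expo_closed subspace_scale[OF V v] by (simp add: \<gamma>_def)
  have \<gamma>add: "\<gamma> (s + t) = \<gamma> s \<otimes> \<gamma> t" for s t using expo_real_add[OF v] by (simp add: \<gamma>_def)
  have cont: "continuous_map euclideanreal T \<gamma>"
    using expo_line_continuous[OF v] unfolding \<gamma>_def .
  define U0 where "U0 = snd c0 ` fst c0"
  define A where "A = coord_dom (chart_prod c0 c0) c0 m"
  define xi where "xi y = frechet_derivative (coord_rep (chart_prod c0 c0) c0 m) (at (y, snd c0 \<one>) within A) (0, v)" for y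
  define x where "x t = snd c0 (\<gamma> t)" for t
  have xi_eq: "xi (snd c0 g) = coord_deriv (chart_prod c0 c0) c0 m (g, \<one>) (0, v)" for g
    by (simp add: xi_def coord_deriv_def A_def)
  have U0: "openin (top_of_set V) U0" unfolding U0_def by (rule is_chartD(2)[OF c0_chart])
  have op: "openin (top_of_set (V \<times> V)) A" unfolding A_def m_def by (rule openin_coord_dom_mult[OF c0(1,1,1)])
  have sm: "smooth_on (V \<times> V) A (coord_rep (chart_prod c0 c0) c0 m)"
    unfolding A_def m_def by (rule smooth_on_coord_rep_mult[OF c0(1,1,1)])
  have UA: "(y, snd c0 \<one>) \<in> A" if y: "y \<in> U0" for y
  proof -
    obtain g where g: "g \<in> fst c0" "y = snd c0 g" using y unfolding U0_def by blast
    have "g \<otimes> \<one> \<in> fst c0" using g chart_carrier[OF c0(1)] by auto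
    then have "(g, \<one>) \<in> fst (chart_prod c0 c0) \<inter> m -` fst c0" using g c0 by (simp add: m_def)
    moreover have "(y, snd c0 \<one>) = snd (chart_prod c0 c0) (g, \<one>)" using g by simp
    ultimately show ?thesis unfolding A_def coord_dom_def by blast
  qed
  have vv: "(0, v) \<in> V \<times> V" using v subspace_0[OF V] by simp
  have dsm: "smooth_on (V \<times> V) A (\<lambda>z. frechet_derivative (coord_rep (chart_prod c0 c0) c0 m) (at z within A) (0, v))"
    by (rule smooth_on_directional_derivative[OF sm VV op vv])
  have xi_smooth: "smooth_on V U0 xi"
    unfolding smooth_on_def
  proof
    fix k
    have bl: "bounded_linear (\<lambda>y::'e. (y, 0::'e))"
      using bounded_linear_Pair[OF bounded_linear_ident bounded_linear_zero] .
    have "(\<lambda>y. (y, 0)) ` V \<subseteq> V \<times> V" using subspace_0[OF V] by auto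
    from Ck_on_affine_comp[OF bl this, where a = "(0, snd c0 \<one>)"] dsm
    have "Ck_on k V {y. (0, snd c0 \<one>) + (y, 0) \<in> A} (\<lambda>y. xi y)"
      unfolding smooth_on_def xi_def by force
    then show "Ck_on k V U0 xi" by (rule Ck_on_subset) (use UA in auto)
  qed
  have tan: "tangent_at_one (at 0) (\<lambda>h. 1 / h) \<gamma> v"
    using tangent_expo_line[OF v] by (simp add: \<gamma>_def[abs_def])
  have xiV: "xi ` U0 \<subseteq> V"
  proof
    fix z assume "z \<in> xi ` U0"
    then obtain g where g: "g \<in> fst c0" "z = xi (snd c0 g)" unfolding U0_def by blast
    show "z \<in> V" unfolding g(2) xi_eq m_def by (rule tangent_limit_translate(2)[OF tan g(1) c0(1) v])
  qed
  have opn: "open {t. \<gamma> t \<in> fst c}" if "c \<in> charts M" for c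
    using openin_continuous_map_preimage[OF cont is_chartD(1)[OF chart[OF that]]] by simp
  have "0 \<in> {t. \<gamma> t \<in> fst c0}" using \<gamma>0 c0 by simp
  then obtain e where e: "e > 0" "ball 0 e \<subseteq> {t. \<gamma> t \<in> fst c0}"
    using openE[OF opn[OF c0(1)]] by metis
  have \<gamma>e: "\<gamma> s \<in> fst c0" if "\<bar>s\<bar> < e" for s using e(2) that by (auto simp: subset_iff)
  have xd: "(x has_vector_derivative xi (x s)) (at s)" if s: "\<bar>s\<bar> < e" for s
  proof -
    have "tangent_limit c0 (\<gamma> s) (at 0) (\<lambda>h. 1 / h) (\<lambda>h. \<gamma> (s + h)) (xi (x s))"
      unfolding \<gamma>add x_def xi_eq m_def by (rule tangent_limit_translate(1)[OF tan \<gamma>e[OF s] c0(1) v])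
    then show ?thesis
      using has_vector_derivative_iff_tangent_limit[where \<gamma> = \<gamma> and t = s, OF c0_chart \<gamma>e[OF s]] by (simp add: x_def[abs_def] o_def)
  qed
  have "smooth_on UNIV {t. \<gamma> t \<in> fst d} (\<lambda>t. snd d (\<gamma> t))"
  proof (rule integral_curve_smooth[OF V U0 xi_smooth xiV e(1) _ xd])
    show "x s \<in> U0" if "\<bar>s\<bar> < e" for s using \<gamma>e[OF that] by (simp add: x_def U0_def)
    fix t assume "t \<in> {t. \<gamma> t \<in> fst d}"
    then have t: "\<gamma> t \<in> fst d" by simp
    define p where "p = snd d (\<gamma> t)"
    define B where "B = coord_dom (chart_prod d c0) d m"
    define U where "U = U0 \<inter> {y. (p, y) \<in> B}"
    define h where "h y = coord_rep (chart_prod d c0) d m (p, y)" for y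
    have pV: "p \<in> V" using t is_chartD(4)[OF chart[OF d]] by (auto simp: p_def)
    have opB: "openin (top_of_set (V \<times> V)) B" unfolding B_def m_def by (rule openin_coord_dom_mult[OF d c0(1) d])
    have "openin (top_of_set V) (V \<inter> (\<lambda>y. (p, y)) -` B)"
      by (rule continuous_openin_preimage[OF _ _ opB]) (use pV in \<open>auto intro!: continuous_intros\<close>)
    moreover have "U = U0 \<inter> (V \<inter> (\<lambda>y. (p, y)) -` B)" using openin_subset[OF U0] by (auto simp: U_def)
    ultimately have 1: "openin (top_of_set V) U" using U0 by (simp add: openin_Int)
    have "(\<gamma> t, \<one>) \<in> fst (chart_prod d c0) \<inter> m -` fst d" using t c0 \<gamma>c[of t] by (simp add: m_def)
    moreover have "(p, x 0) = snd (chart_prod d c0) (\<gamma> t, \<one>)" by (simp add: p_def x_def \<gamma>0)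
    ultimately have "(p, x 0) \<in> B" unfolding B_def coord_dom_def by blast
    then have 2: "x 0 \<in> U" using c0 by (simp add: U_def U0_def x_def \<gamma>0)
    have 3: "smooth_on V U h"
      unfolding smooth_on_def
    proof
      fix k
      have bl: "bounded_linear (\<lambda>y::'e. (0::'e, y))"
        using bounded_linear_Pair[OF bounded_linear_zero bounded_linear_ident] .
      have "(\<lambda>y. (0, y)) ` V \<subseteq> V \<times> V" using subspace_0[OF V] by auto
      from Ck_on_affine_comp[OF bl this, where a = "(p, 0)"] smooth_on_coord_rep_mult[OF d c0(1) d]
      have "Ck_on k V {y. (p, 0) + (0, y) \<in> B} (\<lambda>y. h y)"
        unfolding smooth_on_def h_def B_def m_def by force
      then show "Ck_on k V U h" by (rule Ck_on_subset) (auto simp: U_def)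
    qed
    have 4: "snd d (\<gamma> (t + s)) = h (x s)" if "\<bar>s\<bar> < e" for s
      using coord_rep_mult[OF d c0(1) t \<gamma>e[OF that], of d] by (simp add: h_def p_def x_def \<gamma>add m_def)
    show "\<exists>h U e. openin (top_of_set V) U \<and> U \<subseteq> U0 \<and> x 0 \<in> U \<and> smooth_on V U h \<and>
       e > 0 \<and> (\<forall>s. \<bar>s\<bar> < e \<longrightarrow> snd d (\<gamma> (t + s)) = h (x s))"
      using 1 2 3 4 e(1) by (intro exI[of _ h] exI[of _ U] exI[of _ e]) (auto simp: U_def)
  qed
  then show ?thesis by (simp add: \<gamma>_def)
qed

lemma one_param_subgroup_expo:
  assumes v: "v \<in> V"
  shows "one_param_subgroup G M (\<lambda>t. expo (t *\<^sub>R v))"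
  unfolding one_param_subgroup_def
proof
  have inv: "inv_into UNIV id t = t" for t :: real using inv_into_f_f[of id UNIV t] by simp
  have "smooth_on UNIV (coord_dom (UNIV, id) d (\<lambda>t. expo (t *\<^sub>R v))) (coord_rep (UNIV, id) d (\<lambda>t. expo (t *\<^sub>R v)))"
    if "d \<in> charts M" for d
    using expo_line_smooth[OF v that] by (simp add: coord_dom_def coord_rep_def o_def inv vimage_def)
  then show "smooth_map real_line M (\<lambda>t. expo (t *\<^sub>R v))"
    unfolding smooth_map_def using expo_line_continuous[OF v] by simp
  show "\<forall>s t. expo ((s + t) *\<^sub>R v) = expo (s *\<^sub>R v) \<otimes> expo (t *\<^sub>R v)" using expo_real_add[OF v] by blast
qed

text \<open>\<open>\<gamma> (t / 2^n)\<close> approaches \<open>\<one>\<close> in the direction of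
  \<open>t\<close> times the velocity, and its \<open>2^n\<close>-th power is
  \<open>\<gamma> t\<close> for every \<open>n\<close>. So the sequence of powers that computes
  \<open>expo\<close> is constant.\<close>

lemma one_param_subgroup_unique:
  assumes \<gamma>: "one_param_subgroup G M \<gamma>"
  shows "\<gamma> t = expo (t *\<^sub>R velocity M \<gamma> 0 c0)"
proof -
  have sm: "smooth_map real_line M \<gamma>" and add: "\<And>s t. \<gamma> (s + t) = \<gamma> s \<otimes> \<gamma> t"
    using \<gamma> unfolding one_param_subgroup_def by auto
  have "\<gamma> \<in> UNIV \<rightarrow> carrier G"
    using sm carrier unfolding smooth_map_def continuous_map_def by simp
  then have \<gamma>c: "\<gamma> t \<in> carrier G" for t by blast
  have "\<gamma> 0 \<otimes> \<gamma> 0 = \<gamma> 0 \<otimes> \<one>" using add[of 0 0] \<gamma>c by simp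
  then have \<gamma>0: "\<gamma> 0 = \<one>" using \<gamma>c[of 0] by simp
  define L where "L = coord_deriv (UNIV, id) c0 \<gamma> 0"
  have l: "local_c11 real_line (UNIV, id) c0 \<gamma> 0 L"
    unfolding L_def
    by (rule smooth_map_local_c11[OF real_line_chart c0_chart _ sm _ c0(1)]) (use \<gamma>0 c0 in auto)
  then have "bounded_linear L" unfolding local_c11_def c11_def by blast
  then interpret L: bounded_linear L .
  have "tangent_limit (UNIV, id) (0::real) (at 0) (\<lambda>h. 1 / h) (\<lambda>h. 0 + h) 1"
  proof -
    have "((\<lambda>h::real. (1 / h) *\<^sub>R (h - 0)) \<longlongrightarrow> 1) (at 0)"
      by (rule Lim_transform_eventually[OF tendsto_const]) (simp add: eventually_at_filter)
    then show ?thesis by (simp add: tangent_limit_def)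
  qed
  from tangent_limit_map[OF real_line_chart _ this l]
  have "((snd c0 \<circ> \<gamma>) has_vector_derivative (L 1)) (at 0)"
    using has_vector_derivative_iff_tangent_limit[OF c0_chart, of \<gamma> 0 "L 1"] \<gamma>0 c0 by simp
  then have vel: "velocity M \<gamma> 0 c0 = L 1"
    unfolding velocity_def using c0 \<gamma>0 by (simp add: vector_derivative_at)
  have "tangent_limit (UNIV, id) (0::real) sequentially (\<lambda>n. 2^n) (\<lambda>n. (1/2)^n * t) t"
  proof -
    have *: "(2::real)^n * ((1/2)^n * t) = t" for n by (simp add: power_divide)
    have "(\<lambda>n. (2::real)^n * ((1/2)^n * t)) \<longlonglongrightarrow> t" unfolding * by (rule tendsto_const)
    moreover have "(\<lambda>n. (1/2)^n * t) \<longlonglongrightarrow> 0"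
      using tendsto_mult_left_zero[OF LIMSEQ_realpow_zero[of "1/2"]] by simp
    ultimately show ?thesis by (simp add: tangent_limit_def)
  qed
  from tangent_limit_map[OF real_line_chart _ this l]
  have "tangent_at_one sequentially (\<lambda>n. 2^n) (\<lambda>n. \<gamma> ((1/2)^n * t)) (L t)" using \<gamma>0 by simp
  moreover have "\<gamma> ((1/2)^n * t) [^] (2^n::nat) = \<gamma> t" for n
  proof -
    have pw: "\<gamma> s [^] k = \<gamma> (real k * s)" for s and k :: nat
    proof (induction k)
      case 0
      show ?case by (simp add: \<gamma>0)
    next
      case (Suc k)
      have "real (Suc k) * s = real k * s + s" by (simp add: distrib_right)
      then show ?case unfolding nat_pow_Suc Suc add[symmetric] by simp
    qed
    show ?thesis unfolding pw by (simp add: power_divide)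
  qed
  ultimately have "expo (L t) = \<gamma> t" by (rule expo_eqI[OF \<gamma>c _ _ \<gamma>c])
  moreover have "L t = t *\<^sub>R L 1" using L.scaleR[of t 1] by simp
  ultimately show ?thesis by (simp add: vel)
qed

lemma velocity_expo:
  assumes X: "X \<in> tangent_space M \<one>"
  shows "velocity M (\<lambda>t. expo (t *\<^sub>R X c0)) 0 = X"
proof
  fix d
  have v: "X c0 \<in> V" using tangent_spaceD(1)[OF X c0] .
  show "velocity M (\<lambda>t. expo (t *\<^sub>R X c0)) 0 d = X d"
  proof (cases "d \<in> charts M \<and> \<one> \<in> fst d")
    case True
    then have d: "d \<in> charts M" "\<one> \<in> fst d" by auto
    have l: "local_c11 M c0 d id \<one> (coord_deriv c0 d id \<one>)"
      using smooth_map_local_c11[OF c0_chart chart[OF d(1)] V smooth_map_id[OF M] c0(1) d(1) c0(2)] d by simp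
    have "((snd d \<circ> (\<lambda>t. expo (t *\<^sub>R X c0))) has_vector_derivative coord_deriv c0 d id \<one> (X c0)) (at 0)"
      using tangent_limit_map[OF c0_chart V tangent_expo_line[OF v] l]
        has_vector_derivative_iff_tangent_limit[OF chart[OF d(1)], of "\<lambda>t. expo (t *\<^sub>R X c0)" 0] d by simp
    moreover have "X d = coord_deriv c0 d id \<one> (X c0)" using tangent_spaceD(3)[OF X c0(1) d(1) c0(2) d(2)] .
    ultimately show ?thesis unfolding velocity_def using d by (simp add: vector_derivative_at)
  next
    case False
    then have "X d = 0" using tangent_spaceD(2)[OF X] by blast
    then show ?thesis using False by (auto simp: velocity_def)
  qed
qed

lemma lie_exp_eq_expo:
  assumes X: "X \<in> lie_algebra G M"
  shows "lie_exp G M X = expo (X c0)"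
proof -
  have X': "X \<in> tangent_space M \<one>" using X by (simp add: lie_algebra_def)
  have v: "X c0 \<in> V" using tangent_spaceD(1)[OF X' c0] .
  have "(THE \<gamma>. one_param_subgroup G M \<gamma> \<and> velocity M \<gamma> 0 = X) = (\<lambda>t. expo (t *\<^sub>R X c0))"
  proof (rule the_equality)
    show "one_param_subgroup G M (\<lambda>t. expo (t *\<^sub>R X c0)) \<and> velocity M (\<lambda>t. expo (t *\<^sub>R X c0)) 0 = X"
      using one_param_subgroup_expo[OF v] velocity_expo[OF X'] by blast
    show "\<gamma> = (\<lambda>t. expo (t *\<^sub>R X c0))" if "one_param_subgroup G M \<gamma> \<and> velocity M \<gamma> 0 = X" for \<gamma>
      using one_param_subgroup_unique[of \<gamma>] that by auto
  qed
  then show ?thesis by (simp add: lie_exp_def)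
qed

text \<open>Write \<open>g = expo v\<close> and \<open>z = v / 2\<close>. Continuity gives
  \<open>f (expo z) = expo u\<close> with \<open>u\<close> small; then
  \<open>expo (u + u) = f g = expo (- v)\<close>, and injectivity of \<open>expo\<close> near
  \<open>0\<close> forces \<open>u = - z\<close>.\<close>

lemma hom_inverted_square_root:
  assumes f: "f \<in> hom G G" "continuous_map T T f" and e: "e > 0"
  obtains N where "openin T N" "\<one> \<in> N"
    "\<And>g. g \<in> N \<Longrightarrow> f g = inv g \<Longrightarrow> \<exists>z\<in>V. norm z < e \<and> g = expo z \<otimes> expo z \<and> f (expo z) = expo (- z)"
proof -
  obtain r where r: "r > 0" "\<And>v w. v \<in> V \<Longrightarrow> w \<in> V \<Longrightarrow> norm v < r \<Longrightarrow> norm w < r \<Longrightarrow> expo v = expo w \<Longrightarrow> v = w"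
    by (rule expo_inj_obtain) blast
  \<comment> \<open>Half the injectivity radius, because \<open>u + u\<close> has to stay within
    it.\<close>
  have "r / 2 > 0" using r(1) by simp
  then obtain N2 where N2: "openin T N2" "\<one> \<in> N2" "\<And>g. g \<in> N2 \<Longrightarrow> \<exists>v\<in>V. norm v < r/2 \<and> g = expo v"
    by (rule expo_nhd_obtain) blast
  have f1: "f \<one> = \<one>" using hom_one[OF f(1)] is_group by simp
  have op: "openin T {g \<in> carrier G. f g \<in> N2}"
    using openin_continuous_map_preimage[OF f(2) N2(1)] by (simp add: carrier)
  have op2: "openin (top_of_set V) {v \<in> V. expo v \<in> {g \<in> carrier G. f g \<in> N2}}"
    using openin_continuous_map_preimage[OF expo_continuous op] by simp
  have z0: "0 \<in> {v \<in> V. expo v \<in> {g \<in> carrier G. f g \<in> N2}}" using f1 N2 subspace_0[OF V] by simp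
  obtain d where d: "d > 0" "\<And>y. y \<in> V \<Longrightarrow> norm y < d \<Longrightarrow> 0 + y \<in> {v \<in> V. expo v \<in> {g \<in> carrier G. f g \<in> N2}}"
    by (rule openin_subspace_ball[OF op2 z0 V]) blast
  \<comment> \<open>The factors 2 belong to \<open>v = z + z\<close>: they give
    \<open>|z| < d\<close>, where \<open>f (expo z)\<close> lies in \<open>N2\<close>, and
    \<open>|z| < e\<close>.\<close>
  have "min r (min (2 * d) (2 * e)) > 0" using r d e by simp
  then obtain N where N: "openin T N" "\<one> \<in> N"
    "\<And>g. g \<in> N \<Longrightarrow> \<exists>v\<in>V. norm v < min r (min (2 * d) (2 * e)) \<and> g = expo v"
    by (rule expo_nhd_obtain) blast
  show thesis
  proof (rule that[OF N(1,2)])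
    fix g assume g: "g \<in> N" "f g = inv g"
    obtain v where v: "v \<in> V" "norm v < r" "norm v < 2 * d" "norm v < 2 * e" "g = expo v" using N(3)[OF g(1)] by auto
    define z where "z = (1/2) *\<^sub>R v"
    have z: "z \<in> V" "norm z < d" "norm z < e" using v subspace_scale[OF V v(1)] by (auto simp: z_def)
    have dbl: "expo (u + u) = expo u \<otimes> expo u" if "u \<in> V" for u
      using expo_real_add[OF that, of 1 1] by (simp add: scaleR_2)
    have zz: "z + z = v" by (simp add: z_def scaleR_2[symmetric])
    have gz: "g = expo z \<otimes> expo z" using dbl[OF z(1)] zz v by simp
    obtain u where u: "u \<in> V" "norm u < r/2" "f (expo z) = expo u"
      using d(2)[OF z(1,2)] N2(3) by auto
    have "f g = expo (u + u)"
      using gz u hom_mult[OF f(1) expo_closed[OF z(1)] expo_closed[OF z(1)]] dbl[OF u(1)] by simp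
    then have "expo (u + u) = expo (- v)" using g(2) v expo_minus[OF v(1)] by simp
    moreover have "norm (u + u) < r" using u(2) norm_triangle_ineq[of u u] by simp
    ultimately have "u + u = - v"
      using r(2)[of "u + u" "- v"] u(1) v(1,2) subspace_add[OF V] subspace_neg[OF V] by simp
    then have "2 *\<^sub>R u = 2 *\<^sub>R (- z)" using zz by (simp add: scaleR_2)
    then have "u = - z" unfolding scaleR_cancel_left by simp
    then show "\<exists>z\<in>V. norm z < e \<and> g = expo z \<otimes> expo z \<and> f (expo z) = expo (- z)"
      using z gz u(3) by blast
  qed
qed

end

section \<open>Involutions\<close>

locale lie_group_involution = lie_group_on G M
  for G :: "('a, 'b) monoid_scheme" (structure) and M :: "('a, 'e::euclidean_space) manifold" +
  fixes \<sigma> :: "'a \<Rightarrow> 'a"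
  assumes involution: "lie_involution G M \<sigma>"
begin

lemma sigma_hom: "\<sigma> \<in> hom G G" and sigma_smooth: "smooth_map M M \<sigma>"
  and sigma_sigma: "g \<in> carrier G \<Longrightarrow> \<sigma> (\<sigma> g) = g"
  using involution unfolding lie_involution_def iso_def by auto

lemma sigma_closed: "g \<in> carrier G \<Longrightarrow> \<sigma> g \<in> carrier G"
  using hom_in_carrier[OF sigma_hom] .

lemma sigma_mult: "g \<in> carrier G \<Longrightarrow> h \<in> carrier G \<Longrightarrow> \<sigma> (g \<otimes> h) = \<sigma> g \<otimes> \<sigma> h"
  using hom_mult[OF sigma_hom] .

lemma sigma_one [simp]: "\<sigma> \<one> = \<one>"
  using hom_one[OF sigma_hom] is_group by simp

lemma sigma_inv: "g \<in> carrier G \<Longrightarrow> \<sigma> (inv g) = inv (\<sigma> g)"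
proof -
  assume g: "g \<in> carrier G"
  then have "\<sigma> (inv g) \<otimes> \<sigma> g = \<one>" using sigma_mult[of "inv g" g] by simp
  then show ?thesis using inv_equality[of "\<sigma> (inv g)" "\<sigma> g"] g sigma_closed by simp
qed

lemma sigma_continuous: "continuous_map T T \<sigma>"
  using sigma_smooth by (simp add: smooth_map_def)

definition d_sigma :: "'e \<Rightarrow> 'e" where "d_sigma = coord_deriv c0 c0 \<sigma> \<one>"

lemma sigma_local: "local_c11 M c0 c0 \<sigma> \<one> d_sigma"
  unfolding d_sigma_def
  by (rule smooth_map_local_c11[OF c0_chart c0_chart V sigma_smooth c0(1,1)]) (use c0 in auto)

lemma bounded_linear_d_sigma: "bounded_linear d_sigma"
  using sigma_local unfolding local_c11_def c11_def by blast

lemma d_sigma_in_V: "v \<in> V \<Longrightarrow> d_sigma v \<in> V"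
  using local_c11_linear_range[OF c0_chart c0_chart V V sigma_local] .

lemma sigma_expo: "v \<in> V \<Longrightarrow> \<sigma> (expo v) = expo (d_sigma v)"
  using expo_hom[OF sigma_hom sigma_continuous sigma_local] .

text \<open>The space \<pp> in the coordinates of \<open>c0\<close>; a tangent vector at
  \<open>\<one>\<close> is determined by its component at \<open>c0\<close>.\<close>

definition pp :: "'e set" where "pp = {v \<in> V. d_sigma v = - v}"

lemma pp_V: "v \<in> pp \<Longrightarrow> v \<in> V" by (simp add: pp_def)

lemma pp: "subspace pp"
proof -
  interpret L: bounded_linear d_sigma by (rule bounded_linear_d_sigma)
  show ?thesis
    unfolding pp_def subspace_def using V
    by (auto simp: L.zero L.add L.scaleR subspace_0 subspace_add subspace_scale)
qed

lemma pp_expo: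
  assumes "v \<in> pp"
  shows "expo v \<in> carrier G" "\<sigma> (expo v) = inv (expo v)"
  using assms expo_closed sigma_expo expo_minus unfolding pp_def by auto

lemma expo_double: "v \<in> V \<Longrightarrow> expo (2 *\<^sub>R v) = expo v \<otimes> expo v"
  using expo_real_add[of v 1 1] by simp

text \<open>In the Lie algebra the eigenvector equation is demanded in every chart at
  \<open>\<one>\<close>. It passes from \<open>c0\<close> to a chart \<open>d\<close> by the chain
  rule for \<open>\<sigma>\<close> followed by the change of coordinates.\<close>

lemma lie_exp_image:
  "lie_exp G M ` differential_eigenspace G M \<sigma> (- 1) = expo ` pp"
proof
  show "lie_exp G M ` differential_eigenspace G M \<sigma> (- 1) \<subseteq> expo ` pp"
  proof
    fix g assume "g \<in> lie_exp G M ` differential_eigenspace G M \<sigma> (- 1)"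
    then obtain X where X: "X \<in> differential_eigenspace G M \<sigma> (- 1)" "g = lie_exp G M X" by blast
    have XL: "X \<in> lie_algebra G M" and eig: "tangent_map M M \<sigma> \<one> X = (\<lambda>c. (- 1) *\<^sub>R X c)"
      using X(1) unfolding differential_eigenspace_def by auto
    have "X c0 \<in> V" using tangent_spaceD(1)[OF XL[unfolded lie_algebra_def] c0] .
    moreover have "d_sigma (X c0) = - X c0"
      using fun_cong[OF eig, of c0] c0 by (simp add: tangent_map_def d_sigma_def)
    ultimately have "X c0 \<in> pp" by (simp add: pp_def)
    then show "g \<in> expo ` pp" using X(2) lie_exp_eq_expo[OF XL] by simp
  qed
  show "expo ` pp \<subseteq> lie_exp G M ` differential_eigenspace G M \<sigma> (- 1)"
  proof
    fix g assume "g \<in> expo ` pp"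
    then obtain v where v: "v \<in> pp" "g = expo v" by blast
    note vV = pp_V[OF v(1)]
    define X where "X = coord_vector M c0 v \<one>"
    have X: "X \<in> tangent_space M \<one>" "X c0 = v"
      using coord_vector_tangent[OF M c0 vV] by (simp_all add: X_def)
    have "tangent_map M M \<sigma> \<one> X d = (- 1) *\<^sub>R X d" for d
    proof (cases "d \<in> charts M \<and> \<one> \<in> fst d")
      case True
      then have d: "d \<in> charts M" "\<one> \<in> fst d" by auto
      have l: "local_c11 M c0 d id \<one> (coord_deriv c0 d id \<one>)"
        using smooth_map_local_c11[OF c0_chart chart[OF d(1)] V smooth_map_id[OF M] c0(1) d(1) c0(2)] d by simp
      then have "local_c11 M c0 d id (\<sigma> \<one>) (coord_deriv c0 d id \<one>)" by simp
      from local_c11_compose[OF c0_chart c0_chart V V sigma_local this]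
      have "local_c11 M c0 d \<sigma> \<one> (\<lambda>v. coord_deriv c0 d id \<one> (d_sigma v))" by simp
      from local_c11_coord_deriv[OF c0_chart V this vV]
      have "coord_deriv c0 d \<sigma> \<one> v = coord_deriv c0 d id \<one> (- v)" using v(1) by (simp add: pp_def)
      also have "\<dots> = - coord_deriv c0 d id \<one> v"
      proof -
        have "bounded_linear (coord_deriv c0 d id \<one>)" using l unfolding local_c11_def c11_def by blast
        then show ?thesis by (rule linear_neg[OF bounded_linear.linear])
      qed
      also have "coord_deriv c0 d id \<one> v = X d" using d by (simp add: X_def coord_vector_def)
      finally show ?thesis using d X(2) by (simp add: tangent_map_def)
    next
      case False
      then show ?thesis using tangent_spaceD(2)[OF X(1) False] by (auto simp: tangent_map_def)
    qed
    then have "X \<in> differential_eigenspace G M \<sigma> (- 1)"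
      unfolding differential_eigenspace_def lie_algebra_def using X(1) by blast
    moreover have "lie_exp G M X = g" using lie_exp_eq_expo[of X] X v by (simp add: lie_algebra_def)
    ultimately show "g \<in> lie_exp G M ` differential_eigenspace G M \<sigma> (- 1)" by blast
  qed
qed

section \<open>Inclusions between the sets, and the twisted action of \<open>G\<close> on
  \<open>R\<close>\<close>

abbreviation RR :: "'a set" where "RR \<equiv> {g \<in> carrier G. \<sigma> g = inv g}"
abbreviation QQ :: "'a set" where "QQ \<equiv> {g \<otimes> inv (\<sigma> g) | g. g \<in> carrier G}"

lemma pp_line_in_R: "v \<in> pp \<Longrightarrow> expo (t *\<^sub>R v) \<in> RR"
  using pp_expo[OF subspace_scale[OF pp]] by blast

lemma QQ_subset_RR: "QQ \<subseteq> RR"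
  using sigma_mult sigma_inv sigma_sigma sigma_closed inv_mult_group by auto

lemma expo_pp_subset_squares: "expo ` pp \<subseteq> {g [^] (2::nat) | g. g \<in> RR}"
proof
  fix g assume "g \<in> expo ` pp"
  then obtain v where v: "v \<in> pp" "g = expo v" by blast
  define z where "z = (1/2) *\<^sub>R v"
  have z: "expo z \<in> RR" unfolding z_def by (rule pp_line_in_R[OF v(1)])
  have "z \<in> V" using pp_V[OF v(1)] subspace_scale[OF V] by (simp add: z_def)
  then have "g = expo z [^] (2::nat)"
    using expo_nat_scale[of z 2] v(2) by (simp add: z_def)
  with z show "g \<in> {g [^] (2::nat) | g. g \<in> RR}" by blast
qed

lemma squares_subset_QQ: "{g [^] (2::nat) | g. g \<in> RR} \<subseteq> QQ"
proof
  fix x assume "x \<in> {g [^] (2::nat) | g. g \<in> RR}"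
  then obtain g where g: "g \<in> carrier G" "\<sigma> g = inv g" "x = g [^] (2::nat)" by blast
  then have "x = g \<otimes> inv (\<sigma> g)" by (simp add: numeral_2_eq_2)
  then show "x \<in> QQ" using g(1) by blast
qed

lemma expo_pp_subset_path_component:
  "expo ` pp \<subseteq> path_component_of_set (subtopology T RR) \<one>"
proof
  fix g assume "g \<in> expo ` pp"
  then obtain v where v: "v \<in> pp" "g = expo v" by blast
  have "continuous_map euclideanreal (subtopology T RR) (\<lambda>t. expo (t *\<^sub>R v))"
    unfolding continuous_map_in_subtopology
    using expo_line_continuous[OF pp_V[OF v(1)]] pp_line_in_R[OF v(1)] by blast
  then have "pathin (subtopology T RR) (\<lambda>t. expo (t *\<^sub>R v))"
    unfolding pathin_def by (rule continuous_map_from_subtopology)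
  then show "g \<in> path_component_of_set (subtopology T RR) \<one>"
    unfolding path_component_of_def mem_Collect_eq using v(2)
    by (intro exI[of _ "\<lambda>t. expo (t *\<^sub>R v)"]) simp
qed

text \<open>The orbits of the twisted action \<open>h \<cdot> r = h r \<sigma>(h)\<^sup>-\<^sup>1\<close> of \<open>G\<close> on \<open>R\<close> are open: for \<open>r\<close> in \<open>R\<close>,
  \<open>g \<mapsto> r \<sigma>(g) r\<^sup>-\<^sup>1\<close> is again an involution, and an element near \<open>1\<close> which it inverts has a
  square root near \<open>1\<close> which it also inverts.\<close>

lemma twisted_orbit_open:
  assumes r: "r \<in> RR"
  obtains W where "openin T W" "r \<in> W"
    "\<And>w. w \<in> W \<Longrightarrow> w \<in> RR \<Longrightarrow> \<exists>h\<in>carrier G. w = h \<otimes> r \<otimes> inv (\<sigma> h)"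
proof -
  have rc: "r \<in> carrier G" "\<sigma> r = inv r" using r by auto
  define f where "f g = r \<otimes> \<sigma> g \<otimes> inv r" for g
  have fh: "f \<in> hom G G"
  proof (rule homI)
    fix x y assume xy: "x \<in> carrier G" "y \<in> carrier G"
    show "f x \<in> carrier G" using xy rc sigma_closed by (simp add: f_def)
    have "inv r \<otimes> (r \<otimes> (\<sigma> y \<otimes> inv r)) = \<sigma> y \<otimes> inv r"
      using xy rc sigma_closed by (simp add: m_assoc[symmetric])
    then show "f (x \<otimes> y) = f x \<otimes> f y"
      using xy rc sigma_closed sigma_mult by (simp add: f_def m_assoc)
  qed
  have cc: "continuous_map T T (\<lambda>g. k)" if "k \<in> carrier G" for k using that carrier by simp
  have fcont: "continuous_map T T f"
    unfolding f_def[abs_def]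
    by (intro continuous_map_mult cc sigma_continuous inv_closed rc)
  obtain N where N: "openin T N" "\<one> \<in> N"
    "\<And>g. g \<in> N \<Longrightarrow> f g = inv g \<Longrightarrow> \<exists>z\<in>V. norm z < 1 \<and> g = expo z \<otimes> expo z \<and> f (expo z) = expo (- z)"
    by (rule hom_inverted_square_root[OF fh fcont zero_less_one]) blast
  define W where "W = {w \<in> carrier G. w \<otimes> inv r \<in> N}"
  have Wop: "openin T W"
  proof -
    have "continuous_map T T (\<lambda>w. w \<otimes> inv r)"
      by (intro continuous_map_mult cc inv_closed rc) simp
    from openin_continuous_map_preimage[OF this N(1)] show ?thesis by (simp add: W_def carrier)
  qed
  show thesis
  proof (rule that[OF Wop])
    show "r \<in> W" using rc N by (simp add: W_def)
    fix w assume w: "w \<in> W" "w \<in> RR"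
    then have wc: "w \<in> carrier G" "\<sigma> w = inv w" "w \<otimes> inv r \<in> N" by (auto simp: W_def)
    \<comment> \<open>Membership of both \<open>w\<close> and \<open>r\<close> in \<open>RR\<close>
      makes the new involution invert \<open>w \<otimes> inv r\<close>.\<close>
    have "f (w \<otimes> inv r) = r \<otimes> (inv w \<otimes> r) \<otimes> inv r"
      using wc rc sigma_mult sigma_inv by (simp add: f_def)
    also have "\<dots> = r \<otimes> inv w" using wc rc by (simp add: m_assoc)
    also have "\<dots> = inv (w \<otimes> inv r)" using wc rc by (simp add: inv_mult_group)
    finally obtain z where z: "z \<in> V" "w \<otimes> inv r = expo z \<otimes> expo z" "f (expo z) = expo (- z)"
      using N(3)[OF wc(3)] by blast
    define h where "h = expo z"
    have h: "h \<in> carrier G" using expo_closed[OF z(1)] by (simp add: h_def)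
    have fh': "r \<otimes> \<sigma> h \<otimes> inv r = inv h"
      using z(3) expo_minus[OF z(1)] by (simp add: f_def h_def)
    note sh = sigma_closed[OF h]
    \<comment> \<open>That \<open>f\<close> inverts \<open>h\<close> amounts to
      \<open>inv (\<sigma> h) = inv r \<otimes> h \<otimes> r\<close>. Hence the action of
      \<open>h\<close> sends \<open>r\<close> to \<open>h \<otimes> h \<otimes> r\<close>, which is
      \<open>w\<close> because \<open>h\<close> is a square root of
      \<open>w \<otimes> inv r\<close>.\<close>
    have "r \<otimes> \<sigma> h = inv h \<otimes> r"
      using fh' rc sh h by (metis inv_closed inv_solve_right m_closed inv_inv)
    then have "inv (\<sigma> h) = inv r \<otimes> h \<otimes> r"
      using rc sh h by (metis inv_closed inv_inv inv_mult_group inv_solve_left m_assoc m_closed)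
    then have "h \<otimes> r \<otimes> inv (\<sigma> h) = h \<otimes> (r \<otimes> (inv r \<otimes> (h \<otimes> r)))" using rc h by (simp add: m_assoc)
    also have "\<dots> = h \<otimes> h \<otimes> r" using rc h by (simp add: m_assoc[symmetric])
    also have "\<dots> = w" using z(2) rc wc h by (simp add: h_def[symmetric] inv_solve_right')
    finally show "\<exists>h\<in>carrier G. w = h \<otimes> r \<otimes> inv (\<sigma> h)" using h by metis
  qed
qed

lemma twisted_action_QQ:
  assumes "h \<in> carrier G" "q \<in> QQ"
  shows "h \<otimes> q \<otimes> inv (\<sigma> h) \<in> QQ"
proof -
  obtain g where g: "g \<in> carrier G" "q = g \<otimes> inv (\<sigma> g)" using assms(2) by blast
  have "h \<otimes> q \<otimes> inv (\<sigma> h) = (h \<otimes> g) \<otimes> inv (\<sigma> (h \<otimes> g))"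
    using g assms(1) sigma_closed sigma_mult by (simp add: inv_mult_group m_assoc)
  then show ?thesis using g(1) assms(1) by blast
qed

lemma QQ_eq_connected_component:
  assumes conn: "connected_space T"
  shows "QQ = connected_component_of_set (subtopology T RR) \<one>"
proof
  have oneQ: "\<one> \<in> QQ"
  proof -
    have "\<one> = \<one> \<otimes> inv (\<sigma> \<one>)" by simp
    then show ?thesis by blast
  qed
  have ts: "topspace (subtopology T RR) = RR" using carrier by auto
  show "QQ \<subseteq> connected_component_of_set (subtopology T RR) \<one>"
  proof (rule connected_component_of_maximal[OF _ oneQ])
    have "continuous_map T T (\<lambda>g. g \<otimes> inv (\<sigma> g))"
      by (intro continuous_map_mult continuous_map_inv sigma_continuous) simp
    then have "continuous_map T (subtopology T RR) (\<lambda>g. g \<otimes> inv (\<sigma> g))"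
      unfolding continuous_map_in_subtopology using QQ_subset_RR carrier by blast
    moreover have "connectedin T (topspace T)" using conn by (simp add: connectedin_topspace)
    ultimately have "connectedin (subtopology T RR) ((\<lambda>g. g \<otimes> inv (\<sigma> g)) ` topspace T)"
      by (rule connectedin_continuous_map_image)
    moreover have "(\<lambda>g. g \<otimes> inv (\<sigma> g)) ` topspace T = QQ" using carrier by auto
    ultimately show "connectedin (subtopology T RR) QQ" by simp
  qed
  have op: "openin (subtopology T RR) QQ"
    unfolding openin_subopen[of _ QQ]
  proof
    fix q assume q: "q \<in> QQ"
    then have "q \<in> RR" using QQ_subset_RR by blast
    then obtain W where W: "openin T W" "q \<in> W"
      "\<And>w. w \<in> W \<Longrightarrow> w \<in> RR \<Longrightarrow> \<exists>h\<in>carrier G. w = h \<otimes> q \<otimes> inv (\<sigma> h)"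
      by (rule twisted_orbit_open) blast
    have "W \<inter> RR \<subseteq> QQ" using W(3) twisted_action_QQ[OF _ q] by blast
    then show "\<exists>S. openin (subtopology T RR) S \<and> q \<in> S \<and> S \<subseteq> QQ"
      using W(1,2) \<open>q \<in> RR\<close> by (intro exI[of _ "W \<inter> RR"]) (auto simp: openin_subtopology_Int)
  qed
  have "openin (subtopology T RR) (RR - QQ)"
    unfolding openin_subopen[of _ "RR - QQ"]
  proof
    fix r assume r: "r \<in> RR - QQ"
    then have rR: "r \<in> RR" by blast
    then obtain W where W: "openin T W" "r \<in> W"
      "\<And>w. w \<in> W \<Longrightarrow> w \<in> RR \<Longrightarrow> \<exists>h\<in>carrier G. w = h \<otimes> r \<otimes> inv (\<sigma> h)"
      by (rule twisted_orbit_open) blast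
    have "w \<notin> QQ" if w: "w \<in> W" "w \<in> RR" for w
    proof
      assume wQ: "w \<in> QQ"
      obtain h where h: "h \<in> carrier G" "w = h \<otimes> r \<otimes> inv (\<sigma> h)" using W(3)[OF w] by blast
      \<comment> \<open>Acting with \<open>inv h\<close> undoes the action of \<open>h\<close>, so
        \<open>r\<close> lies in the orbit of \<open>w\<close>.\<close>
      have "inv h \<otimes> w \<otimes> inv (\<sigma> (inv h)) = inv h \<otimes> (h \<otimes> (r \<otimes> (inv (\<sigma> h) \<otimes> \<sigma> h)))"
        using h rR sigma_closed sigma_inv by (simp add: m_assoc)
      also have "\<dots> = r" using h rR sigma_closed by (simp add: m_assoc[symmetric])
      finally have "r \<in> QQ" using twisted_action_QQ[OF inv_closed[OF h(1)] wQ] by simp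
      with r show False by blast
    qed
    then show "\<exists>S. openin (subtopology T RR) S \<and> r \<in> S \<and> S \<subseteq> RR - QQ"
      using W(1,2) rR by (intro exI[of _ "W \<inter> RR"]) (auto simp: openin_subtopology_Int)
  qed
  then have cl: "closedin (subtopology T RR) QQ"
    unfolding closedin_def ts using QQ_subset_RR by blast
  have "connected_component_of_set (subtopology T RR) \<one> \<subseteq> QQ \<or>
      disjnt (connected_component_of_set (subtopology T RR) \<one>) QQ"
    by (rule connectedin_clopen_cases[OF connectedin_connected_component_of cl op])
  moreover have "\<one> \<in> connected_component_of_set (subtopology T RR) \<one>"
    using connected_component_of_refl[of "subtopology T RR" \<one>] oneQ QQ_subset_RR ts by auto
  ultimately show "connected_component_of_set (subtopology T RR) \<one> \<subseteq> QQ"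
    using oneQ unfolding disjnt_iff by blast
qed

end

section \<open>The invariant inner product\<close>

text \<open>Composition with a projection onto \<open>S\<close> extends \<open>q\<close> to a
  bilinear form on the whole Euclidean space, bounded and continuous by finite dimension. The lower
  bound is the minimum over the unit sphere of \<open>S\<close>, by homogeneity.\<close>

lemma inner_form_bounds:
  fixes S :: "'e::euclidean_space set" and q :: "'e \<Rightarrow> 'e \<Rightarrow> real"
  assumes S: "subspace S" and sym: "\<And>x y. x \<in> S \<Longrightarrow> y \<in> S \<Longrightarrow> q x y = q y x"
    and lin: "\<And>x y z a b. x \<in> S \<Longrightarrow> y \<in> S \<Longrightarrow> z \<in> S \<Longrightarrow> q (a *\<^sub>R x + b *\<^sub>R y) z = a * q x z + b * q y z"
    and pos: "\<And>x. x \<in> S \<Longrightarrow> x \<noteq> 0 \<Longrightarrow> 0 < q x x"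
  obtains c C where "0 < c" "0 \<le> C" "\<And>x. x \<in> S \<Longrightarrow> c * (norm x)\<^sup>2 \<le> q x x"
    "\<And>x y. x \<in> S \<Longrightarrow> y \<in> S \<Longrightarrow> \<bar>q x y\<bar> \<le> C * norm x * norm y"
    "continuous_on S (\<lambda>x. q x x)"
proof -
  obtain P where P: "linear P" "\<And>x. P x \<in> S" "\<And>x. x \<in> S \<Longrightarrow> P x = x"
    using orthogonal_projection_obtain[OF S] by metis
  define p where "p x y = q (P x) (P y)" for x y
  have l1: "linear (\<lambda>x. p x y)" for y
  proof
    show "p (x + x') y = p x y + p x' y" for x x'
      using lin[of "P x" "P x'" "P y" 1 1] P(2) by (simp add: p_def linear_add[OF P(1)])
    show "p (a *\<^sub>R x) y = a *\<^sub>R p x y" for a x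
      using lin[of "P x" "P x" "P y" a 0] P(2) by (simp add: p_def linear_scale[OF P(1)])
  qed
  have "p x = (\<lambda>y. p y x)" for x using sym P(2) by (auto simp: p_def)
  then have "bilinear p" unfolding bilinear_def using l1 by metis
  then have bb: "bounded_bilinear p" using bilinear_conv_bounded_bilinear by blast
  then interpret p: bounded_bilinear p .
  have pq: "p x y = q x y" if "x \<in> S" "y \<in> S" for x y using that P(3) by (simp add: p_def)
  have cont: "continuous_on UNIV (\<lambda>x. p x x)"
    by (intro p.continuous_on continuous_on_id)
  obtain C where C: "0 \<le> C" "\<And>x y. norm (p x y) \<le> norm x * norm y * C"
    using p.nonneg_bounded by blast
  define Z where "Z = S \<inter> sphere 0 1"
  have "compact Z" unfolding Z_def using closed_subspace[OF S] by (simp add: closed_Int_compact)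
  have "\<exists>c>0. \<forall>x\<in>Z. c \<le> p x x"
  proof (cases "Z = {}")
    \<comment> \<open>\<open>S\<close> may be the zero space; the sphere is then empty and any
      positive constant will do.\<close>
    case True
    then show ?thesis by (intro exI[of _ 1]) simp
  next
    case False
    obtain z where z: "z \<in> Z" "\<And>x. x \<in> Z \<Longrightarrow> p z z \<le> p x x"
      using continuous_attains_inf[OF \<open>compact Z\<close> False continuous_on_subset[OF cont subset_UNIV]] by metis
    have "z \<in> S" "z \<noteq> 0" using z(1) by (auto simp: Z_def)
    then have "0 < p z z" using pos[of z] pq[of z z] by simp
    with z(2) show ?thesis by blast
  qed
  then obtain c where c: "c > 0" "\<And>x. x \<in> Z \<Longrightarrow> c \<le> p x x" by blast
  have low: "c * (norm x)\<^sup>2 \<le> q x x" if x: "x \<in> S" for x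
  proof (cases "x = 0")
    case True
    then show ?thesis using pq[OF x x] p.zero_left by simp
  next
    case False
    define u where "u = (1 / norm x) *\<^sub>R x"
    have u: "u \<in> Z" using False x subspace_scale[OF S] by (simp add: Z_def u_def)
    have xu: "x = norm x *\<^sub>R u" using False by (simp add: u_def)
    have "q x x = p x x" using pq[OF x x] by simp
    also have "\<dots> = p (norm x *\<^sub>R u) (norm x *\<^sub>R u)" using xu by simp
    also have "\<dots> = (norm x)\<^sup>2 * p u u" by (simp add: p.scaleR_left p.scaleR_right power2_eq_square)
    also have "\<dots> \<ge> (norm x)\<^sup>2 * c" using c(2)[OF u] by (intro mult_left_mono) auto
    finally show ?thesis by (simp add: mult.commute)
  qed
  show thesis
  proof (rule that[OF c(1) C(1) low])
    show "\<bar>q x y\<bar> \<le> C * norm x * norm y" if "x \<in> S" "y \<in> S" for x y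
      using C(2)[of x y] pq[OF that] by (simp add: mult_ac)
    show "continuous_on S (\<lambda>x. q x x)"
      using continuous_on_eq[OF continuous_on_subset[OF cont subset_UNIV, of S]] pq by simp
  qed
qed

lemma tangent_limit_unique:
  assumes "tangent_limit c p F s a v" "tangent_limit c p F s b w" "\<forall>\<^sub>F i in F. a i = b i" "F \<noteq> bot"
  shows "v = w"
proof -
  have "((\<lambda>i. s i *\<^sub>R (snd c (a i) - snd c p)) \<longlongrightarrow> v) F" using assms(1) by (simp add: tangent_limit_def)
  then have "((\<lambda>i. s i *\<^sub>R (snd c (b i) - snd c p)) \<longlongrightarrow> v) F"
    by (rule Lim_transform_eventually) (use assms(3) in \<open>auto elim: eventually_mono\<close>)
  moreover have "((\<lambda>i. s i *\<^sub>R (snd c (b i) - snd c p)) \<longlongrightarrow> w) F" using assms(2) by (simp add: tangent_limit_def)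
  ultimately show ?thesis using tendsto_unique[OF assms(4)] by blast
qed

context lie_group_on
begin

definition conj_by :: "'a \<Rightarrow> 'a \<Rightarrow> 'a" where "conj_by k g = k \<otimes> g \<otimes> inv k"

lemma conj_by_hom: "k \<in> carrier G \<Longrightarrow> conj_by k \<in> hom G G"
proof (rule homI)
  fix x y assume k: "k \<in> carrier G" and xy: "x \<in> carrier G" "y \<in> carrier G"
  show "conj_by k x \<in> carrier G" using xy k by (simp add: conj_by_def)
  have "inv k \<otimes> (k \<otimes> (y \<otimes> inv k)) = y \<otimes> inv k" using xy k by (simp add: m_assoc[symmetric])
  then show "conj_by k (x \<otimes> y) = conj_by k x \<otimes> conj_by k y" using xy k by (simp add: conj_by_def m_assoc)
qed

lemma conj_by_one: "k \<in> carrier G \<Longrightarrow> conj_by k \<one> = \<one>" by (simp add: conj_by_def)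

lemma conj_by_continuous: "k \<in> carrier G \<Longrightarrow> continuous_map T T (conj_by k)"
  unfolding conj_by_def[abs_def] by (intro continuous_map_mult) (simp_all add: carrier)

text \<open>The differential of conjugation at \<open>\<one>\<close>, in coordinates. The choice is
  unique on \<open>V\<close>.\<close>

definition Ad :: "'a \<Rightarrow> 'e \<Rightarrow> 'e" where "Ad k = (SOME L. local_c11 M c0 c0 (conj_by k) \<one> L)"

text \<open>Conjugation is differentiated in two steps because \<open>k \<otimes> x\<close> may
  leave the chart at \<open>\<one>\<close>; the intermediate value is read in a chart at
  \<open>k\<close>.\<close>

lemma Ad_local:
  assumes k: "k \<in> carrier G"
  shows "local_c11 M c0 c0 (conj_by k) \<one> (Ad k)"
proof -
  have kT: "k \<in> topspace T" "inv k \<in> topspace T" using k carrier by auto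
  note ck = chart_at[OF M kT(1)] and ci = chart_at[OF M kT(2)]
  note id = local_c11_ident[OF c0_chart V c0(2)]
  have 1: "k \<otimes> \<one> \<in> fst (chart_at M k)" using k ck by simp
  note l1 = local_c11_mult[OF c0_chart V local_c11_const[OF c0_chart V c0(2) ck(2)] id ck(1) c0(1) ck(1) 1]
  have 2: "(k \<otimes> \<one>) \<otimes> inv k \<in> fst c0" using k c0 by simp
  note l2 = local_c11_mult[OF c0_chart V l1 local_c11_const[OF c0_chart V c0(2) ci(2)] ck(1) ci(1) c0(1) 2]
  then have "\<exists>L. local_c11 M c0 c0 (conj_by k) \<one> L" unfolding conj_by_def[abs_def] by blast
  then show ?thesis unfolding Ad_def by (rule someI_ex)
qed

lemma Ad_in_V: "k \<in> carrier G \<Longrightarrow> v \<in> V \<Longrightarrow> Ad k v \<in> V"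
  using local_c11_linear_range[OF c0_chart c0_chart V V Ad_local] .

lemma expo_Ad: "k \<in> carrier G \<Longrightarrow> v \<in> V \<Longrightarrow> expo (Ad k v) = conj_by k (expo v)"
  using expo_hom[OF conj_by_hom conj_by_continuous Ad_local] by simp

lemma bounded_linear_Ad: "k \<in> carrier G \<Longrightarrow> bounded_linear (Ad k)"
  using Ad_local unfolding local_c11_def c11_def by blast

end

context lie_group_involution
begin

abbreviation KK :: "'a set" where "KK \<equiv> {g \<in> carrier G. \<sigma> g = g}"

lemma KK_subgroup: "subgroup KK G"
  by (rule subgroupI) (auto simp: sigma_mult sigma_inv intro!: exI[of _ \<one>])

text \<open>\<open>\<sigma>\<close> commutes with conjugation by a fixed point \<open>k\<close>,
  hence \<open>d_sigma\<close> commutes with \<open>Ad k\<close> on \<open>pp\<close>.\<close>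

lemma Ad_pp:
  assumes k: "k \<in> KK" and v: "v \<in> pp"
  shows "Ad k v \<in> pp"
proof -
  have kc: "k \<in> carrier G" "\<sigma> k = k" using k by auto
  have c1: "conj_by k \<one> = \<one>" using conj_by_one[OF kc(1)] .
  have "local_c11 M c0 c0 \<sigma> (conj_by k \<one>) d_sigma" using sigma_local c1 by simp
  from local_c11_compose[OF c0_chart c0_chart V V Ad_local[OF kc(1)] this]
  have l1: "local_c11 M c0 c0 (\<lambda>x. \<sigma> (conj_by k x)) \<one> (\<lambda>v. d_sigma (Ad k v))" .
  have "local_c11 M c0 c0 (conj_by k) (\<sigma> \<one>) (Ad k)" using Ad_local[OF kc(1)] by simp
  from local_c11_compose[OF c0_chart c0_chart V V sigma_local this]
  have l2: "local_c11 M c0 c0 (\<lambda>x. conj_by k (\<sigma> x)) \<one> (\<lambda>v. Ad k (d_sigma v))" .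
  have "conj_by k (\<sigma> x) = \<sigma> (conj_by k x)" if "x \<in> fst c0" for x
    using kc that chart_carrier[OF c0(1)] sigma_closed sigma_mult sigma_inv by (auto simp: conj_by_def)
  from local_c11_cong[OF l2 this c0_chart V]
  have l3: "local_c11 M c0 c0 (\<lambda>x. \<sigma> (conj_by k x)) \<one> (\<lambda>v. Ad k (d_sigma v))" by simp
  have "d_sigma (Ad k v) = Ad k (d_sigma v)"
    using local_c11_coord_deriv[OF c0_chart V l1 pp_V[OF v]] local_c11_coord_deriv[OF c0_chart V l3 pp_V[OF v]] by simp
  also have "\<dots> = - Ad k v"
    using v linear_neg[OF bounded_linear.linear[OF bounded_linear_Ad[OF kc(1)]]] by (simp add: pp_def)
  finally show ?thesis using Ad_in_V[OF kc(1) pp_V[OF v]] by (simp add: pp_def)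
qed

end

section \<open>The metric at the base point of \<open>G/K\<close>, pulled back to
  \<open>pp\<close>\<close>

locale symmetric_triple = lie_group_involution G M \<sigma>
  for G :: "('a, 'b) monoid_scheme" (structure) and M :: "('a, 'e::euclidean_space) manifold" and \<sigma> +
  fixes B :: "('a set, 'e) manifold" and h :: "'a set \<Rightarrow> ('a set, 'e) tvec \<Rightarrow> ('a set, 'e) tvec \<Rightarrow> real"
  assumes connected: "connected_space T"
    and homogeneous: "homogeneous_space G M KK B"
    and metric: "riemannian_metric B h"
    and invariant: "invariant_metric G B h"
begin

definition proj :: "'a \<Rightarrow> 'a set" where "proj g = g <# KK"
abbreviation base :: "'a set" where "base \<equiv> KK"
abbreviation b0 :: "('a set, 'e) chart" where "b0 \<equiv> chart_at B base"
abbreviation W :: "'e set" where "W \<equiv> model B"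

lemma proj_one: "proj \<one> = base"
  unfolding proj_def using coset_join3[OF one_closed KK_subgroup] by simp

lemma B: "smooth_manifold B" and B_top: "topspace (mtop B) = lcosets KK"
  and proj_smooth: "smooth_map M B proj"
  and proj_tangent: "g \<in> carrier G \<Longrightarrow> tangent_map M B proj g ` tangent_space M g = tangent_space B (proj g)"
  using homogeneous unfolding homogeneous_space_def proj_def[abs_def] by auto

lemma W: "subspace W" using smooth_manifoldD(2)[OF B] .

lemma B_chart: "d \<in> charts B \<Longrightarrow> is_chart (mtop B) W d" using smooth_manifoldD(3)[OF B] .

lemma base_in: "base \<in> topspace (mtop B)"
proof -
  have "proj \<one> \<in> lcosets KK" unfolding proj_def LCOSETS_def by blast
  then show ?thesis using B_top proj_one by simp
qed

lemma b0: "b0 \<in> charts B" "base \<in> fst b0"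
  using chart_at[OF B base_in] by auto

lemmas b0_chart = B_chart[OF b0(1)]

lemma proj_local:
  assumes "d \<in> charts B" "base \<in> fst d"
  shows "local_c11 M c0 d proj \<one> (coord_deriv c0 d proj \<one>)"
  by (rule smooth_map_local_c11[OF c0_chart B_chart[OF assms(1)] V proj_smooth c0(1) assms(1) c0(2)])
    (use assms proj_one in simp)

text \<open>The differential of \<open>proj\<close> at \<open>\<one>\<close>, from coordinate
  vectors to the tangent vectors of \<open>B\<close> on which the metric is defined.\<close>

definition d_proj :: "'e \<Rightarrow> ('a set, 'e) tvec" where
  "d_proj v = (\<lambda>d. if d \<in> charts B \<and> base \<in> fst d then coord_deriv c0 d proj \<one> v else 0)"

lemma d_proj_b0: "d_proj v b0 = coord_deriv c0 b0 proj \<one> v"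
  using b0 by (simp add: d_proj_def)

lemma tangent_map_proj: "tangent_map M B proj \<one> X = d_proj (X c0)"
  unfolding tangent_map_def d_proj_def proj_one ..

lemma d_proj_tangent: "v \<in> V \<Longrightarrow> d_proj v \<in> tangent_space B base"
proof -
  assume v: "v \<in> V"
  have "tangent_map M B proj \<one> (coord_vector M c0 v \<one>) \<in> tangent_space B (proj \<one>)"
    using proj_tangent[OF one_closed] coord_vector_tangent(1)[OF M c0 v] by blast
  then show ?thesis
    unfolding tangent_map_proj coord_vector_tangent(2)[OF M c0 v] proj_one .
qed

lemma d_proj_surj:
  assumes w: "w \<in> W"
  obtains v where "v \<in> V" "coord_deriv c0 b0 proj \<one> v = w"
proof -
  have "coord_vector B b0 w base \<in> tangent_space B (proj \<one>)"
    using coord_vector_tangent(1)[OF B b0 w] proj_one by simp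
  then obtain X where X: "X \<in> tangent_space M \<one>" "coord_vector B b0 w base = tangent_map M B proj \<one> X"
    using proj_tangent[OF one_closed] by blast
  have "w = d_proj (X c0) b0"
    using coord_vector_tangent(2)[OF B b0 w] X(2) unfolding tangent_map_proj by simp
  with that[of "X c0"] tangent_spaceD(1)[OF X(1) c0] d_proj_b0 show thesis by simp
qed

lemma d_proj_linear:
  assumes "v \<in> V" "w \<in> V"
  shows "d_proj (a *\<^sub>R v + b *\<^sub>R w) = (\<lambda>d. a *\<^sub>R d_proj v d + b *\<^sub>R d_proj w d)"
proof
  fix d
  show "d_proj (a *\<^sub>R v + b *\<^sub>R w) d = a *\<^sub>R d_proj v d + b *\<^sub>R d_proj w d"
  proof (cases "d \<in> charts B \<and> base \<in> fst d")
    case True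
    then have "bounded_linear (coord_deriv c0 d proj \<one>)"
      using proj_local unfolding local_c11_def c11_def by blast
    then interpret L: bounded_linear "coord_deriv c0 d proj \<one>" .
    show ?thesis by (simp add: d_proj_def L.add L.scaleR)
  qed (auto simp: d_proj_def)
qed

text \<open>A local section of \<open>proj\<close> through \<open>\<one>\<close>: the inverse
  function theorem is applied to \<open>proj\<close> along a linear right inverse \<open>L\<close>
  of its differential. It serves to differentiate the action of \<open>K\<close> on \<open>B\<close>
  and to determine the kernel of \<open>d_proj\<close> on \<open>pp\<close>.\<close>

lemma local_section_obtain:
  obtains s L r where "r > 0" "c11 W (\<lambda>y. coord (s y)) L"
    "\<And>y. y \<in> W \<Longrightarrow> norm y < r \<Longrightarrow> s y \<in> fst c0 \<and> proj (s y) \<in> fst b0 \<and> snd b0 (proj (s y)) = snd b0 base + y"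
    "s 0 = \<one>"
proof -
  define D where "D = coord_deriv c0 b0 proj \<one>"
  have l: "local_c11 M c0 b0 proj \<one> D" using proj_local[OF b0] by (simp add: D_def)
  then have D: "bounded_linear D" unfolding local_c11_def c11_def by blast
  obtain L where L: "range L \<subseteq> V" "linear L" "\<And>w. w \<in> D ` V \<Longrightarrow> D (L w) = w"
    using linear_exists_right_inverse_on[OF bounded_linear.linear[OF D] V] by blast
  have DL: "D (L w) = w" if "w \<in> W" for w
    by (rule d_proj_surj[OF that]) (use L(3) D_def in blast)
  have Lb: "bounded_linear L" using L(2) linear_conv_bounded_linear by blast
  have LV: "L w \<in> V" for w using L(1) by blast
  define F where "F w = snd b0 (proj (from_coord (L w))) - snd b0 base" for w
  have fc: "c11 V (\<lambda>y. coord_rep c0 b0 proj (snd c0 \<one> + y) - snd b0 (proj \<one>)) D"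
    using l unfolding local_c11_def by blast
  have "\<exists>r>0::real. \<forall>x\<in>W. norm x < r \<longrightarrow> L x \<in> V" using LV by (intro exI[of _ 1]) simp
  from c11_compose[OF c11_linear[OF Lb] fc W V this]
  have Fc: "c11 W F (\<lambda>w. D (L w))"
    by (simp add: coord_rep_def o_def from_coord_def[symmetric] F_def[abs_def] proj_one)
  obtain r1 where r1: "r1 > 0" "\<And>y. y \<in> V \<Longrightarrow> norm y < r1 \<Longrightarrow> snd c0 \<one> + y \<in> coord_dom c0 b0 proj \<and>
       coord_rep c0 b0 proj (snd c0 \<one> + y) \<in> snd b0 ` fst b0 \<and>
       coord_rep c0 b0 proj (snd c0 \<one> + y) - snd b0 (proj \<one>) \<in> W"
    by (rule local_c11_range[OF c0_chart b0_chart W l]) blast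
  obtain r2 where r2: "r2 > 0" "\<And>y. y \<in> V \<Longrightarrow> norm y < r2 \<Longrightarrow> from_coord y \<in> fst c0 \<and> coord (from_coord y) = y"
    by (rule from_coord_obtain) blast
  have r12: "min r1 r2 > 0" using r1 r2 by simp
  obtain r3 where r3: "r3 > 0" "\<And>w. w \<in> W \<Longrightarrow> norm w < r3 \<Longrightarrow> norm (L w) < min r1 r2"
    using c11_small[OF c11_linear[OF Lb] W r12] by metis
  have FW: "F w \<in> W" if "w \<in> W" "norm w < r3" for w
    using r1(2)[OF LV, of w] r3(2)[OF that] unfolding F_def
    by (simp add: coord_rep_def from_coord_def[symmetric] proj_one)
  have pb: "proj (from_coord (L w)) \<in> fst b0" if "w \<in> W" "norm w < r3" for w
  proof -
    have f: "from_coord (L w) \<in> fst c0" "coord (from_coord (L w)) = L w"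
      using r2(2)[OF LV] r3(2)[OF that] by auto
    have "snd c0 \<one> + L w = snd c0 (from_coord (L w))" using f(2) by (simp add: coord_def algebra_simps)
    then have "snd c0 (from_coord (L w)) \<in> coord_dom c0 b0 proj" using r1(2)[OF LV, of w] r3(2)[OF that] by simp
    then show ?thesis
      using f(1) is_chartD(3)[OF c0_chart] unfolding coord_dom_def inj_on_def by auto
  qed
  have "\<exists>r>0. \<forall>x\<in>W. norm x < r \<longrightarrow> F x \<in> W" using FW r3(1) by blast
  then obtain \<theta> r4 where \<theta>: "c11 W \<theta> (\<lambda>x. x)" "r4 > 0"
    "\<And>y. y \<in> W \<Longrightarrow> norm y < r4 \<Longrightarrow> \<theta> y \<in> W \<and> F (\<theta> y) = y"
    using c11_inverse[OF Fc W DL] by metis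
  obtain r5 where r5: "r5 > 0" "\<And>w. w \<in> W \<Longrightarrow> norm w < r5 \<Longrightarrow> norm (\<theta> w) < r3"
    using c11_small[OF \<theta>(1) W r3(1)] by metis
  define s where "s y = from_coord (L (\<theta> y))" for y
  have \<theta>0: "\<theta> 0 = 0" using \<theta>(1) by (simp add: c11_def)
  show thesis
  proof (rule that[of "min r4 r5" s L])
    show "0 < min r4 r5" using \<theta> r5 by simp
    show "s 0 = \<one>"
      using from_coord_coord[OF c0(2)] \<theta>0 linear_0[OF L(2)] by (simp add: s_def)
    have cs: "coord (s y) = L (\<theta> y)" if "y \<in> W" "norm y < min r4 r5" for y
      using r2(2)[OF LV] r3(2)[of "\<theta> y"] \<theta>(3)[of y] r5(2)[of y] that by (simp add: s_def)
    show "c11 W (\<lambda>y. coord (s y)) L"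
      by (rule c11_cong[OF c11_linear_comp[OF \<theta>(1) Lb W] W _ _ Lb, of "min r4 r5"])
        (use cs \<theta> r5 in auto)
    fix y assume y: "y \<in> W" "norm y < min r4 r5"
    have "F (\<theta> y) = y" using \<theta>(3) y by simp
    then have "snd b0 (proj (s y)) = snd b0 base + y" by (simp add: F_def s_def algebra_simps)
    then show "s y \<in> fst c0 \<and> proj (s y) \<in> fst b0 \<and> snd b0 (proj (s y)) = snd b0 base + y"
      using pb[of "\<theta> y"] r2(2)[OF LV, of "\<theta> y"] r3(2)[of "\<theta> y"] \<theta>(3)[of y] r5(2)[of y] y by (simp add: s_def)
  qed
qed

lemma KK_coset: "k \<in> KK \<Longrightarrow> k <# KK = KK"
  using coset_join3[OF _ KK_subgroup] by blast

lemma KK_carrier: "KK \<subseteq> carrier G" by blast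

lemma action_proj: "k \<in> carrier G \<Longrightarrow> g \<in> carrier G \<Longrightarrow> k <# proj g = proj (k \<otimes> g)"
  unfolding proj_def using lcos_m_assoc[OF KK_carrier] by simp

lemma proj_right: "g \<in> carrier G \<Longrightarrow> k \<in> KK \<Longrightarrow> proj (g \<otimes> k) = proj g"
  unfolding proj_def using lcos_m_assoc[OF KK_carrier, of g k] KK_coset[of k] by simp

lemma proj_conj_by: "k \<in> KK \<Longrightarrow> g \<in> carrier G \<Longrightarrow> proj (conj_by k g) = k <# proj g"
proof -
  assume k: "k \<in> KK" and g: "g \<in> carrier G"
  have "inv k \<in> KK" using subgroup.m_inv_closed[OF KK_subgroup k] .
  then have "proj (conj_by k g) = proj (k \<otimes> g)" unfolding conj_by_def using k g by (intro proj_right) auto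
  then show ?thesis using action_proj k g by simp
qed

lemma proj_eqD: "g \<in> carrier G \<Longrightarrow> g' \<in> carrier G \<Longrightarrow> proj g = proj g' \<Longrightarrow> inv g \<otimes> g' \<in> KK"
proof -
  assume g: "g \<in> carrier G" "g' \<in> carrier G" "proj g = proj g'"
  have "g' \<in> g' <# KK" by (rule lcos_self[OF g(2) KK_subgroup])
  then have "g' \<in> g <# KK" using g(3) by (simp add: proj_def)
  then show ?thesis by (rule subgroup.lcos_module_imp[OF KK_subgroup is_group g(1)])
qed

text \<open>\<open>homogeneous_space\<close> speaks of differentiability of the projection, not of
  the action. Near the base point \<open>k <# x\<close> is \<open>proj (conj_by k (f x))\<close>
  with \<open>f\<close> the local section, a composition of three differentiable maps.\<close>

lemma action_local:
  assumes k: "k \<in> KK" and d: "d \<in> charts B" "base \<in> fst d"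
  obtains L where "local_c11 B b0 d (\<lambda>x. k <# x) base L"
proof -
  have kc: "k \<in> carrier G" using k by blast
  obtain s L r where s: "r > 0" "c11 W (\<lambda>y. coord (s y)) L"
    "\<And>y. y \<in> W \<Longrightarrow> norm y < r \<Longrightarrow> s y \<in> fst c0 \<and> proj (s y) \<in> fst b0 \<and> snd b0 (proj (s y)) = snd b0 base + y"
    "s 0 = \<one>"
    by (rule local_section_obtain) blast
  define f where "f x = s (snd b0 x - snd b0 base)" for x
  have f1: "f base = \<one>" by (simp add: f_def s(4))
  have bW: "snd b0 x \<in> W" if "x \<in> fst b0" for x using is_chartD(4)[OF b0_chart] that by blast
  have rep: "coord_rep b0 c0 f (snd b0 x) = snd c0 (f x)" if "x \<in> fst b0" for x
    using coord_rep_apply[OF b0_chart that] .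
  obtain r' where r': "r' > 0" "\<And>y. y \<in> W \<Longrightarrow> norm y < r' \<Longrightarrow> snd b0 base + y \<in> snd b0 ` fst b0"
    by (rule openin_subspace_ball[OF is_chartD(2)[OF b0_chart] imageI[OF b0(2)] W]) blast
  have near: "snd b0 base + y \<in> coord_dom b0 c0 f \<and>
      coord (s y) = coord_rep b0 c0 f (snd b0 base + y) - snd c0 (f base)"
    if y: "y \<in> W" "norm y < min r r'" for y
  proof -
    obtain x where x: "x \<in> fst b0" "snd b0 base + y = snd b0 x" using r'(2)[of y] y by auto
    have "snd b0 x - snd b0 base = y" using x(2)[symmetric] by simp
    then have fx: "f x = s y" by (simp add: f_def)
    then show ?thesis
      unfolding x(2) rep[OF x(1)] f1 coord_dom_def using s(3)[of y] y x(1) by (auto simp: coord_def)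
  qed
  have pos: "0 < min r r'" using s r' by simp
  have "bounded_linear L" using s(2) by (simp add: c11_def)
  then have "c11 W (\<lambda>y. coord_rep b0 c0 f (snd b0 base + y) - snd c0 (f base)) L"
    by (intro c11_cong[OF s(2) W pos]) (use near in auto)
  then have lf: "local_c11 B b0 c0 f base L"
    unfolding local_c11_def using b0(2) f1 c0(2) near pos by (intro conjI exI[of _ "min r r'"]) auto
  have "local_c11 M c0 c0 (conj_by k) (f base) (Ad k)" using Ad_local[OF kc] f1 by simp
  note l1 = local_c11_compose[OF b0_chart c0_chart W V lf this]
  have "local_c11 M c0 d proj (conj_by k (f base)) (coord_deriv c0 d proj \<one>)"
    using proj_local[OF d] conj_by_one[OF kc] f1 by simp
  note l2 = local_c11_compose[OF b0_chart c0_chart W V l1 this]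
  have eq: "proj (conj_by k (f x)) = k <# x" if x: "x \<in> fst b0" "norm (snd b0 x - snd b0 base) < r" for x
  proof -
    have y: "snd b0 x - snd b0 base \<in> W" using subspace_diff[OF W bW[OF x(1)] bW[OF b0(2)]] .
    have fx: "f x \<in> fst c0" "proj (f x) \<in> fst b0" "snd b0 (proj (f x)) = snd b0 x"
      using s(3)[OF y x(2)] by (simp_all add: f_def)
    have "proj (f x) = x" using is_chartD(3)[OF b0_chart] fx(2,3) x(1) unfolding inj_on_def by blast
    then show ?thesis using proj_conj_by[OF k, of "f x"] fx(1) chart_carrier[OF c0(1)] by auto
  qed
  from local_c11_cong_near[OF l2 s(1) eq b0_chart W] that show thesis by blast
qed

text \<open>Both sides are differentials of the map
  \<open>g \<mapsto> k <# proj g = proj (conj_by k g)\<close>, read once through the action and once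
  through conjugation.\<close>

lemma d_proj_Ad:
  assumes k: "k \<in> KK" and v: "v \<in> V"
  shows "tangent_map B B (\<lambda>x. k <# x) base (d_proj v) = d_proj (Ad k v)"
proof
  fix d
  have kc: "k \<in> carrier G" using k by blast
  show "tangent_map B B (\<lambda>x. k <# x) base (d_proj v) d = d_proj (Ad k v) d"
  proof (cases "d \<in> charts B \<and> base \<in> fst d")
    case True
    then have d: "d \<in> charts B" "base \<in> fst d" by auto
    obtain L where L: "local_c11 B b0 d (\<lambda>x. k <# x) base L" by (rule action_local[OF k d])
    have Dv: "coord_deriv c0 b0 proj \<one> v \<in> W"
      by (rule local_c11_linear_range[OF c0_chart b0_chart V W proj_local[OF b0] v])
    have "local_c11 B b0 d (\<lambda>x. k <# x) (proj \<one>) L" using L proj_one by simp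
    from local_c11_compose[OF c0_chart b0_chart V W proj_local[OF b0] this]
    have l1: "local_c11 M c0 d (\<lambda>x. k <# proj x) \<one> (\<lambda>v. L (coord_deriv c0 b0 proj \<one> v))" .
    have "local_c11 M c0 d proj (conj_by k \<one>) (coord_deriv c0 d proj \<one>)"
      using proj_local[OF d] conj_by_one[OF kc] by simp
    from local_c11_compose[OF c0_chart c0_chart V V Ad_local[OF kc] this]
    have l2: "local_c11 M c0 d (\<lambda>x. proj (conj_by k x)) \<one> (\<lambda>v. coord_deriv c0 d proj \<one> (Ad k v))" .
    have "proj (conj_by k x) = k <# proj x" if "x \<in> fst c0" for x
      using proj_conj_by[OF k] that chart_carrier[OF c0(1)] by blast
    from local_c11_cong[OF l2 this c0_chart V]
    have l3: "local_c11 M c0 d (\<lambda>x. k <# proj x) \<one> (\<lambda>v. coord_deriv c0 d proj \<one> (Ad k v))" by simp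
    have "L (coord_deriv c0 b0 proj \<one> v) = coord_deriv c0 d proj \<one> (Ad k v)"
      using local_c11_coord_deriv[OF c0_chart V l1 v] local_c11_coord_deriv[OF c0_chart V l3 v] by simp
    moreover have "coord_deriv b0 d (\<lambda>x. k <# x) base (coord_deriv c0 b0 proj \<one> v) = L (coord_deriv c0 b0 proj \<one> v)"
      by (rule local_c11_coord_deriv[OF b0_chart W L Dv])
    ultimately show ?thesis
      using d KK_coset[OF k] by (simp add: tangent_map_def d_proj_b0) (simp add: d_proj_def)
  next
    case False
    then show ?thesis using KK_coset[OF k] by (auto simp: tangent_map_def d_proj_def)
  qed
qed

text \<open>A vector of \<open>pp\<close> killed by \<open>d_proj\<close> is tangent to
  \<open>K\<close>: the section over the curve \<open>proj (a t)\<close> has velocity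
  \<open>0\<close>, so dividing \<open>a t\<close> by it leaves a curve in \<open>K\<close> with
  velocity \<open>v\<close>. As \<open>\<sigma>\<close> fixes \<open>K\<close> pointwise,
  \<open>d_sigma v = v\<close>, while \<open>v \<in> pp\<close> says
  \<open>d_sigma v = - v\<close>.\<close>

lemma d_proj_inj:
  assumes v: "v \<in> pp" and z: "d_proj v = (\<lambda>c. 0)"
  shows "v = 0"
proof -
  note vV = pp_V[OF v]
  have Dv: "coord_deriv c0 b0 proj \<one> v = 0" using fun_cong[OF z, of b0] d_proj_b0 by simp
  obtain s L r where s: "r > 0" "c11 W (\<lambda>y. coord (s y)) L"
    "\<And>y. y \<in> W \<Longrightarrow> norm y < r \<Longrightarrow> s y \<in> fst c0 \<and> proj (s y) \<in> fst b0 \<and> snd b0 (proj (s y)) = snd b0 base + y"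
    "s 0 = \<one>"
    by (rule local_section_obtain) blast
  define a where "a t = expo (t *\<^sub>R v)" for t
  have ac: "a t \<in> carrier G" for t using expo_closed[OF subspace_scale[OF V vV]] by (simp add: a_def)
  have ta: "tangent_at_one (at 0) (\<lambda>t. 1 / t) a v"
    using tangent_expo_line[OF vV] by (simp add: a_def[abs_def])
  have tp: "tangent_limit b0 base (at 0) (\<lambda>t. 1 / t) (\<lambda>t. proj (a t)) 0"
    using tangent_limit_map[OF c0_chart V ta proj_local[OF b0]] Dv proj_one by simp
  define y where "y t = snd b0 (proj (a t)) - snd b0 base" for t
  have pev: "\<forall>\<^sub>F t in at 0. proj (a t) \<in> fst b0" using tp by (simp add: tangent_limit_def)
  have yW: "\<forall>\<^sub>F t in at 0. y t \<in> W"
    using pev by (rule eventually_mono)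
      (use is_chartD(4)[OF b0_chart] b0(2) in \<open>unfold y_def, blast intro: subspace_diff[OF W]\<close>)
  have y0: "(y \<longlongrightarrow> 0) (at 0)"
    unfolding y_def using tp LIM_zero unfolding tangent_limit_def by blast
  have sy: "((\<lambda>t. (1 / t) *\<^sub>R y t) \<longlongrightarrow> 0) (at 0)"
    using tp by (simp add: tangent_limit_def y_def)
  have yr: "\<forall>\<^sub>F t in at 0. norm (y t) < r" using order_tendstoD(2)[OF tendsto_norm[OF y0], of r] s(1) by simp
  have L0: "L 0 = 0" using s(2) linear_0 bounded_linear.linear unfolding c11_def by blast
  have "tangent_at_one (at 0) (\<lambda>t. 1 / t) (\<lambda>t. s (y t)) 0"
    unfolding tangent_at_one_iff
  proof (intro conjI)
    show "\<forall>\<^sub>F t in at 0. s (y t) \<in> fst c0" using yW yr by eventually_elim (use s(3) in blast)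
    show "((\<lambda>t. coord (s (y t))) \<longlongrightarrow> 0) (at 0)" by (rule c11_tendsto(1)[OF s(2) W yW y0 sy])
    show "((\<lambda>t. (1 / t) *\<^sub>R coord (s (y t))) \<longlongrightarrow> 0) (at 0)"
      using c11_tendsto(2)[OF s(2) W yW y0 sy] L0 by simp
  qed
  from tangent_at_one_mult[OF tangent_at_one_inv[OF this] ta]
  have tk: "tangent_at_one (at 0) (\<lambda>t. 1 / t) (\<lambda>t. inv (s (y t)) \<otimes> a t) v" by simp
  have ts: "tangent_at_one (at 0) (\<lambda>t. 1 / t) (\<lambda>t. \<sigma> (inv (s (y t)) \<otimes> a t)) (d_sigma v)"
    using tangent_at_one_map[OF tk sigma_local] by simp
  have "\<forall>\<^sub>F t in at 0. \<sigma> (inv (s (y t)) \<otimes> a t) = inv (s (y t)) \<otimes> a t"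
    using pev yW yr
  proof eventually_elim
    case (elim t)
    have st: "s (y t) \<in> fst c0" "proj (s (y t)) \<in> fst b0" "snd b0 (proj (s (y t))) = snd b0 (proj (a t))"
      using s(3)[OF elim(2,3)] by (simp_all add: y_def)
    have "proj (s (y t)) = proj (a t)" using is_chartD(3)[OF b0_chart] st(2,3) elim(1) unfolding inj_on_def by blast
    then show ?case using proj_eqD[of "s (y t)" "a t"] st(1) chart_carrier[OF c0(1)] ac by auto
  qed
  from tangent_limit_unique[OF ts tk this] have "d_sigma v = v" by simp
  then have "v = - v" using v by (simp add: pp_def)
  then show ?thesis by (simp add: eq_neg_iff_add_eq_0 scaleR_2[symmetric])
qed

text \<open>The metric at the base point, pulled back to \<open>V\<close>. It is positive definite
  on \<open>pp\<close> by \<open>d_proj_inj\<close>, and \<open>Ad k\<close> preserves it because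
  \<open>k\<close> fixes the base point.\<close>

definition ip :: "'e \<Rightarrow> 'e \<Rightarrow> real" where "ip v w = h base (d_proj v) (d_proj w)"

lemma metricD:
  assumes "X \<in> tangent_space B base" "Y \<in> tangent_space B base" "Z \<in> tangent_space B base"
  shows "h base X Y = h base Y X"
    "h base (\<lambda>c. a *\<^sub>R X c + b *\<^sub>R Y c) Z = a * h base X Z + b * h base Y Z"
    "X \<noteq> (\<lambda>c. 0) \<Longrightarrow> 0 < h base X X"
proof -
  have *: "(\<forall>X\<in>tangent_space B base. \<forall>Y\<in>tangent_space B base. h base X Y = h base Y X) \<and>
        (\<forall>X\<in>tangent_space B base. \<forall>Y\<in>tangent_space B base. \<forall>Z\<in>tangent_space B base. \<forall>a b.
           h base (\<lambda>c. a *\<^sub>R X c + b *\<^sub>R Y c) Z = a * h base X Z + b * h base Y Z) \<and>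
        (\<forall>X\<in>tangent_space B base. X \<noteq> (\<lambda>c. 0) \<longrightarrow> h base X X > 0)"
    using metric base_in unfolding riemannian_metric_def by blast
  show "h base X Y = h base Y X"
    "h base (\<lambda>c. a *\<^sub>R X c + b *\<^sub>R Y c) Z = a * h base X Z + b * h base Y Z"
    "X \<noteq> (\<lambda>c. 0) \<Longrightarrow> 0 < h base X X"
    using * assms by blast+
qed

lemma ip_sym: "v \<in> V \<Longrightarrow> w \<in> V \<Longrightarrow> ip v w = ip w v"
  unfolding ip_def using metricD(1) d_proj_tangent by blast

lemma ip_linear: "u \<in> V \<Longrightarrow> v \<in> V \<Longrightarrow> w \<in> V \<Longrightarrow> ip (a *\<^sub>R u + b *\<^sub>R v) w = a * ip u w + b * ip v w"
  unfolding ip_def d_proj_linear using metricD(2) d_proj_tangent by blast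

lemma ip_pos: "v \<in> pp \<Longrightarrow> v \<noteq> 0 \<Longrightarrow> 0 < ip v v"
  unfolding ip_def using metricD(3) d_proj_tangent d_proj_inj pp_V by blast

lemma ip_Ad:
  assumes "k \<in> KK" "v \<in> V"
  shows "ip (Ad k v) (Ad k v) = ip v v"
proof -
  have "h (k <# base) (tangent_map B B (\<lambda>y. k <# y) base (d_proj v)) (tangent_map B B (\<lambda>y. k <# y) base (d_proj v))
     = h base (d_proj v) (d_proj v)"
    using invariant assms base_in d_proj_tangent unfolding invariant_metric_def by blast
  then show ?thesis unfolding d_proj_Ad[OF assms] KK_coset[OF assms(1)] ip_def .
qed

end

section \<open>Minimal broken geodesics\<close>

context lie_group_on
begin

text \<open>A product rule for maps whose source is a vector space such as
  \<open>pp \<times> pp\<close> instead of a manifold.\<close>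

lemma c11_coord_mult:
  assumes S: "subspace S" and f: "c11 S (\<lambda>x. coord (f x)) L" and g: "c11 S (\<lambda>x. coord (g x)) K"
    and r: "r > 0" "\<And>x. x \<in> S \<Longrightarrow> norm x < r \<Longrightarrow> f x \<in> fst c0 \<and> g x \<in> fst c0"
  obtains t where "c11 S (\<lambda>x. coord (f x \<otimes> g x)) (\<lambda>x. L x + K x)" "t > 0"
    "\<And>x. x \<in> S \<Longrightarrow> norm x < t \<Longrightarrow> f x \<otimes> g x \<in> fst c0"
proof -
  define m where "m = (\<lambda>(x, y). x \<otimes> y)"
  define cc where "cc = chart_prod c0 c0"
  define D where "D = coord_deriv cc c0 m (\<one>, \<one>)"
  have ch: "is_chart (mtop (prod_manifold M M)) (model (prod_manifold M M)) cc"
    using is_chart_prod[OF c0_chart c0_chart] by (simp add: cc_def)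
  have VV': "subspace (model (prod_manifold M M))" using VV by simp
  have l: "local_c11 (prod_manifold M M) cc c0 m (\<one>, \<one>) D"
    unfolding D_def cc_def m_def
    by (rule smooth_map_local_c11[OF ch[unfolded cc_def] c0_chart VV' mult_smooth chart_prod_mem[OF c0(1,1)] c0(1)])
      (use c0 in auto)
  then have mc: "c11 (V \<times> V) (\<lambda>z. coord_rep cc c0 m (snd cc (\<one>, \<one>) + z) - snd c0 (m (\<one>, \<one>))) D"
    unfolding local_c11_def by simp
  obtain r1 where r1: "r1 > 0" "\<And>z. z \<in> V \<times> V \<Longrightarrow> norm z < r1 \<Longrightarrow> snd cc (\<one>, \<one>) + z \<in> coord_dom cc c0 m"
    using l unfolding local_c11_def by auto
  note fg = c11_Pair[OF f g]
  obtain r2 where r2: "0 < r2" "\<And>x. x \<in> S \<Longrightarrow> norm x < r2 \<Longrightarrow> norm (coord (f x), coord (g x)) < r1"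
    using c11_small[OF fg S r1(1)] by metis
  have VVx: "(coord (f x), coord (g x)) \<in> V \<times> V" if "x \<in> S" "norm x < r" for x
    using r(2)[OF that] coord_in_V by blast
  have shift: "snd cc (\<one>, \<one>) + (coord (f x), coord (g x)) = snd cc (f x, g x)" for x
    by (simp add: cc_def coord_def)
  have g1: "c11 S (\<lambda>x. coord_rep cc c0 m (snd cc (\<one>, \<one>) + (coord (f x), coord (g x))) - snd c0 (m (\<one>, \<one>))) (\<lambda>x. D (L x, K x))"
    by (rule c11_compose[OF fg mc S VV]) (use VVx r(1) in blast)
  have g2: "coord_rep cc c0 m (snd cc (f x, g x)) - snd c0 (m (\<one>, \<one>)) = coord (f x \<otimes> g x)"
    if "x \<in> S" "norm x < r" for x
    using coord_rep_mult[OF c0(1,1), of "f x" "g x" c0] r(2)[OF that] by (simp add: cc_def m_def coord_def)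
  have g3: "bounded_linear (\<lambda>x. L x + K x)" using f g unfolding c11_def by (blast intro: bounded_linear_add)
  have g4: "D (L x, K x) = L x + K x" if x: "x \<in> S" for x
  proof -
    have "L x \<in> V"
      by (rule c11_derivative_range[OF f S closed_subspace[OF V] V r(1) _ x]) (use r(2) coord_in_V in blast)
    moreover have "K x \<in> V"
      by (rule c11_derivative_range[OF g S closed_subspace[OF V] V r(1) _ x]) (use r(2) coord_in_V in blast)
    ultimately show ?thesis
      using mult_deriv_one by (simp add: D_def cc_def m_def)
  qed
  have "c11 S (\<lambda>x. coord (f x \<otimes> g x)) (\<lambda>x. L x + K x)"
    by (rule c11_cong[OF g1[unfolded shift] S r(1) g2 g3 g4])
  moreover have "f x \<otimes> g x \<in> fst c0" if "x \<in> S" "norm x < min r r2" for x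
  proof -
    have "snd cc (f x, g x) \<in> coord_dom cc c0 m"
      using r1(2)[OF VVx r2(2)] that unfolding shift by simp
    then obtain z where z: "snd cc (f x, g x) = snd cc z" "z \<in> fst cc \<inter> m -` fst c0"
      unfolding coord_dom_def by (rule imageE)
    moreover have "(f x, g x) \<in> fst cc" using r(2) that by (simp add: cc_def)
    ultimately have "(f x, g x) = z" using inj_onD[OF is_chartD(3)[OF ch]] by blast
    then show ?thesis using z by (auto simp: m_def)
  qed
  moreover have "min r r2 > 0" using r r2 by simp
  ultimately show thesis using that by blast
qed

end

context symmetric_triple
begin

text \<open>The equation says that \<open>z\<close> and \<open>a \<otimes> b\<close> have the same
  image under \<open>g \<mapsto> g \<otimes> inv (\<sigma> g)\<close>, and the fibres of this map
  are left cosets of \<open>K\<close>.\<close>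

lemma square_factor:
  assumes a: "a \<in> carrier G" "\<sigma> a = inv a" and b: "b \<in> carrier G" "\<sigma> b = inv b"
    and z: "z \<in> carrier G" "\<sigma> z = inv z" and eq: "z \<otimes> z = a \<otimes> (b \<otimes> b) \<otimes> a"
  shows "inv z \<otimes> (a \<otimes> b) \<in> KK"
proof -
  have "\<sigma> (inv z \<otimes> (a \<otimes> b)) = z \<otimes> (inv a \<otimes> inv b)"
    using a b z by (simp add: sigma_mult sigma_inv)
  also have "\<dots> = inv z \<otimes> (z \<otimes> z) \<otimes> (inv a \<otimes> inv b)"
    using z a b by (simp add: m_assoc[symmetric])
  also have "\<dots> = inv z \<otimes> (a \<otimes> (b \<otimes> (b \<otimes> (a \<otimes> (inv a \<otimes> inv b)))))"
    unfolding eq using z a b by (simp add: m_assoc)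
  also have "a \<otimes> (inv a \<otimes> inv b) = inv b" using a b by (simp add: m_assoc[symmetric])
  finally show ?thesis using a b z by simp
qed

lemma ip_bounds:
  obtains c C where "0 < c" "0 \<le> C" "\<And>x. x \<in> pp \<Longrightarrow> c * (norm x)\<^sup>2 \<le> ip x x"
    "\<And>x y. x \<in> pp \<Longrightarrow> y \<in> pp \<Longrightarrow> \<bar>ip x y\<bar> \<le> C * norm x * norm y"
    "continuous_on pp (\<lambda>x. ip x x)"
proof -
  have s: "ip x y = ip y x" if "x \<in> pp" "y \<in> pp" for x y
    using ip_sym that pp_V by simp
  have l: "ip (a *\<^sub>R x + b *\<^sub>R y) z = a * ip x z + b * ip y z" if "x \<in> pp" "y \<in> pp" "z \<in> pp" for x y z a b
    using ip_linear that pp_V by simp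
  show thesis
    by (rule inner_form_bounds[OF pp s l ip_pos]; (assumption | rule that; assumption))
qed

text \<open>Apply \<open>g \<mapsto> \<sigma>(g)\<^sup>-\<^sup>1\<close> to the equation \<open>a b = z k\<close>.\<close>

lemma swap_conjugate:
  assumes ab: "a \<in> carrier G" "\<sigma> a = inv a" "b \<in> carrier G" "\<sigma> b = inv b"
    and z: "z \<in> carrier G" "\<sigma> z = inv z" and z': "z' \<in> carrier G" "\<sigma> z' = inv z'"
    and k: "k \<in> KK" "a \<otimes> b = z \<otimes> k" and k': "k' \<in> KK" "b \<otimes> a = z' \<otimes> k'"
  shows "z' \<otimes> z' = conj_by (inv k) (z \<otimes> z)"
proof -
  have kc: "k \<in> carrier G" "\<sigma> k = k" "k' \<in> carrier G" "\<sigma> k' = k'" using k k' by auto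
  have "b \<otimes> a = inv (\<sigma> (a \<otimes> b))" using ab by (simp add: sigma_mult inv_mult_group)
  also have "\<dots> = inv k \<otimes> z" unfolding k(2) using z kc by (simp add: sigma_mult inv_mult_group)
  finally have e: "z' \<otimes> k' = inv k \<otimes> z" using k'(2) by simp
  \<comment> \<open>The map \<open>g \<mapsto> g \<otimes> inv (\<sigma> g)\<close> sends
    \<open>z' \<otimes> k'\<close> to \<open>z' \<otimes> z'\<close>, and
    \<open>inv k \<otimes> z\<close> to the conjugate of \<open>z \<otimes> z\<close>.\<close>
  have "z' \<otimes> z' = (z' \<otimes> k') \<otimes> inv (\<sigma> (z' \<otimes> k'))"
  proof -
    have "k' \<otimes> (inv k' \<otimes> z') = z'" using kc z' by (simp add: m_assoc[symmetric])
    then show ?thesis using kc z' by (simp add: sigma_mult inv_mult_group m_assoc)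
  qed
  also have "\<dots> = (inv k \<otimes> z) \<otimes> inv (inv k \<otimes> inv z)" unfolding e using kc z by (simp add: sigma_mult sigma_inv)
  also have "\<dots> = conj_by (inv k) (z \<otimes> z)" using kc z by (simp add: conj_by_def inv_mult_group m_assoc)
  finally show ?thesis .
qed

text \<open>\<open>Z (x, y)\<close> is the \<pp>-part of \<open>g = expo x \<otimes> expo y\<close>.
  The map \<open>g \<mapsto> g \<otimes> inv (\<sigma> g)\<close> forgets the \<open>K\<close>-part
  and yields \<open>w = expo x \<otimes> expo (2 *\<^sub>R y) \<otimes> expo x\<close>, so
  \<open>Z\<close> is half the logarithm of \<open>w\<close>, with derivative
  \<open>(x + 2 y + x) / 2\<close>.\<close>

lemma product_log_obtain:
  assumes e: "e > 0"
  obtains Z r where "r > 0" "c11 (pp \<times> pp) Z (\<lambda>(x, y). x + y)"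
    "\<And>x y. x \<in> pp \<Longrightarrow> y \<in> pp \<Longrightarrow> norm (x, y) < r \<Longrightarrow> Z (x, y) \<in> pp \<and> norm (Z (x, y)) < e \<and>
       expo (2 *\<^sub>R Z (x, y)) = expo x \<otimes> (expo y \<otimes> expo y) \<otimes> expo x"
proof -
  obtain lg r1 where lg: "r1 > 0" "c11 V lg (\<lambda>v. v)" "c11 V (\<lambda>v. coord (expo v)) (\<lambda>v. v)"
    "\<And>v. v \<in> V \<Longrightarrow> norm v < r1 \<Longrightarrow> expo v \<in> fst c0 \<and> lg (coord (expo v)) = v"
    "\<And>g. g \<in> fst c0 \<Longrightarrow> norm (coord g) < r1 \<Longrightarrow> lg (coord g) \<in> V \<and> expo (lg (coord g)) = g"
    by (rule log_obtain) blast
  obtain r2 where r2: "r2 > 0" "\<And>v w. v \<in> V \<Longrightarrow> w \<in> V \<Longrightarrow> norm v < r2 \<Longrightarrow> norm w < r2 \<Longrightarrow> expo v = expo w \<Longrightarrow> v = w"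
    by (rule expo_inj_obtain) blast
  define S where "S = pp \<times> pp"
  have S: "subspace S" unfolding S_def by (rule subspace_Times[OF pp pp])
  have near: "\<exists>r>0::real. \<forall>x\<in>S. norm x < r \<longrightarrow> A x \<in> V" if "\<And>x. x \<in> S \<Longrightarrow> A x \<in> V" for A :: "'e \<times> 'e \<Rightarrow> 'e"
    using that by (intro exI[of _ 1]) simp
  have bl1: "bounded_linear (fst :: 'e \<times> 'e \<Rightarrow> 'e)" by (rule bounded_linear_fst)
  have bl2: "bounded_linear (\<lambda>p :: 'e \<times> 'e. 2 *\<^sub>R snd p)"
    by (rule bounded_linear_compose[OF bounded_linear_scaleR_right bounded_linear_snd])
  have S1: "fst p \<in> V" "2 *\<^sub>R snd p \<in> V" if "p \<in> S" for p
    using that pp_V subspace_scale[OF V] by (auto simp: S_def)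
  have c1: "c11 S (\<lambda>p. coord (expo (fst p))) fst"
    using c11_compose[OF c11_linear[OF bl1] lg(3) S V near] S1(1) by simp
  have c2: "c11 S (\<lambda>p. coord (expo (2 *\<^sub>R snd p))) (\<lambda>p. 2 *\<^sub>R snd p)"
    using c11_compose[OF c11_linear[OF bl2] lg(3) S V near] S1(2) by simp
  have d1: "expo (fst p) \<in> fst c0" "expo (2 *\<^sub>R snd p) \<in> fst c0" if p: "p \<in> S" "norm p < r1 / 2" for p
  proof -
    have n: "norm (fst p) < r1" "norm (2 *\<^sub>R snd p) < r1"
      using p(2) norm_fst_le[of "fst p" "snd p"] norm_snd_le[of "snd p" "fst p"] norm_ge_zero[of p] lg(1)
      by (simp_all del: norm_ge_zero)
    show "expo (fst p) \<in> fst c0" "expo (2 *\<^sub>R snd p) \<in> fst c0" using lg(4)[OF S1(1)[OF p(1)] n(1)] lg(4)[OF S1(2)[OF p(1)] n(2)] by auto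
  qed
  have r1h: "r1 / 2 > 0" using lg(1) by simp
  obtain t1 where t1: "c11 S (\<lambda>p. coord (expo (fst p) \<otimes> expo (2 *\<^sub>R snd p))) (\<lambda>p. fst p + 2 *\<^sub>R snd p)" "t1 > 0"
    "\<And>p. p \<in> S \<Longrightarrow> norm p < t1 \<Longrightarrow> expo (fst p) \<otimes> expo (2 *\<^sub>R snd p) \<in> fst c0"
    by (rule c11_coord_mult[OF S c1 c2 r1h]) (use d1 in blast)+
  have m1: "min t1 (r1 / 2) > 0" using t1 r1h by simp
  define w where "w p = expo (fst p) \<otimes> expo (2 *\<^sub>R snd p) \<otimes> expo (fst p)" for p
  obtain t2 where t2: "c11 S (\<lambda>p. coord (w p)) (\<lambda>p. fst p + 2 *\<^sub>R snd p + fst p)" "t2 > 0"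
    "\<And>p. p \<in> S \<Longrightarrow> norm p < t2 \<Longrightarrow> w p \<in> fst c0"
    unfolding w_def by (rule c11_coord_mult[OF S t1(1) c1 m1]) (use d1 t1(3) in auto)
  obtain t3 where t3: "0 < t3" "\<And>p. p \<in> S \<Longrightarrow> norm p < t3 \<Longrightarrow> norm (coord (w p)) < r1"
    using c11_small[OF t2(1) S lg(1)] by metis
  define U where "U p = lg (coord (w p))" for p
  have "\<exists>r>0. \<forall>p\<in>S. norm p < r \<longrightarrow> coord (w p) \<in> V" using t2(2,3) coord_in_V by blast
  from c11_compose[OF t2(1) lg(2) S V this]
  have Uc: "c11 S U (\<lambda>p. fst p + 2 *\<^sub>R snd p + fst p)" by (simp add: U_def[abs_def])
  have Uw: "U p \<in> V" "expo (U p) = w p" if "p \<in> S" "norm p < min t2 t3" for p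
    using lg(5)[OF t2(3) t3(2)] that by (auto simp: U_def)
  interpret ds: bounded_linear d_sigma by (rule bounded_linear_d_sigma)
  \<comment> \<open>\<open>\<sigma>\<close> inverts \<open>w p\<close>, so
    \<open>d_sigma (U p)\<close> and \<open>- U p\<close> have the same exponential. The bound
    \<open>B\<close> keeps both inside the injectivity radius \<open>r2\<close>, whence
    \<open>U p \<in> pp\<close>.\<close>
  obtain B where B: "B > 0" "\<And>x. norm (d_sigma x) \<le> norm x * B" using ds.pos_bounded by blast
  have m2: "min (2 * e) (r2 / (B + 1)) > 0" using e r2 B by simp
  obtain t4 where t4: "0 < t4" "\<And>p. p \<in> S \<Longrightarrow> norm p < t4 \<Longrightarrow> norm (U p) < min (2 * e) (r2 / (B + 1))"
    using c11_small[OF Uc S m2] by metis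
  define Z where "Z p = (1/2) *\<^sub>R U p" for p
  define r where "r = min (min t2 t3) t4"
  show thesis
  proof (rule that[of r Z])
    show "r > 0" using t2 t3 t4 by (simp add: r_def)
    have "(\<lambda>p::'e \<times> 'e. (1/2) *\<^sub>R (fst p + 2 *\<^sub>R snd p + fst p)) = (\<lambda>(x, y). x + y)"
    proof (rule ext, clarify)
      fix x y :: 'e
      have "x + 2 *\<^sub>R y + x = 2 *\<^sub>R (x + y)" by (simp add: scaleR_2 algebra_simps)
      then show "(1/2) *\<^sub>R (fst (x, y) + 2 *\<^sub>R snd (x, y) + fst (x, y)) = x + y" by simp
    qed
    then show "c11 (pp \<times> pp) Z (\<lambda>(x, y). x + y)"
      using c11_linear_comp[OF Uc bounded_linear_scaleR_right[of "1/2"] S] by (simp add: Z_def[abs_def] S_def)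
    fix x y assume xy: "x \<in> pp" "y \<in> pp" "norm (x, y) < r"
    define p where "p = (x, y)"
    have p: "p \<in> S" "norm p < min t2 t3" "norm p < t4" using xy by (auto simp: p_def S_def r_def)
    note Up = Uw[OF p(1,2)]
    have nU: "norm (U p) < 2 * e" "norm (U p) * (B + 1) < r2"
      using t4(2)[OF p(1,3)] B(1) by (simp_all add: pos_less_divide_eq)
    have ex: "expo x \<in> carrier G" "\<sigma> (expo x) = inv (expo x)" "expo y \<in> carrier G" "\<sigma> (expo y) = inv (expo y)"
      using pp_expo xy by auto
    have wp: "w p = expo x \<otimes> (expo y \<otimes> expo y) \<otimes> expo x"
      using expo_double[OF pp_V[OF xy(2)]] by (simp add: w_def p_def)
    have "\<sigma> (w p) = inv (w p)"
      unfolding wp using ex by (simp add: sigma_mult inv_mult_group m_assoc)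
    then have "expo (d_sigma (U p)) = expo (- U p)"
      using sigma_expo[OF Up(1)] expo_minus[OF Up(1)] Up(2) by simp
    moreover have "norm (d_sigma (U p)) < r2 \<and> norm (U p) < r2"
    proof -
      have "norm (U p) * B + norm (U p) < r2" using nU(2) by (simp add: distrib_left)
      moreover have "0 \<le> norm (U p) * B" using B(1) by simp
      ultimately show ?thesis using B(2)[of "U p"] norm_ge_zero[of "U p"] by linarith
    qed
    ultimately have "d_sigma (U p) = - U p"
      using r2(2)[OF d_sigma_in_V[OF Up(1)] subspace_neg[OF V Up(1)]] by simp
    then have "U p \<in> pp" using Up(1) by (simp add: pp_def)
    then have "Z p \<in> pp" using subspace_scale[OF pp] by (simp add: Z_def)
    moreover have "norm (Z p) < e" using nU(1) by (simp add: Z_def)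
    moreover have "expo (2 *\<^sub>R Z p) = w p" using Up(2) by (simp add: Z_def)
    ultimately show "Z (x, y) \<in> pp \<and> norm (Z (x, y)) < e \<and>
       expo (2 *\<^sub>R Z (x, y)) = expo x \<otimes> (expo y \<otimes> expo y) \<otimes> expo x"
      using wp by (simp add: p_def)
  qed
qed

lemma ip_add: "u \<in> pp \<Longrightarrow> v \<in> pp \<Longrightarrow> ip (u + v) (u + v) = ip u u + 2 * ip u v + ip v v"
proof -
  assume uv: "u \<in> pp" "v \<in> pp"
  then have V': "u \<in> V" "v \<in> V" "u + v \<in> V" using pp_V subspace_add[OF V] by auto
  have l: "ip (x + y) z = ip x z + ip y z" if "x \<in> V" "y \<in> V" "z \<in> V" for x y z
    using ip_linear[OF that, of 1 1] by simp
  have "ip (u + v) (u + v) = ip (u + v) u + ip (u + v) v"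
    using l[OF V'(1,2,3)] ip_sym[OF V'(1,3)] ip_sym[OF V'(2,3)] by linarith
  also have "\<dots> = (ip u u + ip v u) + (ip u v + ip v v)" using l[OF V'(1,2,1)] l[OF V'(1,2,2)] by linarith
  finally show ?thesis using ip_sym[OF V'(2,1)] by linarith
qed

lemma ip_scale: "u \<in> pp \<Longrightarrow> ip (a *\<^sub>R u) (a *\<^sub>R u) = a\<^sup>2 * ip u u"
proof -
  assume u: "u \<in> pp"
  then have V': "u \<in> V" "a *\<^sub>R u \<in> V" using pp_V subspace_scale[OF V] by auto
  have l: "ip (a *\<^sub>R x) z = a * ip x z" if "x \<in> V" "z \<in> V" for x z
    using ip_linear[OF that(1,1,2), of a 0] by simp
  show ?thesis using l[OF V'(1,2)] l[OF V'(1,1)] ip_sym[OF V'] by (simp add: power2_eq_square)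
qed

text \<open>With \<open>a\<close> the mean of \<open>x\<close> and \<open>y\<close> and
  \<open>d\<close> half their difference, the right-hand side is \<open>4 |a|^2 + 4 |d|^2\<close>,
  while \<open>z\<close> is close to \<open>2 a\<close>. So the excess of \<open>|z|^2\<close> over
  \<open>4 |a|^2\<close> has to be kept below \<open>4 |d|^2\<close>.\<close>

lemma two_step:
  obtains r where "r > 0"
    "\<And>x y. x \<in> pp \<Longrightarrow> y \<in> pp \<Longrightarrow> norm x < r \<Longrightarrow> norm y < r \<Longrightarrow> x \<noteq> y \<Longrightarrow>
      \<exists>z\<in>pp. \<exists>k\<in>KK. expo x \<otimes> expo y = expo z \<otimes> k \<and> ip z z < 2 * (ip x x + ip y y)"
proof -
  obtain c I where cI: "0 < c" "0 \<le> I" "\<And>x. x \<in> pp \<Longrightarrow> c * (norm x)\<^sup>2 \<le> ip x x"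
    "\<And>x y. x \<in> pp \<Longrightarrow> y \<in> pp \<Longrightarrow> \<bar>ip x y\<bar> \<le> I * norm x * norm y"
    by (rule ip_bounds) blast
  obtain r1 where r1: "r1 > 0" "\<And>v w. v \<in> V \<Longrightarrow> w \<in> V \<Longrightarrow> norm v < r1 \<Longrightarrow> norm w < r1 \<Longrightarrow> expo v = expo w \<Longrightarrow> v = w"
    by (rule expo_inj_obtain) blast
  text \<open>\<open>e\<close> is chosen such that the \<open>K\<close>-conjugates of \<open>2 Z\<close> stay in the injectivity domain of the exponential.\<close>
  define e where "e = min (r1 / 2) (r1 * sqrt (c / (4 * (I + 1))))"
  have e: "e > 0" using r1 cI by (simp add: e_def)
  have Ad_small: "norm (Ad k (2 *\<^sub>R z)) < r1" if k: "k \<in> KK" and z: "z \<in> pp" "norm z < e" for k z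
  proof -
    have A: "Ad k (2 *\<^sub>R z) \<in> pp" using Ad_pp[OF k] subspace_scale[OF pp z(1)] by blast
    have z2: "2 *\<^sub>R z \<in> pp" using subspace_scale[OF pp z(1)] .
    have "c * (norm (Ad k (2 *\<^sub>R z)))\<^sup>2 \<le> ip (2 *\<^sub>R z) (2 *\<^sub>R z)"
      using cI(3)[OF A] ip_Ad[OF k pp_V[OF z2]] by simp
    also have "\<dots> \<le> I * norm (2 *\<^sub>R z) * norm (2 *\<^sub>R z)" using cI(4)[OF z2 z2] by linarith
    also have "\<dots> = 4 * I * (norm z)\<^sup>2" by (simp add: power2_eq_square)
    also have "\<dots> \<le> 4 * (I + 1) * (norm z)\<^sup>2" by (intro mult_right_mono) auto
    also have "\<dots> < 4 * (I + 1) * (r1 * sqrt (c / (4 * (I + 1))))\<^sup>2"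
      using z(2) cI by (intro mult_strict_left_mono power_strict_mono) (auto simp: e_def)
    also have "\<dots> = c * r1\<^sup>2" using cI by (simp add: power_mult_distrib)
    finally have "(norm (Ad k (2 *\<^sub>R z)))\<^sup>2 < r1\<^sup>2" using cI(1) by simp
    then show ?thesis using r1(1) power2_less_imp_less by force
  qed
  obtain Z r2 where Z: "r2 > 0" "c11 (pp \<times> pp) Z (\<lambda>(x, y). x + y)"
    "\<And>x y. x \<in> pp \<Longrightarrow> y \<in> pp \<Longrightarrow> norm (x, y) < r2 \<Longrightarrow> Z (x, y) \<in> pp \<and> norm (Z (x, y)) < e \<and>
       expo (2 *\<^sub>R Z (x, y)) = expo x \<otimes> (expo y \<otimes> expo y) \<otimes> expo x"
    by (rule product_log_obtain[OF e]) blast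
  define L where "L = (\<lambda>(x, y). x + y :: 'e)"
  \<comment> \<open>The nonlinear part of \<open>Z\<close>. Its derivative is \<open>0\<close>, so
    the first \<open>c11\<close> estimate bounds its Lipschitz constant by a multiple of the
    radius.\<close>
  define \<rho> where "\<rho> p = Z p - L p" for p
  have S: "subspace (pp \<times> pp)" by (rule subspace_Times[OF pp pp])
  have bL: "bounded_linear L"
    unfolding L_def case_prod_unfold by (intro bounded_linear_add bounded_linear_fst bounded_linear_snd)
  have "c11 (pp \<times> pp) \<rho> (\<lambda>p. L p - L p)"
    unfolding \<rho>_def by (rule c11_diff[OF Z(2)[folded L_def] c11_linear[OF bL] S])
  then obtain r3 C where C: "r3 > 0" "C \<ge> 0" "c11_on (pp \<times> pp) r3 C \<rho> (\<lambda>p. 0)"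
    unfolding c11_def by auto
  \<comment> \<open>\<open>32 C\<close> comes from the mixed term \<open>e2\<close> and
    \<open>64 C^2\<close> from the squares in \<open>e3\<close>; the summand 1 makes
    \<open>q\<close> positive and the comparison strict. The bound \<open>r <= c / q\<close> then
    keeps the total error below \<open>c |d|^2\<close>.\<close>
  define q where "q = I * (32 * C + 64 * C * C) + 1"
  have q: "q > 0" using cI C by (simp add: q_def add_nonneg_pos)
  \<comment> \<open>\<open>r1 / 4\<close> keeps \<open>4 a\<close> in the injectivity radius,
    \<open>1\<close> allows \<open>r * r <= r\<close>, and the halves turn bounds on
    \<open>x\<close> and \<open>y\<close> into bounds on the pair.\<close>
  define r where "r = min (min (r1 / 4) 1) (min (min (r2 / 2) (r3 / 2)) (c / q))"
  have r: "r > 0" "r \<le> 1" using cI q r1 Z C by (auto simp: r_def)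
  have fac: "expo x \<otimes> expo y = expo (Z (x, y)) \<otimes> (inv (expo (Z (x, y))) \<otimes> (expo x \<otimes> expo y)) \<and>
       inv (expo (Z (x, y))) \<otimes> (expo x \<otimes> expo y) \<in> KK"
    if "x \<in> pp" "y \<in> pp" "norm (x, y) < r2" for x y
  proof
    note z = Z(3)[OF that]
    note pe = pp_expo[OF that(1)] pp_expo[OF that(2)] pp_expo[OF conjunct1[OF z]]
    show "expo x \<otimes> expo y = expo (Z (x, y)) \<otimes> (inv (expo (Z (x, y))) \<otimes> (expo x \<otimes> expo y))"
      using pe by (simp add: m_assoc[symmetric])
    show "inv (expo (Z (x, y))) \<otimes> (expo x \<otimes> expo y) \<in> KK"
      using z expo_double[of "Z (x, y)"] pp_V pe by (intro square_factor) auto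
  qed
  show thesis
  proof (rule that[OF r(1)])
    fix x y assume xy: "x \<in> pp" "y \<in> pp" "norm x < r" "norm y < r" "x \<noteq> y"
    have nxy: "norm (x, y) < r2" "norm (x, y) < r3" "norm (y, x) < r2" "norm (y, x) < r3"
      using norm_Pair_le[of x y] norm_Pair_le[of y x] xy(3,4) by (auto simp: r_def)
    define a where "a = (1/2) *\<^sub>R (x + y)"
    define d where "d = (1/2) *\<^sub>R (x - y)"
    have ad: "a \<in> pp" "d \<in> pp" using xy subspace_scale[OF pp] subspace_add[OF pp] subspace_diff[OF pp] by (auto simp: a_def d_def)
    have "(1/2::real) *\<^sub>R (x + x) = x" "(1/2::real) *\<^sub>R (y + y) = y" by (rule scaleR_half_double)+
    then have xa: "x = a + d" "y = a - d"
      unfolding a_def d_def by (simp_all add: scaleR_add_right[symmetric] scaleR_right_diff_distrib[symmetric])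
    have na: "norm a < r" unfolding a_def by (rule norm_half_sum_less[OF xy(3,4)])
    have naa: "norm (a, a) < r2" "norm (a, a) < r3" using norm_Pair_le[of a a] na by (auto simp: r_def)
    have d0: "norm d > 0" using xy(5) by (simp add: d_def)
    define z where "z = Z (x, y)"
    define z' where "z' = Z (y, x)"
    define k where "k = inv (expo z) \<otimes> (expo x \<otimes> expo y)"
    define k' where "k' = inv (expo z') \<otimes> (expo y \<otimes> expo x)"
    have z: "z \<in> pp" "norm z < e" using Z(3)[OF xy(1,2) nxy(1)] by (auto simp: z_def)
    have z': "z' \<in> pp" "norm z' < e" using Z(3)[OF xy(2,1) nxy(3)] by (auto simp: z'_def)
    have k: "k \<in> KK" "expo x \<otimes> expo y = expo z \<otimes> k"
      using fac[OF xy(1,2) nxy(1)] unfolding k_def z_def by blast+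
    have k': "k' \<in> KK" "expo y \<otimes> expo x = expo z' \<otimes> k'"
      using fac[OF xy(2,1) nxy(3)] unfolding k'_def z'_def by blast+
    have ik: "inv k \<in> KK" using subgroup.m_inv_closed[OF KK_subgroup k(1)] .
    have z2: "2 *\<^sub>R z \<in> pp" "2 *\<^sub>R z' \<in> pp" using subspace_scale[OF pp] z z' by auto
    \<comment> \<open>The squares are conjugate by \<open>inv k\<close>, and injectivity of
      \<open>expo\<close> transfers this to \<open>z'\<close> and \<open>z\<close>, which therefore
      have the same length.\<close>
    have "expo z' \<otimes> expo z' = conj_by (inv k) (expo z \<otimes> expo z)"
      by (rule swap_conjugate[OF pp_expo[OF xy(1)] pp_expo[OF xy(2)] pp_expo[OF z(1)] pp_expo[OF z'(1)] k k'])
    then have "expo (2 *\<^sub>R z') = expo (Ad (inv k) (2 *\<^sub>R z))"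
      using expo_double[OF pp_V[OF z(1)]] expo_double[OF pp_V[OF z'(1)]] expo_Ad[OF _ pp_V[OF z2(1)], of "inv k"] ik by simp
    moreover have "norm (2 *\<^sub>R z') < r1" using z'(2) by (simp add: e_def)
    ultimately have "2 *\<^sub>R z' = Ad (inv k) (2 *\<^sub>R z)"
      using r1(2)[OF pp_V[OF z2(2)] pp_V[OF Ad_pp[OF ik z2(1)]] _ Ad_small[OF ik z]] by blast
    then have "ip (2 *\<^sub>R z') (2 *\<^sub>R z') = ip (2 *\<^sub>R z) (2 *\<^sub>R z)" using ip_Ad[OF ik pp_V[OF z2(1)]] by simp
    then have ipz: "ip z' z' = ip z z" using ip_scale[OF z(1)] ip_scale[OF z'(1)] by simp
    define u where "u = \<rho> (x, y)"
    define u' where "u' = \<rho> (y, x)"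
    have zu: "z = 2 *\<^sub>R a + u" "z' = 2 *\<^sub>R a + u'"
      by (simp_all add: z_def z'_def u_def u'_def \<rho>_def L_def a_def add.commute)
    have a2: "2 *\<^sub>R a \<in> pp" using subspace_scale[OF pp ad(1)] .
    have upp: "u \<in> pp" "u' \<in> pp"
      using subspace_diff[OF pp z(1) a2] subspace_diff[OF pp z'(1) a2] by (simp_all add: zu)
    have uu: "u + u' \<in> pp" using subspace_add[OF pp upp] .
    \<comment> \<open>Equal factors multiply exactly,
      \<open>expo a \<otimes> expo a = expo (2 *\<^sub>R a)\<close>, so \<open>Z\<close> has no
      nonlinear part on the diagonal.\<close>
    have \<rho>a: "\<rho> (a, a) = 0"
    proof -
      note za = Z(3)[OF ad(1,1) naa(1)]
      have aV: "a \<in> V" using pp_V[OF ad(1)] .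
      have "expo a \<otimes> (expo a \<otimes> expo a) \<otimes> expo a = expo (2 *\<^sub>R (2 *\<^sub>R a))"
        using expo_double[OF aV] expo_double[OF pp_V[OF a2]] expo_closed[OF aV] by (simp add: m_assoc)
      then have "expo (2 *\<^sub>R Z (a, a)) = expo (2 *\<^sub>R (2 *\<^sub>R a))" using za by simp
      moreover have "norm (2 *\<^sub>R Z (a, a)) < r1" using za by (simp add: e_def)
      moreover have "norm (2 *\<^sub>R (2 *\<^sub>R a)) < r1" using na by (simp add: r_def)
      ultimately have "2 *\<^sub>R Z (a, a) = 2 *\<^sub>R (2 *\<^sub>R a)"
        using r1(2)[OF pp_V pp_V] za subspace_scale[OF pp] a2 by blast
      then have "Z (a, a) = 2 *\<^sub>R a" unfolding scaleR_cancel_left by simp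
      then show ?thesis by (simp add: \<rho>_def L_def scaleR_2)
    qed
    have m1: "(x, y) \<in> pp \<times> pp" "(y, x) \<in> pp \<times> pp" "(a, a) \<in> pp \<times> pp" using xy ad by auto
    have bound: "norm (\<rho> p) \<le> 8 * C * r * norm d"
      if p: "p \<in> pp \<times> pp" "norm p < r3" "norm p \<le> 2 * r" "norm (p - (a, a)) \<le> 2 * norm d" for p
    proof -
      have "norm (\<rho> p) \<le> C * (norm p + norm (a, a)) * norm (p - (a, a))"
        using c11_onD(1)[OF C(3) p(1) m1(3) p(2) naa(2)] \<rho>a by simp
      also have "\<dots> \<le> C * (2 * r + 2 * r) * (2 * norm d)"
        using p na norm_Pair_le[of a a] C(2) r(1) by (intro mult_mono mult_left_mono add_mono) auto
      finally show ?thesis by simp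
    qed
    have nd: "norm (d, - d) \<le> 2 * norm d" "norm (- d, d) \<le> 2 * norm d"
      using norm_Pair_le[of d "- d"] norm_Pair_le[of "- d" d] by auto
    have pd: "(x, y) - (a, a) = (d, - d)" "(y, x) - (a, a) = (- d, d)" by (simp_all add: xa)
    have n2: "norm (x, y) \<le> 2 * r" "norm (y, x) \<le> 2 * r"
      using norm_Pair_le[of x y] norm_Pair_le[of y x] xy(3,4) by auto
    have nu: "norm u \<le> 8 * C * r * norm d" "norm u' \<le> 8 * C * r * norm d"
      unfolding u_def u'_def
      using bound[OF m1(1) nxy(2) n2(1)] bound[OF m1(2) nxy(4) n2(2)] nd unfolding pd by auto
    \<comment> \<open>\<open>\<rho>\<close> vanishes at the midpoint \<open>(a, a)\<close> of
      \<open>(x, y)\<close> and \<open>(y, x)\<close>. So \<open>u + u'\<close> is a second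
      difference, bounded quadratically in \<open>d\<close>, although the bounds on \<open>u\<close>
      and \<open>u'\<close> are only linear.\<close>
    have mid: "(1/2) *\<^sub>R ((x, y) + (y, x)) = (a, a)" by (simp add: a_def add.commute)
    have "norm (u + u') \<le> C * (norm ((x, y) - (y, x)))\<^sup>2"
      using c11_onD(2)[OF C(3) m1(1,2) nxy(2,4)] unfolding mid \<rho>a by (simp add: u_def u'_def)
    also have "\<dots> \<le> C * (4 * norm d)\<^sup>2"
    proof -
      have "(x, y) - (y, x) = 2 *\<^sub>R (d, - d)" by (simp add: xa scaleR_2)
      then have "norm ((x, y) - (y, x)) = 2 * norm (d, - d)" by (metis norm_scaleR abs_numeral)
      then have "norm ((x, y) - (y, x)) \<le> 4 * norm d" using nd(1) by linarith
      then show ?thesis using C(2) by (intro mult_left_mono power_mono norm_ge_zero)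
    qed
    finally have nuu: "norm (u + u') \<le> 16 * C * (norm d)\<^sup>2" by (simp add: power_mult_distrib)
    have ipu: "ip w w \<le> I * (64 * C * C * r * (norm d)\<^sup>2)" if w: "w \<in> pp" "norm w \<le> 8 * C * r * norm d" for w
    proof -
      have "norm w * norm w \<le> (8 * C * r * norm d) * (8 * C * r * norm d)"
        using w(2) by (intro mult_mono norm_ge_zero order_trans[OF norm_ge_zero w(2)])
      also have "\<dots> = 64 * C * C * r * r * (norm d)\<^sup>2" by (simp add: power2_eq_square)
      also have "\<dots> \<le> 64 * C * C * r * 1 * (norm d)\<^sup>2"
        using C(2) r by (intro mult_right_mono mult_left_mono) auto
      finally have "I * (norm w * norm w) \<le> I * (64 * C * C * r * 1 * (norm d)\<^sup>2)"
        using cI(2) by (rule mult_left_mono)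
      then show ?thesis using cI(4)[OF w(1,1)] by (simp add: mult.assoc)
    qed
    \<comment> \<open>The mean of the expansions of \<open>ip z z\<close> and
      \<open>ip z' z'\<close>, which are equal; the mixed term then contains only
      \<open>u + u'\<close>.\<close>
    have e1: "ip z z = ip (2 *\<^sub>R a) (2 *\<^sub>R a) + ip (2 *\<^sub>R a) (u + u') + (ip u u + ip u' u') / 2"
    proof -
      have "ip (2 *\<^sub>R a) (u + u') = ip (2 *\<^sub>R a) u + ip (2 *\<^sub>R a) u'"
        using ip_linear[OF pp_V[OF upp(1)] pp_V[OF upp(2)] pp_V[OF a2], of 1 1]
          ip_sym[OF pp_V[OF a2]] pp_V[OF upp(1)] pp_V[OF upp(2)] pp_V[OF uu] by simp
      then show ?thesis using ip_add[OF a2 upp(1)] ip_add[OF a2 upp(2)] ipz unfolding zu by argo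
    qed
    have e2: "ip (2 *\<^sub>R a) (u + u') \<le> I * (32 * C * r * (norm d)\<^sup>2)"
    proof -
      have "ip (2 *\<^sub>R a) (u + u') \<le> I * (norm (2 *\<^sub>R a) * norm (u + u'))"
        using cI(4)[OF a2 uu] by (simp add: mult.assoc)
      also have "\<dots> \<le> I * ((2 * r) * (16 * C * (norm d)\<^sup>2))"
        using na nuu cI(2) r(1) by (intro mult_left_mono mult_mono) auto
      finally show ?thesis by (simp add: mult_ac)
    qed
    have e3: "(ip u u + ip u' u') / 2 \<le> I * (64 * C * C * r * (norm d)\<^sup>2)"
    proof -
      have "(s + t) / 2 \<le> m" if "s \<le> m" "t \<le> m" for s t m :: real using that by simp
      from this[OF ipu[OF upp(1) nu(1)] ipu[OF upp(2) nu(2)]] show ?thesis .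
    qed
    have e4: "ip (2 *\<^sub>R a) (2 *\<^sub>R a) = 4 * ip a a" using ip_scale[OF ad(1), of 2] by simp
    have e5: "I * (32 * C * r * (norm d)\<^sup>2) + I * (64 * C * C * r * (norm d)\<^sup>2) =
        r * (I * (32 * C + 64 * C * C)) * (norm d)\<^sup>2"
      by (simp add: algebra_simps)
    have "ip z z \<le> 4 * ip a a + r * (I * (32 * C + 64 * C * C)) * (norm d)\<^sup>2"
    proof -
      have "z0 \<le> a0 + m0" if "z0 = s + t + w" "t \<le> m1" "w \<le> m2" "s = a0" "m1 + m2 = m0"
        for z0 s t w m1 m2 a0 m0 :: real using that by simp
      from this[OF e1 e2 e3 e4 e5] show ?thesis .
    qed
    also have "\<dots> < 4 * ip a a + c * (norm d)\<^sup>2"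
    proof -
      have "r * (I * (32 * C + 64 * C * C)) < r * q" using r(1) by (simp add: q_def)
      also have "r * q \<le> c"
      proof -
        have "r \<le> c / q" by (simp add: r_def)
        then show ?thesis using q by (simp add: pos_le_divide_eq)
      qed
      finally have "r * (I * (32 * C + 64 * C * C)) < c" .
      moreover have "0 < (norm d)\<^sup>2" using d0 by simp
      ultimately show ?thesis by (intro add_strict_left_mono mult_strict_right_mono)
    qed
    also have "\<dots> \<le> 4 * ip a a + 4 * ip d d"
    proof -
      have "a0 + s \<le> a0 + 4 * t" if "0 \<le> s" "s \<le> t" for a0 s t :: real using that by simp
      from this[OF _ cI(3)[OF ad(2)]] cI(1) show ?thesis by simp
    qed
    also have "\<dots> = 2 * (ip x x + ip y y)"
    proof -
      have "y = a + - d" using xa by simp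
      moreover have "ip a (- d) = - ip a d"
        using ip_linear[OF pp_V[OF ad(2)] pp_V[OF ad(2)] pp_V[OF ad(1)], of "- 1" 0]
          ip_sym[OF pp_V[OF ad(1)]] pp_V[OF ad(2)] subspace_neg[OF V] by simp
      moreover have "ip (- d) (- d) = ip d d" using ip_scale[OF ad(2), of "- 1"] by simp
      ultimately show ?thesis
        using ip_add[OF ad(1,2)] ip_add[OF ad(1) subspace_neg[OF pp ad(2)]] xa(1) by simp
    qed
    finally have "ip z z < 2 * (ip x x + ip y y)" .
    with z(1) k show "\<exists>z\<in>pp. \<exists>k\<in>KK. expo x \<otimes> expo y = expo z \<otimes> k \<and> ip z z < 2 * (ip x x + ip y y)"
      by blast
  qed
qed

end

section \<open>Products of exponentials and the minimum of the energy\<close>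

context lie_group_on
begin

text \<open>Tuples of factors are encoded as sequences on all of \<open>nat\<close> whose first
  \<open>n\<close> entries matter, so that tuples form a product space of one fixed type.\<close>

primrec expo_prod :: "(nat \<Rightarrow> 'e) \<Rightarrow> nat \<Rightarrow> 'a" where
  "expo_prod x 0 = \<one>"
| "expo_prod x (Suc n) = expo_prod x n \<otimes> expo (x n)"

lemma expo_prod_closed: "(\<And>i. x i \<in> V) \<Longrightarrow> expo_prod x n \<in> carrier G"
  by (induction n) (auto simp: expo_closed)

lemma expo_prod_cong: "(\<And>i. i < n \<Longrightarrow> x i = y i) \<Longrightarrow> expo_prod x n = expo_prod y n"
  by (induction n) auto

lemma expo_prod_const:
  assumes "v \<in> V" "\<And>i. i < n \<Longrightarrow> x i = v"
  shows "expo_prod x n = expo (real n *\<^sub>R v)"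
  using assms(2)
proof (induction n)
  case (Suc n)
  then show ?case using expo_real_add[OF assms(1), of "real n" 1] by (simp add: add.commute)
qed simp

end

context symmetric_triple
begin

text \<open>\<open>R\<close> bounds the square of the length. The invariant form takes the place of
  the Euclidean norm so that \<open>Ad k\<close> maps the ball into itself for \<open>k\<close> in
  \<open>K\<close>.\<close>

definition pp_ball :: "real \<Rightarrow> 'e set" where "pp_ball R = {x \<in> pp. ip x x \<le> R}"

lemma pp_ball_Ad: "k \<in> KK \<Longrightarrow> x \<in> pp_ball R \<Longrightarrow> Ad k x \<in> pp_ball R"
  unfolding pp_ball_def using Ad_pp ip_Ad pp_V by auto

lemma compact_pp_ball: "compact (pp_ball R)"
proof -
  obtain c I where cI: "0 < c" "0 \<le> I" "\<And>x. x \<in> pp \<Longrightarrow> c * (norm x)\<^sup>2 \<le> ip x x"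
    "\<And>x y. x \<in> pp \<Longrightarrow> y \<in> pp \<Longrightarrow> \<bar>ip x y\<bar> \<le> I * norm x * norm y"
    "continuous_on pp (\<lambda>x. ip x x)"
    by (rule ip_bounds) blast
  have "norm x \<le> sqrt (R / c)" if "x \<in> pp_ball R" for x
  proof (rule real_le_rsqrt)
    have "c * (norm x)\<^sup>2 \<le> R" using cI(3)[of x] that by (simp add: pp_ball_def)
    then show "(norm x)\<^sup>2 \<le> R / c" using cI(1) by (simp add: pos_le_divide_eq mult.commute)
  qed
  then have "bounded (pp_ball R)" unfolding bounded_iff by blast
  moreover have "closed (pp_ball R)"
  proof -
    have "closedin (top_of_set pp) (pp \<inter> (\<lambda>x. ip x x) -` {..R})"
      by (rule continuous_closedin_preimage[OF cI(5)]) simp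
    moreover have "pp \<inter> (\<lambda>x. ip x x) -` {..R} = pp_ball R" by (auto simp: pp_ball_def)
    ultimately show ?thesis using closedin_closed_trans closed_subspace[OF pp] by metis
  qed
  ultimately show ?thesis by (simp add: compact_eq_bounded_closed)
qed

lemma KK_closed: "closedin T KK"
proof -
  have "closedin T {x \<in> topspace T. \<sigma> x = id x}"
    by (rule closedin_continuous_maps_eq[OF Hausdorff sigma_continuous]) simp
  then show ?thesis by (simp add: carrier)
qed

text \<open>The products in question form a nonempty set \<open>H\<close> with
  \<open>H N \<subseteq> H\<close> for a neighbourhood \<open>N\<close> of \<open>\<one>\<close>.
  Hence \<open>H\<close> is open, and so is its complement, since \<open>x \<in> H\<close> and
  \<open>inv x \<otimes> g \<in> N\<close> imply \<open>g \<in> H\<close>. Connectedness gives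
  \<open>H = G\<close>.\<close>

lemma generated:
  assumes R: "R > 0" and g: "g \<in> carrier G"
  obtains x n k where "\<And>i. x i \<in> pp_ball R" "k \<in> KK" "g = expo_prod x n \<otimes> k"
proof -
  obtain c I where cI: "0 < c" "0 \<le> I" "\<And>x. x \<in> pp \<Longrightarrow> c * (norm x)\<^sup>2 \<le> ip x x"
    "\<And>x y. x \<in> pp \<Longrightarrow> y \<in> pp \<Longrightarrow> \<bar>ip x y\<bar> \<le> I * norm x * norm y"
    by (rule ip_bounds) blast
  have pV: "z \<in> V" if "z \<in> pp_ball R" for z
    using that pp_V by (auto simp: pp_ball_def)
  obtain r where r: "r > 0" "\<And>v w. v \<in> V \<Longrightarrow> w \<in> V \<Longrightarrow> norm v < r \<Longrightarrow> norm w < r \<Longrightarrow> expo v = expo w \<Longrightarrow> v = w"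
    by (rule expo_inj_obtain) blast
  obtain s where s: "0 < s" "\<And>x. x \<in> V \<Longrightarrow> norm x < s \<Longrightarrow> norm (d_sigma x) < r"
    using c11_small[OF c11_linear[OF bounded_linear_d_sigma] V r(1)] by metis
  \<comment> \<open>\<open>r\<close> and \<open>s\<close> put \<open>z\<close> and
    \<open>d_sigma z\<close> into the injectivity radius, so that \<open>z \<in> pp\<close> can be
    concluded; the square root yields \<open>ip z z <= R\<close>.\<close>
  define e where "e = min (min r s) (sqrt (R / (I + 1)))"
  have e: "e > 0" using r s R cI by (simp add: e_def)
  obtain N0 where N0: "openin T N0" "\<one> \<in> N0"
    "\<And>g. g \<in> N0 \<Longrightarrow> \<sigma> g = inv g \<Longrightarrow> \<exists>z\<in>V. norm z < e \<and> g = expo z \<otimes> expo z \<and> \<sigma> (expo z) = expo (- z)"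
    by (rule hom_inverted_square_root[OF sigma_hom sigma_continuous e]) blast
  define N where "N = {g \<in> carrier G. g \<otimes> inv (\<sigma> g) \<in> N0}"
  have N: "openin T N" "\<one> \<in> N"
  proof -
    have "continuous_map T T (\<lambda>g. g \<otimes> inv (\<sigma> g))"
      by (intro continuous_map_mult continuous_map_inv sigma_continuous) simp
    from openin_continuous_map_preimage[OF this N0(1)] show "openin T N" by (simp add: N_def carrier)
    show "\<one> \<in> N" using N0(2) by (simp add: N_def)
  qed
  \<comment> \<open>\<open>g \<otimes> inv (\<sigma> g)\<close> is near \<open>\<one>\<close> and
    inverted by \<open>\<sigma>\<close>, so it has a square root \<open>expo z\<close> with
    \<open>z \<in> pp\<close>; dividing \<open>g\<close> by it on the left leaves an element of
    \<open>K\<close>.\<close>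
  have factor: "\<exists>z\<in>pp_ball R. \<exists>k\<in>KK. g = expo z \<otimes> k" if gN: "g \<in> N" for g
  proof -
    have gc: "g \<in> carrier G" "g \<otimes> inv (\<sigma> g) \<in> N0" using gN by (auto simp: N_def)
    have "\<sigma> (g \<otimes> inv (\<sigma> g)) = inv (g \<otimes> inv (\<sigma> g))"
      using gc(1) sigma_closed sigma_sigma by (simp add: sigma_mult sigma_inv inv_mult_group)
    then obtain z where z: "z \<in> V" "norm z < e" "g \<otimes> inv (\<sigma> g) = expo z \<otimes> expo z" "\<sigma> (expo z) = expo (- z)"
      using N0(3)[OF gc(2)] by blast
    have "expo (d_sigma z) = expo (- z)" using sigma_expo[OF z(1)] z(4) by simp
    then have "d_sigma z = - z"
      using r(2)[OF d_sigma_in_V[OF z(1)] subspace_neg[OF V z(1)] s(2)[OF z(1)]] z(2) by (simp add: e_def)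
    then have zp: "z \<in> pp" using z(1) by (simp add: pp_def)
    have "ip z z \<le> I * (norm z)\<^sup>2" using cI(4)[OF zp zp] by (simp add: power2_eq_square mult.assoc)
    also have "\<dots> \<le> (I + 1) * (norm z)\<^sup>2" by (intro mult_right_mono) auto
    also have "\<dots> \<le> (I + 1) * (sqrt (R / (I + 1)))\<^sup>2"
      using z(2) cI(2) by (intro mult_left_mono power_mono) (auto simp: e_def)
    also have "\<dots> = R" using R cI(2) by simp
    finally have zb: "z \<in> pp_ball R" using zp by (simp add: pp_ball_def)
    define k where "k = inv (expo z) \<otimes> g"
    note ez = pp_expo[OF zp]
    have kc: "k \<in> carrier G" using ez gc by (simp add: k_def)
    have "\<sigma> k = expo z \<otimes> \<sigma> g" using ez gc by (simp add: k_def sigma_mult sigma_inv)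
    also have "\<dots> = inv (expo z) \<otimes> ((expo z \<otimes> expo z) \<otimes> \<sigma> g)"
      using ez gc sigma_closed by (simp add: m_assoc[symmetric])
    also have "\<dots> = k" unfolding z(3)[symmetric] using gc sigma_closed by (simp add: k_def m_assoc)
    finally have "k \<in> KK" using kc by simp
    moreover have "g = expo z \<otimes> k" using ez gc by (simp add: k_def m_assoc[symmetric])
    ultimately show ?thesis using zb by blast
  qed
  define H where "H = {g. \<exists>x n k. (\<forall>i. x i \<in> pp_ball R) \<and> k \<in> KK \<and> g = expo_prod x n \<otimes> k}"
  have Hc: "H \<subseteq> carrier G"
  proof
    fix g assume "g \<in> H"
    then obtain x n k where x: "\<And>i. x i \<in> pp_ball R" "k \<in> KK" "g = expo_prod x n \<otimes> k" unfolding H_def by blast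
    have "expo_prod x n \<in> carrier G" using expo_prod_closed[of x n] pV[OF x(1)] by blast
    then show "g \<in> carrier G" using x(2,3) by simp
  qed
  have HN: "g \<otimes> a \<in> H" if gH: "g \<in> H" and aN: "a \<in> N" for g a
  proof -
    obtain x n k where x: "\<And>i. x i \<in> pp_ball R" "k \<in> KK" "g = expo_prod x n \<otimes> k" using gH unfolding H_def by blast
    obtain z k' where z: "z \<in> pp_ball R" "k' \<in> KK" "a = expo z \<otimes> k'" using factor[OF aN] by blast
    \<comment> \<open>\<open>k \<otimes> expo z = expo (Ad k z) \<otimes> k\<close> moves the new
      factor past the old \<open>k\<close>.\<close>
    define y where "y = x(n := Ad k z)"
    have y: "y i \<in> pp_ball R" for i using x(1) pp_ball_Ad[OF x(2) z(1)] by (simp add: y_def)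
    have zV: "z \<in> V" using z(1) pp_V by (simp add: pp_ball_def)
    have kc: "k \<in> carrier G" "k' \<in> carrier G" using x z by auto
    have pc: "expo_prod x n \<in> carrier G" using expo_prod_closed[of x n] pV[OF x(1)] by blast
    have "expo_prod y (Suc n) = expo_prod x n \<otimes> conj_by k (expo z)"
      using expo_prod_cong[of n y x] expo_Ad[OF kc(1) zV] by (simp add: y_def)
    then have "expo_prod y (Suc n) \<otimes> (k \<otimes> k') = expo_prod x n \<otimes> (k \<otimes> (expo z \<otimes> (inv k \<otimes> (k \<otimes> k'))))"
      using pc kc expo_closed[OF zV] by (simp add: conj_by_def m_assoc)
    also have "inv k \<otimes> (k \<otimes> k') = k'" using kc by (simp add: m_assoc[symmetric])
    also have "expo_prod x n \<otimes> (k \<otimes> (expo z \<otimes> k')) = g \<otimes> a"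
      using pc kc expo_closed[OF zV] by (simp add: x(3) z(3) m_assoc)
    finally have "g \<otimes> a = expo_prod y (Suc n) \<otimes> (k \<otimes> k')" ..
    moreover have "k \<otimes> k' \<in> KK" using subgroup.m_closed[OF KK_subgroup x(2) z(2)] .
    ultimately show ?thesis unfolding H_def using y by blast
  qed
  have tr: "openin T {x \<in> carrier G. f x \<in> N}" if "continuous_map T T f" for f
    using openin_continuous_map_preimage[OF that N(1)] by (simp add: carrier)
  have opH: "openin T H"
    unfolding openin_subopen[of T H]
  proof
    fix g assume gH: "g \<in> H"
    then have gc: "g \<in> carrier G" using Hc by blast
    define U where "U = {x \<in> carrier G. inv g \<otimes> x \<in> N}"
    have "openin T U" unfolding U_def by (intro tr continuous_map_mult) (use gc carrier in simp_all)
    moreover have "g \<in> U" using gc N(2) by (simp add: U_def)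
    moreover have "U \<subseteq> H"
    proof
      fix x assume "x \<in> U"
      then have x: "x \<in> carrier G" "inv g \<otimes> x \<in> N" by (auto simp: U_def)
      have "g \<otimes> (inv g \<otimes> x) = x" using x gc by (simp add: m_assoc[symmetric])
      then show "x \<in> H" using HN[OF gH x(2)] by simp
    qed
    ultimately show "\<exists>U. openin T U \<and> g \<in> U \<and> U \<subseteq> H" by blast
  qed
  have "openin T (carrier G - H)"
    unfolding openin_subopen[of T "carrier G - H"]
  proof
    fix g assume g: "g \<in> carrier G - H"
    define U where "U = {x \<in> carrier G. inv x \<otimes> g \<in> N}"
    have "openin T U" unfolding U_def by (intro tr continuous_map_mult continuous_map_inv) (use g carrier in simp_all)
    moreover have "g \<in> U" using g N(2) by (simp add: U_def)
    moreover have "U \<subseteq> carrier G - H"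
    proof
      fix x assume "x \<in> U"
      then have x: "x \<in> carrier G" "inv x \<otimes> g \<in> N" by (auto simp: U_def)
      have "x \<otimes> (inv x \<otimes> g) = g" using x g by (simp add: m_assoc[symmetric])
      then have "x \<notin> H" using HN[of x, OF _ x(2)] g by auto
      then show "x \<in> carrier G - H" using x by blast
    qed
    ultimately show "\<exists>U. openin T U \<and> g \<in> U \<and> U \<subseteq> carrier G - H" by blast
  qed
  then have clH: "closedin T H" unfolding closedin_def using Hc carrier by simp
  have "ip 0 0 = 0" using ip_scale[OF subspace_0[OF pp], of 0] by simp
  then have "0 \<in> pp_ball R" using R subspace_0[OF pp] by (simp add: pp_ball_def)
  moreover have "\<one> \<in> KK" by simp
  moreover have "\<one> = expo_prod (\<lambda>i. 0) 0 \<otimes> \<one>" by simp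
  ultimately have "\<one> \<in> H"
    unfolding H_def mem_Collect_eq by (intro exI[of _ "\<lambda>i. 0"] exI[of _ 0] exI[of _ \<one>]) simp
  moreover have "H = {} \<or> H = topspace T"
    using connected opH clH unfolding connected_space_clopen_in by blast
  ultimately have "g \<in> H" using g carrier by blast
  then obtain x n k where "\<forall>i. x i \<in> pp_ball R" "k \<in> KK" "g = expo_prod x n \<otimes> k" unfolding H_def by blast
  then show thesis using that[of x k n] by blast
qed

text \<open>At a minimum of the energy two consecutive factors agree: otherwise \<open>exp x\<^sub>i exp x\<^sub>i\<^sub>+\<^sub>1 = exp z k\<close> could be
  replaced by \<open>exp (z/2) exp (z/2) k\<close>, and \<open>k\<close> moved to the right end, with less energy.\<close>

lemma polar_decomposition:
  assumes g: "g \<in> carrier G"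
  obtains v k where "v \<in> pp" "k \<in> KK" "g = expo v \<otimes> k"
proof -
  obtain r where r: "r > 0"
    "\<And>x y. x \<in> pp \<Longrightarrow> y \<in> pp \<Longrightarrow> norm x < r \<Longrightarrow> norm y < r \<Longrightarrow> x \<noteq> y \<Longrightarrow>
      \<exists>z\<in>pp. \<exists>k\<in>KK. expo x \<otimes> expo y = expo z \<otimes> k \<and> ip z z < 2 * (ip x x + ip y y)"
    by (rule two_step) blast
  obtain c I where cI: "0 < c" "0 \<le> I" "\<And>x. x \<in> pp \<Longrightarrow> c * (norm x)\<^sup>2 \<le> ip x x"
    "\<And>x y. x \<in> pp \<Longrightarrow> y \<in> pp \<Longrightarrow> \<bar>ip x y\<bar> \<le> I * norm x * norm y"
    "continuous_on pp (\<lambda>x. ip x x)"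
    by (rule ip_bounds) blast
  \<comment> \<open>The factor 1/4 gives the strict bound \<open>norm x < r\<close> on a closed
    ball, as \<open>two_step\<close> requires.\<close>
  define R where "R = c * r\<^sup>2 / 4"
  have R: "R > 0" using cI r by (simp add: R_def)
  have small: "norm x < r" if "x \<in> pp_ball R" for x
  proof -
    have "c * (norm x)\<^sup>2 \<le> c * r\<^sup>2 / 4" using cI(3)[of x] that by (simp add: pp_ball_def R_def)
    also have "\<dots> < c * r\<^sup>2" using cI r by simp
    finally have "(norm x)\<^sup>2 < r\<^sup>2" using cI(1) by simp
    then show ?thesis using r(1) power2_less_imp_less by force
  qed
  have bp: "x \<in> pp" "x \<in> V" if "x \<in> pp_ball R" for x using that pp_V by (auto simp: pp_ball_def)
  obtain x0 n k0 where x0: "\<And>i. x0 i \<in> pp_ball R" "k0 \<in> KK" "g = expo_prod x0 n \<otimes> k0"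
    by (rule generated[OF R g]) (rule that)
  \<comment> \<open>Compact by Tychonoff. The number \<open>n\<close> of factors stays the one found
    for \<open>g\<close>.\<close>
  define X where "X = (UNIV :: nat set) \<rightarrow> pp_ball R"
  have Xi: "x i \<in> pp_ball R" if "x \<in> X" for x i using that by (auto simp: X_def)
  have pc: "expo_prod x m \<in> carrier G" if "x \<in> X" for x m
    using expo_prod_closed[of x m] bp(2)[OF Xi[OF that]] by blast
  have "compact X"
  proof -
    have "compactin (product_topology (\<lambda>i::nat. euclidean) UNIV) (PiE UNIV (\<lambda>i. pp_ball R))"
      unfolding compactin_PiE using compact_pp_ball by simp
    then show ?thesis unfolding X_def PiE_UNIV_domain euclidean_product_topology by simp
  qed
  \<comment> \<open>The admissible tuples. \<open>K\<close> is closed and the products depend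
    continuously on the tuple, so \<open>Y\<close> is closed in \<open>X\<close> and the energy
    attains its minimum.\<close>
  define Y where "Y = {x \<in> X. inv (expo_prod x n) \<otimes> g \<in> KK}"
  have cp: "continuous_map (top_of_set X) T (\<lambda>x. expo_prod x m)" for m
  proof (induction m)
    case 0
    then show ?case by (simp add: carrier)
  next
    case (Suc m)
    have "continuous_map (top_of_set X) (top_of_set V) (\<lambda>x. x m)"
      unfolding continuous_map_in_subtopology continuous_map_iff_continuous
      using continuous_on_subset[OF continuous_on_product_coordinates subset_UNIV] bp(2)[OF Xi] by auto
    from continuous_map_compose[OF this expo_continuous]
    have "continuous_map (top_of_set X) T (\<lambda>x. expo (x m))" by (simp add: o_def)
    with Suc show ?case by (simp add: continuous_map_mult)
  qed
  have "compact Y"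
  proof -
    have "continuous_map (top_of_set X) T (\<lambda>x. inv (expo_prod x n) \<otimes> g)"
      by (intro continuous_map_mult continuous_map_inv cp) (use g carrier in simp)
    from closedin_continuous_map_preimage[OF this KK_closed]
    have "closedin (top_of_set X) Y" by (simp add: Y_def)
    then show ?thesis using closedin_compact[OF \<open>compact X\<close>] by blast
  qed
  define E where "E x = (\<Sum>i<n. ip (x i) (x i))" for x :: "nat \<Rightarrow> 'e"
  have "continuous_on Y E"
    unfolding E_def
  proof (intro continuous_on_sum)
    fix i
    have "continuous_on Y (\<lambda>x. x i)"
      by (rule continuous_on_subset[OF continuous_on_product_coordinates subset_UNIV])
    then show "continuous_on Y (\<lambda>x. ip (x i) (x i))"
      by (rule continuous_on_compose2[OF cI(5)]) (use bp(1)[OF Xi] in \<open>auto simp: Y_def\<close>)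
  qed
  moreover have "x0 \<in> Y"
  proof -
    have x0X: "x0 \<in> X" using x0(1) by (simp add: X_def)
    have "inv (expo_prod x0 n) \<otimes> g = k0"
      using x0(2,3) pc[OF x0X] by (simp add: m_assoc[symmetric])
    then show ?thesis using x0X x0(2) by (simp add: Y_def)
  qed
  ultimately obtain x where x: "x \<in> Y" "\<And>y. y \<in> Y \<Longrightarrow> E x \<le> E y"
    using continuous_attains_inf[OF \<open>compact Y\<close>] by (metis empty_iff)
  have xX: "x \<in> X" and xK: "inv (expo_prod x n) \<otimes> g \<in> KK" using x(1) by (auto simp: Y_def)
  have step: "x i = x (Suc i)" if i: "Suc i < n" for i
  proof (rule ccontr)
    assume ne: "x i \<noteq> x (Suc i)"
    obtain z k where z: "z \<in> pp" "k \<in> KK" "expo (x i) \<otimes> expo (x (Suc i)) = expo z \<otimes> k"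
      "ip z z < 2 * (ip (x i) (x i) + ip (x (Suc i)) (x (Suc i)))"
      using r(2)[OF bp(1)[OF Xi[OF xX]] bp(1)[OF Xi[OF xX]] small[OF Xi[OF xX]] small[OF Xi[OF xX]] ne] by blast
    have kc: "k \<in> carrier G" using z(2) by blast
    define w where "w = (1/2) *\<^sub>R z"
    have w: "w \<in> pp" using subspace_scale[OF pp z(1)] by (simp add: w_def)
    have ipw: "ip w w = ip z z / 4" using ip_scale[OF z(1), of "1/2"] by (simp add: w_def power2_eq_square)
    have ww: "expo w \<otimes> expo w = expo z" using expo_double[OF pp_V[OF w]] by (simp add: w_def)
    \<comment> \<open>Entries after \<open>Suc i\<close> are transformed by \<open>Ad k\<close>, so
      that \<open>k\<close> can travel to the right end; invariance preserves their lengths.\<close>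
    define y where "y j = (if j < i then x j else if j = i \<or> j = Suc i then w else Ad k (x j))" for j
    \<comment> \<open>\<open>ip w w\<close> is less than the mean of the two old values, so the new
      tuple stays in the ball even when the minimum lies on its boundary.\<close>
    have "ip w w \<le> R"
      using z(4) ipw Xi[OF xX, of i] Xi[OF xX, of "Suc i"] by (simp add: pp_ball_def)
    then have wb: "w \<in> pp_ball R" using w by (simp add: pp_ball_def)
    have yX: "y \<in> X" unfolding X_def using Xi[OF xX] pp_ball_Ad[OF z(2) Xi[OF xX]] wb by (auto simp: y_def)
    have prod: "expo_prod y (Suc (Suc i) + m) \<otimes> k = expo_prod x (Suc (Suc i) + m)" for m
    proof (induction m)
      case 0
      have "expo_prod y i = expo_prod x i" by (rule expo_prod_cong) (simp add: y_def)
      then have "expo_prod y (Suc (Suc i)) \<otimes> k = expo_prod x i \<otimes> (expo w \<otimes> expo w \<otimes> k)"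
        using pc[OF xX] kc pp_expo[OF w] by (simp add: y_def m_assoc)
      also have "\<dots> = expo_prod x (Suc (Suc i))"
        unfolding ww z(3)[symmetric] using pc[OF xX] expo_closed[OF bp(2)[OF Xi[OF xX]]] by (simp add: m_assoc)
      finally show ?case by simp
    next
      case (Suc m)
      define j where "j = Suc (Suc i) + m"
      have yj: "y j = Ad k (x j)" by (simp add: y_def j_def)
      have xj: "expo (x j) \<in> carrier G" using expo_closed[OF bp(2)[OF Xi[OF xX]]] .
      have "expo_prod y (Suc j) \<otimes> k = expo_prod y j \<otimes> (k \<otimes> (expo (x j) \<otimes> (inv k \<otimes> k)))"
        using pc[OF yX] kc xj expo_Ad[OF kc bp(2)[OF Xi[OF xX]]] by (simp add: yj conj_by_def m_assoc)
      also have "\<dots> = (expo_prod y j \<otimes> k) \<otimes> expo (x j)" using pc[OF yX] kc xj by (simp add: m_assoc)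
      also have "\<dots> = expo_prod x (Suc j)" using Suc.IH by (simp add: j_def)
      finally show ?case by (simp add: j_def)
    qed
    obtain m where m: "n = Suc (Suc i) + m" using i by (metis less_imp_Suc_add add_Suc add_Suc_right)
    have "inv (expo_prod x n) \<otimes> g = inv k \<otimes> (inv (expo_prod y n) \<otimes> g)"
      unfolding prod[of m, folded m, symmetric] using pc[OF yX] kc g by (simp add: inv_mult_group m_assoc)
    then have "inv (expo_prod y n) \<otimes> g = k \<otimes> (inv (expo_prod x n) \<otimes> g)"
      using pc[OF yX] kc g by (simp add: m_assoc[symmetric])
    then have "y \<in> Y" using yX subgroup.m_closed[OF KK_subgroup z(2) xK] by (simp add: Y_def)
    then have le: "E x \<le> E y" by (rule x(2))
    define A where "A = {..<n} - {i, Suc i}"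
    have split: "E u = (\<Sum>j\<in>A. ip (u j) (u j)) + (ip (u i) (u i) + ip (u (Suc i)) (u (Suc i)))" for u
    proof -
      have "{i, Suc i} \<subseteq> {..<n}" using i by auto
      from sum.subset_diff[OF this finite_lessThan, of "\<lambda>j. ip (u j) (u j)"] show ?thesis by (simp add: E_def A_def)
    qed
    have "(\<Sum>j\<in>A. ip (y j) (y j)) = (\<Sum>j\<in>A. ip (x j) (x j))"
    proof (rule sum.cong[OF refl])
      fix j assume "j \<in> A"
      then show "ip (y j) (y j) = ip (x j) (x j)"
        using ip_Ad[OF z(2) bp(2)[OF Xi[OF xX]]] by (auto simp: A_def y_def)
    qed
    \<comment> \<open>The two new entries together contribute \<open>ip z z / 2\<close>, less than
      the two old ones.\<close>
    then have "E y < E x" unfolding split[of x] split[of y] using z(4) ipw by (simp add: y_def)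
    with le show False by simp
  qed
  have all: "x i = x 0" if "i < n" for i
    using that
  proof (induction i)
    case (Suc i)
    then show ?case using step[of i] by simp
  qed simp
  have "expo_prod x n = expo (real n *\<^sub>R x 0)"
    by (rule expo_prod_const[OF bp(2)[OF Xi[OF xX]] all])
  moreover have "g = expo_prod x n \<otimes> (inv (expo_prod x n) \<otimes> g)" using pc[OF xX] g by (simp add: m_assoc[symmetric])
  ultimately show thesis
    using that[OF subspace_scale[OF pp bp(1)[OF Xi[OF xX]]] xK] by metis
qed

lemma QQ_subset_expo_pp: "QQ \<subseteq> expo ` pp"
proof
  fix x assume "x \<in> QQ"
  then obtain g where g: "g \<in> carrier G" "x = g \<otimes> inv (\<sigma> g)" by blast
  obtain v k where v: "v \<in> pp" "k \<in> KK" "g = expo v \<otimes> k" by (rule polar_decomposition[OF g(1)])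
  note ev = pp_expo[OF v(1)]
  have kc: "k \<in> carrier G" "\<sigma> k = k" using v(2) by auto
  have "k \<otimes> (inv k \<otimes> expo v) = expo v" using kc ev by (simp add: m_assoc[symmetric])
  then have "x = expo v \<otimes> expo v"
    using g(2) v(3) ev kc by (simp add: sigma_mult inv_mult_group m_assoc)
  then have "x = expo (2 *\<^sub>R v)" using expo_double[OF pp_V[OF v(1)]] by simp
  then show "x \<in> expo ` pp" using subspace_scale[OF pp v(1)] by blast
qed

end

theorem theorem2p5:
  fixes G :: "('a, 'b) monoid_scheme"
    and M :: "('a, 'e::euclidean_space) manifold"
    and \<sigma> :: "'a \<Rightarrow> 'a" and K :: "'a set"
    and \<pp> :: "('a, 'e) tvec set"
    and P Q R R2 R0 R0' :: "'a set"
  assumes "riemannian_symmetric_triple G M \<sigma> K"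
  defines "\<pp> \<equiv> differential_eigenspace G M \<sigma> (- 1)"
  defines "P \<equiv> lie_exp G M ` \<pp>"
    and "Q \<equiv> {g \<otimes>\<^bsub>G\<^esub> inv\<^bsub>G\<^esub> (\<sigma> g) | g. g \<in> carrier G}"
    and "R \<equiv> {g \<in> carrier G. \<sigma> g = inv\<^bsub>G\<^esub> g}"
  defines "R2 \<equiv> {g [^]\<^bsub>G\<^esub> (2::nat) | g. g \<in> R}"
    and "R0 \<equiv> connected_component_of_set (subtopology (mtop M) R) \<one>\<^bsub>G\<^esub>"
    and "R0' \<equiv> path_component_of_set (subtopology (mtop M) R) \<one>\<^bsub>G\<^esub>"
  shows "P = Q \<and> Q = R0 \<and> R0 = R0' \<and> R0' = R2"
proof -
  have lie: "lie_group G M" and conn: "connected_space (mtop M)" and inv: "lie_involution G M \<sigma>"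
    and K: "K = {g \<in> carrier G. \<sigma> g = g}"
    using assms(1) unfolding riemannian_symmetric_triple_def by auto
  obtain B h where Bh: "homogeneous_space G M K B" "riemannian_metric B h" "invariant_metric G B h"
    using assms(1) unfolding riemannian_symmetric_triple_def by auto
  interpret group G using lie unfolding lie_group_def by blast
  interpret symmetric_triple G M \<sigma> B h
    by unfold_locales (use lie conn inv Bh K in simp_all)
  have 1: "P \<subseteq> R2" unfolding P_def \<pp>_def R2_def R_def lie_exp_image by (rule expo_pp_subset_squares)
  have 2: "R2 \<subseteq> Q" unfolding R2_def R_def Q_def by (rule squares_subset_QQ)
  have 3: "Q \<subseteq> P" unfolding P_def \<pp>_def Q_def lie_exp_image by (rule QQ_subset_expo_pp)
  have 4: "Q = R0" unfolding R0_def R_def Q_def by (rule QQ_eq_connected_component[OF conn])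
  have 5: "P \<subseteq> R0'" unfolding P_def \<pp>_def R0'_def R_def lie_exp_image by (rule expo_pp_subset_path_component)
  have 6: "R0' \<subseteq> R0" unfolding R0_def R0'_def by (rule path_component_subset_connected_component_of)
  show ?thesis using 1 2 3 4 5 6 by blast
qed

end
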